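(* The category $\mathbf{Cstab}_{\mathsf m}$ (objects: measurable complete cones; morphisms from $P$ to $Q$: measurable stable functions $f$ from $P$ to $Q$ with $f(\mathcal B P)\subseteq\mathcal B Q$) is cartesian closed. More precisely, for measurable complete cones $P,Q$, the measurable complete cone $P\Rightarrow Q$ together with the evaluation map $\mathrm{Ev}:\mathcal B(P\Rightarrow Q)\times\mathcal B P\to Q$, $\mathrm{Ev}(f,x)=f(x)$, is an object of morphisms (exponential) from $P$ to $Q$: for every measurable complete cone $R$ and every $f\in\mathbf{Cstab}_{\mathsf m}(R\times P,Q)$ there is a unique $g\in\mathbf{Cstab}_{\mathsf m}(R,P\Rightarrow Q)$ with $\mathrm{Ev}(g(z),x)=f(z,x)$ for all $z\in\mathcal B R$, $x\in\mathcal B P$, namely $g(z)=f(z,\cdot)$.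
   Context: A cone is an $\mathbb R_{\ge0}$-semimodule $P$ with a map $\|\cdot\|_P:P\to\mathbb R_{\ge0}$ such that for all $x,x',y,y'\in P$, $\alpha\ge0$: $x+y=x+y'\Rightarrow y=y'$; $\|\alpha x\|_P=\alpha\|x\|_P$; $\|x\|_P=0\Rightarrow x=0$; $\|x+x'\|_P\le\|x\|_P+\|x'\|_P$; $\|x\|_P\le\|x+x'\|_P$. The unit ball is $\mathcal B P=\{x:\|x\|_P\le1\}$. The cone order is $x\le_P x'$ iff $x'=x+y$ for some (necessarily unique) $y$, written $x'-x$. $P$ is complete if every $\le_P$-non-decreasing sequence in $\mathcal B P$ has a least upper bound in $\mathcal B P$. For $f:\mathcal B P\to Q$, $\vec u=(u_1,\dots,u_n)\in P^n$ and $x\in P$ with $x+\sum_iu_i\in\mathcal B P$, set $\Delta^{\epsilon}f(x;\vec u)=\sum_{I\in\mathcal C^\epsilon_n}f(x+\sum_{i\in I}u_i)$ for $\epsilon\in\{+,-\}$, where $\mathcal C^+_n$ (resp. $\mathcal C^-_n$) is the set of subsets $I\subseteq\{1,\dots,n\}$ with $n-|I|$ even (resp. odd). $f$ is pre-stable from $P$ to $Q$ if $\Delta^-f(x;\vec u)\le_Q\Delta^+f(x;\vec u)$ for all $n\ge1$ and all such $\vec u,x$. For complete cones, $f$ is Scott-continuous if it is bounded ($f(\mathcal B P)\subseteq\{y:\|y\|_Q\le\alpha\}$ for some $\alpha$), non-decreasing, and preserves lubs of non-decreasing sequences in $\mathcal B P$; $f$ is stable if pre-stable and Scott-continuous. For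 a cone $P$, $P'$ denotes the set of linear Scott-continuous maps $P\to\mathbb R_{\ge0}$. A measurable cone is a cone $P$ with sets $\mathcal M_n(P)$ ($n\in\mathbb N$) of functions $l:\mathbb R^n\to P'$ (measurability tests) such that $0\in\mathcal M_n(P)$, $l\circ h\in\mathcal M_p(P)$ whenever $l\in\mathcal M_n(P)$ and $h:\mathbb R^p\to\mathbb R^n$ is measurable, and $\vec r\mapsto l(\vec r)(x)$ is measurable for every $l\in\mathcal M_n(P)$, $x\in P$. A measurable path of arity $n$ in $P$ is $\gamma:\mathbb R^n\to P$ with bounded image such that for all $k$ and $l\in\mathcal M_k(P)$ the map $(\vec r,\vec s)\mapsto l(\vec r)(\gamma(\vec s))$, $\mathbb R^{k+n}\to\mathbb R_{\ge0}$, is measurable. A stable function $f$ from $P$ to $Q$ (measurable complete cones) is measurable if $f\circ\gamma$ is a measurable path in $Q$ for every measurable path $\gamma$ in $P$ with values in $\mathcal B P$. The product $P_1\times P_2$: componentwise operations, norm $\max(\|x_1\|,\|x_2\|)$, tests $\mathcal M_n(P_1\times P_2)=\{\vec r\mapsto((x_1,x_2)\mapsto l_1(\vec r)(x_1)+l_2(\vec r)(x_2)) : l_i\in\mathcal M_n(P_i)\}$. The cone $P\Rightarrow Q$: carrier the functions $f:\mathcal B P\to Q$ such that $\epsilon f\in\mathbf{Cstab}_{\mathsf m}(P,Q)$ for some $\epsilon>0$, pointwise operations, norm $\sup_{x\in\mathcal B P}\|f(x)\|_Q$, and tests $\mathcal M_n(P\Rightarrow Q)=\{\gamma\triangleright m:\gamma$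 measurable path of arity $n$ in $P$ with values in $\mathcal B P$, $m\in\mathcal M_n(Q)\}$ where $(\gamma\triangleright m)(\vec r)(f)=m(\vec r)(f(\gamma(\vec r)))$. *)

theory Defs
  imports "HOL-Analysis.Analysis" "HOL-Algebra.Module"
begin

section \<open>Cones\<close>

text \<open>
  As for the modules of HOL-Algebra, the fields \<open>mult\<close> and \<open>one\<close> inherited from the
  ring record play no role. The semiring of scalars is the set of non-negative reals;
  \<open>smult\<close> is unspecified on negative scalars.
\<close>

record 'a pcone = "(real, 'a) module" +
  cnorm :: "'a \<Rightarrow> real"

locale pcone = abelian_monoid P for P :: "('a, 'm) pcone_scheme" (structure) +
  assumes smult_closed: "\<lbrakk>0 \<le> a; x \<in> carrier P\<rbrakk> \<Longrightarrow> a \<odot> x \<in> carrier P"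
    and smult_r_distr:
      "\<lbrakk>0 \<le> a; x \<in> carrier P; y \<in> carrier P\<rbrakk> \<Longrightarrow> a \<odot> (x \<oplus> y) = a \<odot> x \<oplus> a \<odot> y"
    and smult_l_distr: "\<lbrakk>0 \<le> a; 0 \<le> b; x \<in> carrier P\<rbrakk> \<Longrightarrow> (a + b) \<odot> x = a \<odot> x \<oplus> b \<odot> x"
    and smult_assoc: "\<lbrakk>0 \<le> a; 0 \<le> b; x \<in> carrier P\<rbrakk> \<Longrightarrow> (a * b) \<odot> x = a \<odot> (b \<odot> x)"
    and smult_one: "x \<in> carrier P \<Longrightarrow> 1 \<odot> x = x"
    and smult_zero_scalar: "x \<in> carrier P \<Longrightarrow> 0 \<odot> x = \<zero>"
    and smult_zero: "0 \<le> a \<Longrightarrow> a \<odot> \<zero> = \<zero>"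
    and add_cancel:
      "\<lbrakk>x \<in> carrier P; y \<in> carrier P; y' \<in> carrier P; x \<oplus> y = x \<oplus> y'\<rbrakk> \<Longrightarrow> y = y'"
    and cnorm_nonneg: "x \<in> carrier P \<Longrightarrow> 0 \<le> cnorm P x"
    and cnorm_smult: "\<lbrakk>0 \<le> a; x \<in> carrier P\<rbrakk> \<Longrightarrow> cnorm P (a \<odot> x) = a * cnorm P x"
    and cnorm_zero: "\<lbrakk>x \<in> carrier P; cnorm P x = 0\<rbrakk> \<Longrightarrow> x = \<zero>"
    and cnorm_triangle:
      "\<lbrakk>x \<in> carrier P; x' \<in> carrier P\<rbrakk> \<Longrightarrow> cnorm P (x \<oplus> x') \<le> cnorm P x + cnorm P x'"
    and cnorm_mono: "\<lbrakk>x \<in> carrier P; x' \<in> carrier P\<rbrakk> \<Longrightarrow> cnorm P x \<le> cnorm P (x \<oplus> x')"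

definition uball :: "('a, 'm) pcone_scheme \<Rightarrow> 'a set" where
  "uball P = {x \<in> carrier P. cnorm P x \<le> 1}"

definition cone_le :: "('a, 'm) pcone_scheme \<Rightarrow> 'a \<Rightarrow> 'a \<Rightarrow> bool"
    (\<open>(_/ \<preceq>\<index> _)\<close> [51, 51] 50) where
  "x \<preceq>\<^bsub>P\<^esub> x' \<longleftrightarrow> x \<in> carrier P \<and> (\<exists>y\<in>carrier P. x' = x \<oplus>\<^bsub>P\<^esub> y)"

definition uball_chain :: "('a, 'm) pcone_scheme \<Rightarrow> (nat \<Rightarrow> 'a) \<Rightarrow> bool" where
  "uball_chain P s \<longleftrightarrow> (\<forall>n. s n \<in> uball P \<and> s n \<preceq>\<^bsub>P\<^esub> s (Suc n))"

text \<open>Least upper bounds are taken in the whole cone, not relative to the unit ball.\<close>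

definition is_lub_seq :: "('a, 'm) pcone_scheme \<Rightarrow> (nat \<Rightarrow> 'a) \<Rightarrow> 'a \<Rightarrow> bool" where
  "is_lub_seq P s u \<longleftrightarrow> u \<in> carrier P \<and> (\<forall>n. s n \<preceq>\<^bsub>P\<^esub> u) \<and>
     (\<forall>v\<in>carrier P. (\<forall>n. s n \<preceq>\<^bsub>P\<^esub> v) \<longrightarrow> u \<preceq>\<^bsub>P\<^esub> v)"

locale complete_pcone = pcone +
  assumes complete: "uball_chain P s \<Longrightarrow> \<exists>u\<in>uball P. is_lub_seq P s u"


section \<open>Pre-stable, Scott-continuous and stable functions\<close>

definition subsets_plus :: "nat \<Rightarrow> nat set set" where
  "subsets_plus n = {I. I \<subseteq> {1..n} \<and> even (n - card I)}"

definition subsets_minus :: "nat \<Rightarrow> nat set set" where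
  "subsets_minus n = {I. I \<subseteq> {1..n} \<and> odd (n - card I)}"

definition Delta_plus ::
  "('a, 'm) pcone_scheme \<Rightarrow> ('b, 'k) pcone_scheme \<Rightarrow> nat \<Rightarrow> ('a \<Rightarrow> 'b) \<Rightarrow> 'a \<Rightarrow> (nat \<Rightarrow> 'a) \<Rightarrow> 'b" where
  "Delta_plus P Q n f x u = (\<Oplus>\<^bsub>Q\<^esub>I\<in>subsets_plus n. f (x \<oplus>\<^bsub>P\<^esub> (\<Oplus>\<^bsub>P\<^esub>i\<in>I. u i)))"

definition Delta_minus ::
  "('a, 'm) pcone_scheme \<Rightarrow> ('b, 'k) pcone_scheme \<Rightarrow> nat \<Rightarrow> ('a \<Rightarrow> 'b) \<Rightarrow> 'a \<Rightarrow> (nat \<Rightarrow> 'a) \<Rightarrow> 'b" where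
  "Delta_minus P Q n f x u = (\<Oplus>\<^bsub>Q\<^esub>I\<in>subsets_minus n. f (x \<oplus>\<^bsub>P\<^esub> (\<Oplus>\<^bsub>P\<^esub>i\<in>I. u i)))"

definition pre_stable ::
  "('a, 'm) pcone_scheme \<Rightarrow> ('b, 'k) pcone_scheme \<Rightarrow> ('a \<Rightarrow> 'b) \<Rightarrow> bool" where
  "pre_stable P Q f \<longleftrightarrow> f \<in> uball P \<rightarrow> carrier Q \<and>
     (\<forall>n\<ge>1. \<forall>u\<in>{1..n} \<rightarrow> carrier P. \<forall>x\<in>carrier P. x \<oplus>\<^bsub>P\<^esub> (\<Oplus>\<^bsub>P\<^esub>i\<in>{1..n}. u i) \<in> uball P \<longrightarrow>
        Delta_minus P Q n f x u \<preceq>\<^bsub>Q\<^esub> Delta_plus P Q n f x u)"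

definition scott_continuous ::
  "('a, 'm) pcone_scheme \<Rightarrow> ('b, 'k) pcone_scheme \<Rightarrow> ('a \<Rightarrow> 'b) \<Rightarrow> bool" where
  "scott_continuous P Q f \<longleftrightarrow> f \<in> uball P \<rightarrow> carrier Q \<and>
     (\<exists>\<alpha>. \<forall>x\<in>uball P. cnorm Q (f x) \<le> \<alpha>) \<and>
     (\<forall>x\<in>uball P. \<forall>y\<in>uball P. x \<preceq>\<^bsub>P\<^esub> y \<longrightarrow> f x \<preceq>\<^bsub>Q\<^esub> f y) \<and>
     (\<forall>s. uball_chain P s \<longrightarrow>
        (\<forall>x\<in>uball P. is_lub_seq P s x \<longrightarrow> is_lub_seq Q (\<lambda>n. f (s n)) (f x)))"

definition stable :: "('a, 'm) pcone_scheme \<Rightarrow> ('b, 'k) pcone_scheme \<Rightarrow> ('a \<Rightarrow> 'b) \<Rightarrow> bool" where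
  "stable P Q f \<longleftrightarrow> pre_stable P Q f \<and> scott_continuous P Q f"

definition nonneg_cone :: "real pcone" where
  "nonneg_cone = \<lparr>carrier = {0..}, mult = (*), one = 1, zero = 0, add = (+), smult = (*),
     cnorm = (\<lambda>x. x)\<rparr>"

definition cone_dual :: "('a, 'm) pcone_scheme \<Rightarrow> ('a \<Rightarrow> real) set" where
  "cone_dual P = {l \<in> carrier P \<rightarrow>\<^sub>E {0..}.
     (\<forall>x\<in>carrier P. \<forall>y\<in>carrier P. l (x \<oplus>\<^bsub>P\<^esub> y) = l x + l y) \<and>
     (\<forall>a\<ge>0. \<forall>x\<in>carrier P. l (a \<odot>\<^bsub>P\<^esub> x) = a * l x) \<and>
     scott_continuous P nonneg_cone l}"


section \<open>Measurable cones\<close>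

text \<open>
  The space \<open>\<real>\<^sup>n\<close>: its points are the functions on \<open>{..<n}\<close>, extended by \<open>undefined\<close>.
\<close>

definition Rn :: "nat \<Rightarrow> (nat \<Rightarrow> real) measure" where
  "Rn n = (\<Pi>\<^sub>M i\<in>{..<n}. borel)"

text \<open>
  Measurability tests, the functionals in \<open>cone_dual P\<close>, and the morphisms below are extensional
  functions, so that their equality is equality on the intended domain.
\<close>

record 'a mcone = "'a pcone" +
  tests :: "nat \<Rightarrow> ((nat \<Rightarrow> real) \<Rightarrow> 'a \<Rightarrow> real) set"

locale measurable_cone = pcone P for P :: "('a, 'm) mcone_scheme" (structure) +
  assumes tests_dual: "tests P n \<subseteq> space (Rn n) \<rightarrow>\<^sub>E cone_dual P"
    and tests_zero: "(\<lambda>r\<in>space (Rn n). \<lambda>x\<in>carrier P. 0) \<in> tests P n"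
    and tests_compose:
      "\<lbrakk>l \<in> tests P n; h \<in> Rn p \<rightarrow>\<^sub>M Rn n\<rbrakk> \<Longrightarrow> compose (space (Rn p)) l h \<in> tests P p"
    and tests_measurable:
      "\<lbrakk>l \<in> tests P n; x \<in> carrier P\<rbrakk> \<Longrightarrow> (\<lambda>r. l r x) \<in> borel_measurable (Rn n)"

locale measurable_complete_cone = measurable_cone P + complete_pcone P
  for P :: "('a, 'm) mcone_scheme" (structure)

text \<open>
  In the last clause the vector \<open>w\<close> of \<open>\<real>\<^bsup>k+n\<^esup>\<close> is split into its first \<open>k\<close> and its last
  \<open>n\<close> coordinates.
\<close>

definition measurable_path :: "('a, 'm) mcone_scheme \<Rightarrow> nat \<Rightarrow> ((nat \<Rightarrow> real) \<Rightarrow> 'a) \<Rightarrow> bool" where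
  "measurable_path P n \<gamma> \<longleftrightarrow> \<gamma> \<in> space (Rn n) \<rightarrow> carrier P \<and>
     (\<exists>\<alpha>. \<forall>s\<in>space (Rn n). cnorm P (\<gamma> s) \<le> \<alpha>) \<and>
     (\<forall>k. \<forall>l\<in>tests P k.
        (\<lambda>w. l (\<lambda>i\<in>{..<k}. w i) (\<gamma> (\<lambda>i\<in>{..<n}. w (k + i)))) \<in> borel_measurable (Rn (k + n)))"

definition uball_paths :: "('a, 'm) mcone_scheme \<Rightarrow> nat \<Rightarrow> ((nat \<Rightarrow> real) \<Rightarrow> 'a) set" where
  "uball_paths P n = {\<gamma>. measurable_path P n \<gamma> \<and> \<gamma> \<in> space (Rn n) \<rightarrow> uball P}"

definition measurable_stable ::
  "('a, 'm) mcone_scheme \<Rightarrow> ('b, 'k) mcone_scheme \<Rightarrow> ('a \<Rightarrow> 'b) \<Rightarrow> bool" where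
  "measurable_stable P Q f \<longleftrightarrow> stable P Q f \<and>
     (\<forall>n. \<forall>\<gamma>\<in>uball_paths P n. measurable_path Q n (\<lambda>s. f (\<gamma> s)))"

text \<open>The hom-sets of the category of measurable complete cones.\<close>

definition Cstab :: "('a, 'm) mcone_scheme \<Rightarrow> ('b, 'k) mcone_scheme \<Rightarrow> ('a \<Rightarrow> 'b) set" where
  "Cstab P Q = {f \<in> uball P \<rightarrow>\<^sub>E uball Q. measurable_stable P Q f}"


section \<open>Terminal object, products and function spaces\<close>

definition one_cone :: "unit mcone" where
  "one_cone = \<lparr>carrier = {()}, mult = undefined, one = undefined, zero = (),
     add = (\<lambda>_ _. ()), smult = (\<lambda>_ _. ()), cnorm = (\<lambda>_. 0),
     tests = (\<lambda>n. {\<lambda>r\<in>space (Rn n). \<lambda>_. 0})\<rparr>"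

definition prod_cone :: "'a mcone \<Rightarrow> 'b mcone \<Rightarrow> ('a \<times> 'b) mcone" where
  "prod_cone P Q = \<lparr>carrier = carrier P \<times> carrier Q, mult = undefined, one = undefined,
     zero = (\<zero>\<^bsub>P\<^esub>, \<zero>\<^bsub>Q\<^esub>),
     add = (\<lambda>(x, y) (x', y'). (x \<oplus>\<^bsub>P\<^esub> x', y \<oplus>\<^bsub>Q\<^esub> y')),
     smult = (\<lambda>a (x, y). (a \<odot>\<^bsub>P\<^esub> x, a \<odot>\<^bsub>Q\<^esub> y)),
     cnorm = (\<lambda>(x, y). max (cnorm P x) (cnorm Q y)),
     tests = (\<lambda>n. {\<lambda>r\<in>space (Rn n). \<lambda>(x, y)\<in>carrier P \<times> carrier Q. l r x + m r y | l m.
                     l \<in> tests P n \<and> m \<in> tests Q n})\<rparr>"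

definition fun_cone_carrier :: "'a mcone \<Rightarrow> 'b mcone \<Rightarrow> ('a \<Rightarrow> 'b) set" where
  "fun_cone_carrier P Q = {f \<in> uball P \<rightarrow>\<^sub>E carrier Q.
     \<exists>\<epsilon>>0. (\<lambda>x\<in>uball P. \<epsilon> \<odot>\<^bsub>Q\<^esub> f x) \<in> Cstab P Q}"

definition path_test ::
  "'a mcone \<Rightarrow> 'b mcone \<Rightarrow> nat \<Rightarrow> ((nat \<Rightarrow> real) \<Rightarrow> 'a) \<Rightarrow> ((nat \<Rightarrow> real) \<Rightarrow> 'b \<Rightarrow> real) \<Rightarrow>
     (nat \<Rightarrow> real) \<Rightarrow> ('a \<Rightarrow> 'b) \<Rightarrow> real" where
  "path_test P Q n \<gamma> m = (\<lambda>r\<in>space (Rn n). \<lambda>f\<in>fun_cone_carrier P Q. m r (f (\<gamma> r)))"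

text \<open>
  Functions in the carrier are bounded on the (non-empty) unit ball, so the supremum defining the
  norm is a genuine one.
\<close>

definition fun_cone :: "'a mcone \<Rightarrow> 'b mcone \<Rightarrow> ('a \<Rightarrow> 'b) mcone" where
  "fun_cone P Q = \<lparr>carrier = fun_cone_carrier P Q, mult = undefined, one = undefined,
     zero = (\<lambda>x\<in>uball P. \<zero>\<^bsub>Q\<^esub>),
     add = (\<lambda>f g. \<lambda>x\<in>uball P. f x \<oplus>\<^bsub>Q\<^esub> g x),
     smult = (\<lambda>a f. \<lambda>x\<in>uball P. a \<odot>\<^bsub>Q\<^esub> f x),
     cnorm = (\<lambda>f. SUP x\<in>uball P. cnorm Q (f x)),
     tests = (\<lambda>n. {path_test P Q n \<gamma> m | \<gamma> m. \<gamma> \<in> uball_paths P n \<and> m \<in> tests Q n})\<rparr>"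

definition cone_id :: "'a mcone \<Rightarrow> 'a \<Rightarrow> 'a" where
  "cone_id P = (\<lambda>x\<in>uball P. x)"

definition cone_comp :: "'a mcone \<Rightarrow> ('b \<Rightarrow> 'c) \<Rightarrow> ('a \<Rightarrow> 'b) \<Rightarrow> 'a \<Rightarrow> 'c" where
  "cone_comp P g f = compose (uball P) g f"

definition cone_fst :: "'a mcone \<Rightarrow> 'b mcone \<Rightarrow> 'a \<times> 'b \<Rightarrow> 'a" where
  "cone_fst P Q = (\<lambda>z\<in>uball (prod_cone P Q). fst z)"

definition cone_snd :: "'a mcone \<Rightarrow> 'b mcone \<Rightarrow> 'a \<times> 'b \<Rightarrow> 'b" where
  "cone_snd P Q = (\<lambda>z\<in>uball (prod_cone P Q). snd z)"

definition Ev :: "'a mcone \<Rightarrow> 'b mcone \<Rightarrow> ('a \<Rightarrow> 'b) \<times> 'a \<Rightarrow> 'b" where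
  "Ev P Q = (\<lambda>(f, x)\<in>uball (fun_cone P Q) \<times> uball P. f x)"

definition cone_curry :: "'r mcone \<Rightarrow> 'a mcone \<Rightarrow> ('r \<times> 'a \<Rightarrow> 'b) \<Rightarrow> 'r \<Rightarrow> 'a \<Rightarrow> 'b" where
  "cone_curry R P f = (\<lambda>z\<in>uball R. \<lambda>x\<in>uball P. f (z, x))"

end

theory Submission imports Defs begin

text \<open>
  A function \<open>f\<close> is pre-stable iff, for all increments \<open>u i\<close> with \<open>i\<close> in a finite set \<open>A\<close>, its values
  at the partial sums have a Moebius expansion \<open>f (x + (\<Sum>i\<in>I. u i)) = (\<Sum>J\<subseteq>I. b J)\<close> with
  coefficients \<open>b J\<close> in the cone. This formulation involves no subtraction, and by cancellation the
  coefficients are unique. Composition, evaluation and currying only regroup such expansions.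
  The cone order of the function space is the coefficientwise order, whence least upper bounds in it
  are pointwise. Scott-continuity and measurability pass to differences \<open>h\<close> with \<open>g = f + h\<close> as soon
  as \<open>h\<close> is pre-stable; this gives them for the coefficients of a curried function.
\<close>

text \<open>The obstacle is the order of \<open>fun_cone P Q\<close>: for \<open>f\<close> to lie
  below \<open>g\<close>, the pointwise difference must itself be pre-stable, so a pointwise least
  upper bound is not obviously one for this order. Along a chain of functions, however, each
  coefficient is itself a chain in \<open>uball Q\<close>; completeness of \<open>Q\<close> supplies
  its limit, and the limits sum to the values of the pointwise bound. Currying meets the same
  obstacle from the other side. The coefficients of \<open>z \<mapsto> f (z, _)\<close> arise
  separately for each \<open>x\<close>, and they must be shown to form elements of the function
  space. Their pre-stability in \<open>x\<close> comes from expanding \<open>f\<close> along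
  increments of both arguments at once. For measurability the shape of the tests decides:
  \<open>path_test\<close> feeds one and the same parameter to the path in \<open>P\<close> and to
  the test of \<open>Q\<close>. Independent parameters are therefore packed into
  \<open>Rn (k + n)\<close> and recovered by the two coordinate maps.\<close>

section \<open>Regrouping of finite sums\<close>

context abelian_monoid
begin

lemma finsum_fibres:
  assumes "finite T" "finite B" "\<phi> \<in> T \<rightarrow> B" "\<beta> \<in> T \<rightarrow> carrier G"
  shows "(\<Oplus>t\<in>T. \<beta> t) = (\<Oplus>b\<in>B. \<Oplus>t\<in>{t \<in> T. \<phi> t = b}. \<beta> t)"
proof -
  have T: "T = (\<Union>b\<in>B. {t \<in> T. \<phi> t = b})"
    using assms(3) by auto
  show ?thesis
    by (subst T, rule add.finprod_UN_disjoint)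
      (use assms in \<open>auto simp: pairwise_def disjnt_def\<close>)
qed

lemma finsum_Sigma:
  assumes "finite A" "\<And>i. i \<in> A \<Longrightarrow> finite (B i)"
    "\<And>i j. i \<in> A \<Longrightarrow> j \<in> B i \<Longrightarrow> f i j \<in> carrier G"
  shows "(\<Oplus>i\<in>A. \<Oplus>j\<in>B i. f i j) = (\<Oplus>t\<in>Sigma A B. f (fst t) (snd t))"
proof -
  have "(\<Oplus>t\<in>Sigma A B. f (fst t) (snd t))
      = (\<Oplus>i\<in>A. \<Oplus>t\<in>{t \<in> Sigma A B. fst t = i}. f (fst t) (snd t))"
    using assms by (intro finsum_fibres) auto
  also have "\<dots> = (\<Oplus>i\<in>A. \<Oplus>j\<in>B i. f i j)"
  proof (rule finsum_cong', goal_cases)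
    case (3 i)
    have "{t \<in> Sigma A B. fst t = i} = Pair i ` B i"
      using 3 by auto
    then have "(\<Oplus>t\<in>{t \<in> Sigma A B. fst t = i}. f (fst t) (snd t))
        = (\<Oplus>t\<in>Pair i ` B i. f (fst t) (snd t))"
      by simp
    also have "\<dots> = (\<Oplus>j\<in>B i. f (fst (i, j)) (snd (i, j)))"
      using assms 3 by (intro finsum_reindex) (auto simp: inj_on_def)
    finally show ?case by simp
  qed (use assms in \<open>auto intro!: finsum_closed\<close>)
  finally show ?thesis ..
qed

lemma finsum_swap_dep:
  assumes "finite A" "finite B"
    "\<And>i j. i \<in> A \<Longrightarrow> j \<in> B \<Longrightarrow> rel i j \<Longrightarrow> f i j \<in> carrier G"
  shows "(\<Oplus>i\<in>A. \<Oplus>j\<in>{j \<in> B. rel i j}. f i j) = (\<Oplus>j\<in>B. \<Oplus>i\<in>{i \<in> A. rel i j}. f i j)"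
proof -
  have "(\<Oplus>i\<in>A. \<Oplus>j\<in>{j \<in> B. rel i j}. f i j)
      = (\<Oplus>t\<in>(SIGMA i:A. {j \<in> B. rel i j}). f (fst t) (snd t))"
    using assms by (intro finsum_Sigma) auto
  also have "(SIGMA i:A. {j \<in> B. rel i j}) = prod.swap ` (SIGMA j:B. {i \<in> A. rel i j})"
    by force
  also have "(\<Oplus>t\<in>\<dots>. f (fst t) (snd t))
      = (\<Oplus>t\<in>(SIGMA j:B. {i \<in> A. rel i j}). f (fst (prod.swap t)) (snd (prod.swap t)))"
    using assms by (intro finsum_reindex) (auto simp: inj_on_def)
  also have "\<dots> = (\<Oplus>t\<in>(SIGMA j:B. {i \<in> A. rel i j}). (\<lambda>j i. f i j) (fst t) (snd t))"
    by simp
  also have "\<dots> = (\<Oplus>j\<in>B. \<Oplus>i\<in>{i \<in> A. rel i j}. f i j)"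
    using assms by (intro finsum_Sigma[symmetric]) auto
  finally show ?thesis .
qed

end


section \<open>The order of a cone\<close>

context pcone
begin

lemma le_carrier: "x \<preceq> y \<Longrightarrow> x \<in> carrier P \<and> y \<in> carrier P"
  by (auto simp: cone_le_def)

lemma le_refl: "x \<in> carrier P \<Longrightarrow> x \<preceq> x"
  unfolding cone_le_def by (metis r_zero zero_closed)

lemma le_add: "x \<in> carrier P \<Longrightarrow> y \<in> carrier P \<Longrightarrow> x \<preceq> x \<oplus> y"
  by (auto simp: cone_le_def)

lemma le_trans [trans]: "x \<preceq> y \<Longrightarrow> y \<preceq> z \<Longrightarrow> x \<preceq> z"
  unfolding cone_le_def by (metis a_assoc a_closed)

lemma cnorm_of_zero: "cnorm P \<zero> = 0"
  using cnorm_smult[of 0 \<zero>] smult_zero_scalar[of \<zero>] by simp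

text \<open>Cancellation gives \<open>a \<oplus> b = \<zero>\<close> for the two differences, and
  monotonicity of the norm then forces \<open>a\<close> to have norm 0. This is where the norm
  axioms turn the algebraic preorder into an order.\<close>

lemma le_antisym:
  assumes "x \<preceq> y" "y \<preceq> x"
  shows "x = y"
proof -
  obtain a b where ab: "a \<in> carrier P" "b \<in> carrier P" "y = x \<oplus> a" "x = y \<oplus> b" and x: "x \<in> carrier P"
    using assms by (auto simp: cone_le_def)
  have "x \<oplus> (a \<oplus> b) = x \<oplus> \<zero>"
    using a_assoc[OF x ab(1,2)] r_zero[OF x] by (simp flip: ab(3,4))
  then have ab0: "a \<oplus> b = \<zero>"
    using add_cancel[OF x _ zero_closed] ab(1,2) by simp
  have "cnorm P a \<le> 0"
    using cnorm_mono[OF ab(1,2)] ab0 cnorm_of_zero by simp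
  then have "a = \<zero>"
    using cnorm_zero cnorm_nonneg ab(1) by (metis order_antisym)
  then show ?thesis
    using ab(3) x by simp
qed

lemma zero_le: "x \<in> carrier P \<Longrightarrow> \<zero> \<preceq> x"
  unfolding cone_le_def by (metis l_zero zero_closed)

lemma add_le_cancel:
  assumes "a \<in> carrier P" "x \<in> carrier P" "y \<in> carrier P"
  shows "a \<oplus> x \<preceq> a \<oplus> y \<longleftrightarrow> x \<preceq> y"
proof
  assume "a \<oplus> x \<preceq> a \<oplus> y"
  then obtain z where z: "z \<in> carrier P" "a \<oplus> y = a \<oplus> (x \<oplus> z)"
    using assms a_assoc by (auto simp: cone_le_def)
  then have "y = x \<oplus> z"
    using assms add_cancel[of a y "x \<oplus> z"] by simp
  then show "x \<preceq> y" using z assms le_add by simp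
next
  assume "x \<preceq> y"
  then obtain z where "z \<in> carrier P" "y = x \<oplus> z"
    by (auto simp: cone_le_def)
  then show "a \<oplus> x \<preceq> a \<oplus> y"
    using assms le_add[of "a \<oplus> x" z] by (simp add: a_assoc)
qed

lemma add_mono:
  assumes "x \<preceq> y" "x' \<preceq> y'"
  shows "x \<oplus> x' \<preceq> y \<oplus> y'"
proof -
  have c: "x \<in> carrier P" "y \<in> carrier P" "x' \<in> carrier P" "y' \<in> carrier P"
    using assms le_carrier by auto
  have "x \<oplus> x' \<preceq> x \<oplus> y'"
    using assms c add_le_cancel by simp
  also have "x \<oplus> y' \<preceq> y \<oplus> y'"
    using assms c add_le_cancel[of y' x y] by (simp add: a_comm)
  finally show ?thesis .
qed

lemma smult_mono: "0 \<le> a \<Longrightarrow> x \<preceq> y \<Longrightarrow> a \<odot> x \<preceq> a \<odot> y"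
  unfolding cone_le_def using smult_r_distr smult_closed by blast

lemma smult_inverse: "0 < a \<Longrightarrow> x \<in> carrier P \<Longrightarrow> inverse a \<odot> (a \<odot> x) = x"
  using smult_assoc[of "inverse a" a x] smult_one by simp

lemma cnorm_le: "x \<preceq> y \<Longrightarrow> cnorm P x \<le> cnorm P y"
  using cnorm_mono by (auto simp: cone_le_def)

lemma uball_le: "x \<preceq> y \<Longrightarrow> y \<in> uball P \<Longrightarrow> x \<in> uball P"
  using cnorm_le le_carrier by (fastforce simp: uball_def)

lemma uball_carrier: "x \<in> uball P \<Longrightarrow> x \<in> carrier P"
  by (simp add: uball_def)

lemma zero_uball: "\<zero> \<in> uball P"
  by (simp add: uball_def cnorm_of_zero)

lemma le_seq_mono:
  assumes "\<And>n. s n \<preceq> s (Suc n)" "m \<le> n"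
  shows "s m \<preceq> s n"
  using assms(2)
proof (induction n rule: dec_induct)
  case base
  show ?case using assms(1) le_carrier le_refl by blast
next
  case (step n)
  then show ?case using assms(1) le_trans by blast
qed

section \<open>Least upper bounds of sequences\<close>

lemma lub_carrier: "is_lub_seq P s u \<Longrightarrow> u \<in> carrier P"
  by (simp add: is_lub_seq_def)

lemma lub_upper: "is_lub_seq P s u \<Longrightarrow> s n \<preceq> u"
  by (simp add: is_lub_seq_def)

lemma lub_least: "is_lub_seq P s u \<Longrightarrow> (\<And>n. s n \<preceq> v) \<Longrightarrow> u \<preceq> v"
  unfolding is_lub_seq_def using le_carrier by blast

lemma lubI:
  "u \<in> carrier P \<Longrightarrow> (\<And>n. s n \<preceq> u) \<Longrightarrow> (\<And>v. v \<in> carrier P \<Longrightarrow> (\<And>n. s n \<preceq> v) \<Longrightarrow> u \<preceq> v)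
    \<Longrightarrow> is_lub_seq P s u"
  by (auto simp: is_lub_seq_def)

lemma lub_unique: "is_lub_seq P s u \<Longrightarrow> is_lub_seq P s v \<Longrightarrow> u = v"
  by (meson le_antisym lub_least lub_upper)

lemma lub_const: "c \<in> carrier P \<Longrightarrow> is_lub_seq P (\<lambda>_. c) c"
  by (simp add: is_lub_seq_def le_refl)

text \<open>A bound \<open>w\<close> of the diagonal sums bounds all
  \<open>s n \<oplus> t m\<close>, as both sequences are non-decreasing. Subtracting
  \<open>s n\<close> from \<open>w\<close> leaves a bound of \<open>t\<close>, hence of
  \<open>v\<close>; subtracting \<open>v\<close> next leaves a bound of \<open>s\<close>, hence of
  \<open>u\<close>. Only differences that are already known to exist are taken.\<close>

lemma lub_add:
  assumes s: "\<And>n. s n \<preceq> s (Suc n)" "is_lub_seq P s u"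
    and t: "\<And>n. t n \<preceq> t (Suc n)" "is_lub_seq P t v"
  shows "is_lub_seq P (\<lambda>n. s n \<oplus> t n) (u \<oplus> v)"
proof -
  have c [simp]: "u \<in> carrier P" "v \<in> carrier P" "s n \<in> carrier P" "t n \<in> carrier P" for n
    using s t lub_carrier le_carrier by blast+
  show ?thesis
  proof (rule lubI)
    fix w assume w: "w \<in> carrier P" "s n \<oplus> t n \<preceq> w" for n
    have mn: "s n \<oplus> t m \<preceq> w" for n m
    proof (rule le_trans)
      show "s n \<oplus> t m \<preceq> s (max n m) \<oplus> t (max n m)"
        using le_seq_mono[of s n "max n m"] le_seq_mono[of t m "max n m"] s t
        by (intro add_mono) simp_all
    qed (rule w)
    have "s n \<oplus> v \<preceq> w" for n
    proof -
      have "s n \<preceq> w" using le_trans[OF le_add[of "s n" "t n"] mn[of n n]] by simp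
      then obtain y where y: "y \<in> carrier P" "w = s n \<oplus> y"
        by (auto simp: cone_le_def)
      have "v \<preceq> y"
        using mn[of n] y by (intro lub_least[OF t(2)]) (simp add: add_le_cancel)
      then show ?thesis using y add_le_cancel by simp
    qed
    note vn = this
    \<comment> \<open>This secures that the difference of \<open>w\<close> and \<open>v\<close>
      exists before it is taken.\<close>
    have "\<zero> \<oplus> v \<preceq> s 0 \<oplus> v"
      by (intro add_mono zero_le le_refl) simp_all
    then have "v \<preceq> w" using le_trans[OF _ vn[of 0]] by simp
    then obtain y where y: "y \<in> carrier P" "w = v \<oplus> y"
      by (auto simp: cone_le_def)
    have "u \<preceq> y"
      using vn y by (intro lub_least[OF s(2)]) (simp add: add_le_cancel a_comm[of _ v])
    then show "u \<oplus> v \<preceq> w" using y by (simp add: add_le_cancel a_comm[of u])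
  qed (use s t lub_upper add_mono in auto)
qed

text \<open>Monotonicity of the partial sums is carried through the induction because
  \<open>lub_add\<close> asks for it.\<close>

lemma lub_finsum:
  assumes "finite A"
    and s: "\<And>i n. i \<in> A \<Longrightarrow> s n i \<preceq> s (Suc n) i" "\<And>i. i \<in> A \<Longrightarrow> is_lub_seq P (\<lambda>n. s n i) (u i)"
  shows "is_lub_seq P (\<lambda>n. \<Oplus>i\<in>A. s n i) (\<Oplus>i\<in>A. u i) \<and>
    (\<forall>n. (\<Oplus>i\<in>A. s n i) \<preceq> (\<Oplus>i\<in>A. s (Suc n) i))"
  using assms
proof (induction A rule: finite_induct)
  case empty
  then show ?case by (simp add: lub_const le_refl)
next
  case (insert a A)
  have "s n \<in> insert a A \<rightarrow> carrier P" "u \<in> insert a A \<rightarrow> carrier P" for n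
    using insert le_carrier lub_carrier by blast+
  then have [simp]: "(\<Oplus>i\<in>insert a A. s n i) = s n a \<oplus> (\<Oplus>i\<in>A. s n i)"
      "(\<Oplus>i\<in>insert a A. u i) = u a \<oplus> (\<Oplus>i\<in>A. u i)" for n
    using insert by (subst finsum_insert; auto)+
  show ?case
    using insert by (auto intro!: lub_add add_mono)
qed

text \<open>For \<open>a > 0\<close>, scaling is an order isomorphism with inverse the scaling by
  \<open>inverse a\<close>; for \<open>a = 0\<close> the sequence is constant.\<close>

lemma lub_smult:
  assumes "0 \<le> a" "is_lub_seq P s u"
  shows "is_lub_seq P (\<lambda>n. a \<odot> s n) (a \<odot> u)"
proof (cases "a = 0")
  case True
  have "s n \<in> carrier P" for n using assms lub_upper le_carrier by blast
  then show ?thesis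
    using True lub_const lub_carrier[OF assms(2)] smult_zero_scalar by simp
next
  case False
  with assms have a: "0 < a" by simp
  have c: "s n \<in> carrier P" "u \<in> carrier P" for n
    using assms lub_upper le_carrier by blast+
  show ?thesis
  proof (rule lubI)
    fix v assume v: "v \<in> carrier P" "\<And>n. a \<odot> s n \<preceq> v"
    have "s n \<preceq> inverse a \<odot> v" for n
      using smult_mono[of "inverse a" "a \<odot> s n" v] v(2)[of n] a smult_inverse[OF a] c by simp
    from lub_least[OF assms(2) this] have "u \<preceq> inverse a \<odot> v" .
    from smult_mono[OF assms(1) this] show "a \<odot> u \<preceq> v"
      using smult_inverse[of "inverse a" v] a v by simp
  qed (use assms(1) c smult_closed smult_mono lub_upper[OF assms(2)] in simp_all)
qed

lemma finsum_smult:
  assumes "0 \<le> a" "finite A" "f \<in> A \<rightarrow> carrier P"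
  shows "a \<odot> (\<Oplus>i\<in>A. f i) = (\<Oplus>i\<in>A. a \<odot> f i)"
  using assms(2,3)
proof (induction A rule: finite_induct)
  case empty
  then show ?case using assms smult_zero by simp
next
  case (insert x A)
  have f: "f \<in> A \<rightarrow> carrier P" "f x \<in> carrier P"
    using insert.prems by auto
  have "a \<odot> (\<Oplus>i\<in>insert x A. f i) = a \<odot> (f x \<oplus> (\<Oplus>i\<in>A. f i))"
    using insert.hyps f by (subst finsum_insert) auto
  also have "\<dots> = a \<odot> f x \<oplus> a \<odot> (\<Oplus>i\<in>A. f i)"
    using f assms(1) by (intro smult_r_distr finsum_closed)
  also have "\<dots> = a \<odot> f x \<oplus> (\<Oplus>i\<in>A. a \<odot> f i)"
    by (simp only: insert.IH[OF f(1)])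
  also have "\<dots> = (\<Oplus>i\<in>insert x A. a \<odot> f i)"
    using insert.hyps f smult_closed[OF assms(1)] by (subst finsum_insert) auto
  finally show ?case .
qed

lemma finsum_le_subset:
  assumes "finite A" "B \<subseteq> A" "f \<in> A \<rightarrow> carrier P"
  shows "(\<Oplus>i\<in>B. f i) \<preceq> (\<Oplus>i\<in>A. f i)"
proof -
  have "(\<Oplus>i\<in>B \<union> (A - B). f i) = (\<Oplus>i\<in>B. f i) \<oplus> (\<Oplus>i\<in>A - B. f i)"
    using assms by (intro finsum_Un_disjoint) (auto intro: finite_subset)
  moreover have "B \<union> (A - B) = A" using assms by auto
  ultimately show ?thesis
    using assms le_add[of "\<Oplus>i\<in>B. f i" "\<Oplus>i\<in>A - B. f i"] by (auto intro!: finsum_closed simp: Pi_iff subset_iff)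
qed

end


section \<open>Moebius expansions\<close>

text \<open>\<open>F\<close> depends on the subset alone and not on the points of the domain that
  produced it. Coefficients can thus be regrouped without referring to the domain cone.\<close>

definition moebius ::
  "('q, 'm) pcone_scheme \<Rightarrow> 'i set \<Rightarrow> ('i set \<Rightarrow> 'q) \<Rightarrow> ('i set \<Rightarrow> 'q) \<Rightarrow> bool" where
  "moebius Q A F b \<longleftrightarrow> b \<in> Pow A \<rightarrow> carrier Q \<and> (\<forall>I\<in>Pow A. F I = (\<Oplus>\<^bsub>Q\<^esub>J\<in>Pow I. b J))"

context pcone
begin

lemma moebius_coeff: "moebius P A F b \<Longrightarrow> J \<subseteq> A \<Longrightarrow> b J \<in> carrier P"
  by (auto simp: moebius_def)

lemma moebius_sum: "moebius P A F b \<Longrightarrow> I \<subseteq> A \<Longrightarrow> F I = (\<Oplus>J\<in>Pow I. b J)"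
  by (auto simp: moebius_def)

lemma moebius_Pi: "moebius P A F b \<Longrightarrow> I \<subseteq> A \<Longrightarrow> b \<in> Pow I \<rightarrow> carrier P"
  by (force simp: moebius_def)

lemma moebius_closed: "moebius P A F b \<Longrightarrow> I \<subseteq> A \<Longrightarrow> F I \<in> carrier P"
  by (force simp: moebius_def intro!: finsum_closed)

lemma moebius_cong: "moebius P A F b \<Longrightarrow> (\<And>I. I \<subseteq> A \<Longrightarrow> F I = G I) \<Longrightarrow> moebius P A G b"
  by (auto simp: moebius_def)

lemma moebius_split:
  assumes "finite I" "b \<in> Pow I \<rightarrow> carrier P"
  shows "(\<Oplus>J\<in>Pow I. b J) = b I \<oplus> (\<Oplus>J\<in>Pow I - {I}. b J)"
proof -
  have "(\<Oplus>J\<in>insert I (Pow I - {I}). b J) = b I \<oplus> (\<Oplus>J\<in>Pow I - {I}. b J)"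
    using assms by (intro finsum_insert) auto
  then show ?thesis by (simp add: insert_absorb)
qed

text \<open>Strong induction on \<open>J\<close>: the proper subsets contribute equally to both
  sums, so cancellation leaves the top coefficients.\<close>

lemma moebius_unique:
  assumes "finite A" "moebius P A F b" "moebius P A F c" "J \<subseteq> A"
  shows "b J = c J"
proof -
  have "finite J" using assms(1,4) by (rule rev_finite_subset)
  then show ?thesis using assms(4)
  proof (induction J rule: finite_psubset_induct)
    case (psubset J)
    have b: "b \<in> Pow J \<rightarrow> carrier P" and c: "c \<in> Pow J \<rightarrow> carrier P"
      using assms psubset.prems moebius_Pi by blast+
    have eq: "(\<Oplus>K\<in>Pow J - {J}. b K) = (\<Oplus>K\<in>Pow J - {J}. c K)"
      using psubset c by (intro finsum_cong') auto
    have "(\<Oplus>K\<in>Pow J. b K) = (\<Oplus>K\<in>Pow J. c K)"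
      using assms(2,3) psubset.prems moebius_sum by metis
    then have "b J \<oplus> (\<Oplus>K\<in>Pow J - {J}. c K) = c J \<oplus> (\<Oplus>K\<in>Pow J - {J}. c K)"
      using moebius_split[OF psubset.hyps b] moebius_split[OF psubset.hyps c] eq by simp
    moreover have "(\<Oplus>K\<in>Pow J - {J}. c K) \<in> carrier P"
      using c by (intro finsum_closed) auto
    moreover have "b J \<in> carrier P" "c J \<in> carrier P"
      using b c by auto
    ultimately show ?case
      using add_cancel[of "\<Oplus>K\<in>Pow J - {J}. c K" "b J" "c J"] a_comm by simp
  qed
qed

text \<open>
  A function of \<open>I\<close> is a sum of monomials \<open>[\<phi> t \<subseteq> I]\<close>; collecting equal monomials yields its
  coefficients.
\<close>

lemma moebius_collect:
  assumes "finite A" "finite T" "\<phi> \<in> T \<rightarrow> Pow A" "\<beta> \<in> T \<rightarrow> carrier P"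
    and F: "\<And>I. I \<subseteq> A \<Longrightarrow> F I = (\<Oplus>t\<in>{t \<in> T. \<phi> t \<subseteq> I}. \<beta> t)"
  shows "moebius P A F (\<lambda>J. \<Oplus>t\<in>{t \<in> T. \<phi> t = J}. \<beta> t)"
  unfolding moebius_def
proof (intro conjI ballI)
  show "(\<lambda>J. \<Oplus>t\<in>{t \<in> T. \<phi> t = J}. \<beta> t) \<in> Pow A \<rightarrow> carrier P"
    using assms(4) by (auto intro!: finsum_closed)
  fix I assume "I \<in> Pow A"
  then have I: "I \<subseteq> A" by simp
  have "F I = (\<Oplus>t\<in>{t \<in> T. \<phi> t \<subseteq> I}. \<beta> t)" by (rule F[OF I])
  also have "\<dots> = (\<Oplus>J\<in>Pow I. \<Oplus>t\<in>{t \<in> {t \<in> T. \<phi> t \<subseteq> I}. \<phi> t = J}. \<beta> t)"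
    using assms finite_subset[OF I] by (intro finsum_fibres) auto
  also have "\<dots> = (\<Oplus>J\<in>Pow I. \<Oplus>t\<in>{t \<in> T. \<phi> t = J}. \<beta> t)"
    using assms(4)
    by (intro finsum_cong') (auto intro!: finsum_closed arg_cong2[where f = "finsum P"])
  finally show "F I = (\<Oplus>J\<in>Pow I. \<Oplus>t\<in>{t \<in> T. \<phi> t = J}. \<beta> t)" .
qed

lemma moebius_add:
  assumes "moebius P A F b" "moebius P A G c"
  shows "moebius P A (\<lambda>I. F I \<oplus> G I) (\<lambda>J. b J \<oplus> c J)"
  unfolding moebius_def
proof (intro conjI ballI)
  show "(\<lambda>J. b J \<oplus> c J) \<in> Pow A \<rightarrow> carrier P"
    using assms by (auto simp: moebius_def)
  fix I assume "I \<in> Pow A"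
  then have "b \<in> Pow I \<rightarrow> carrier P" "c \<in> Pow I \<rightarrow> carrier P" "I \<subseteq> A"
    using assms moebius_Pi by blast+
  then show "F I \<oplus> G I = (\<Oplus>J\<in>Pow I. b J \<oplus> c J)"
    using assms by (simp add: finsum_addf moebius_sum)
qed

lemma moebius_smult:
  assumes "finite A" "0 \<le> a" "moebius P A F b"
  shows "moebius P A (\<lambda>I. a \<odot> F I) (\<lambda>J. a \<odot> b J)"
  unfolding moebius_def
proof (intro conjI ballI)
  show "(\<lambda>J. a \<odot> b J) \<in> Pow A \<rightarrow> carrier P"
    using assms smult_closed by (auto simp: moebius_def)
  fix I assume "I \<in> Pow A"
  then have "b \<in> Pow I \<rightarrow> carrier P" "I \<subseteq> A" "finite (Pow I)"
    using assms moebius_Pi finite_subset by blast+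
  then show "a \<odot> F I = (\<Oplus>J\<in>Pow I. a \<odot> b J)"
    using assms by (simp add: finsum_smult moebius_sum)
qed

text \<open>Coefficientwise differences exist in the cone by assumption. Their sum over
  \<open>Pow I\<close>, added to \<open>F I\<close>, gives \<open>G I\<close>, so cancelling
  \<open>F I\<close> identifies it with \<open>H I\<close>.\<close>

lemma moebius_diff:
  assumes "finite A" "moebius P A F b" "moebius P A G c" "\<And>J. J \<subseteq> A \<Longrightarrow> b J \<preceq> c J"
    and H: "\<And>I. I \<subseteq> A \<Longrightarrow> H I \<in> carrier P" "\<And>I. I \<subseteq> A \<Longrightarrow> G I = F I \<oplus> H I"
  shows "\<exists>d. moebius P A H d \<and> (\<forall>J\<subseteq>A. c J = b J \<oplus> d J)"
proof -
  have "\<forall>J\<in>Pow A. \<exists>d\<in>carrier P. c J = b J \<oplus> d"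
    using assms(4) by (auto simp: cone_le_def)
  from bchoice[OF this[unfolded Bex_def]] obtain d where "\<forall>J\<in>Pow A. d J \<in> carrier P \<and> c J = b J \<oplus> d J"
    by blast
  then have d: "\<And>J. J \<subseteq> A \<Longrightarrow> d J \<in> carrier P" "\<And>J. J \<subseteq> A \<Longrightarrow> c J = b J \<oplus> d J"
    by (simp_all only: Pow_iff)
  have "H I = (\<Oplus>J\<in>Pow I. d J)" if I: "I \<subseteq> A" for I
  proof -
    have bd: "b \<in> Pow I \<rightarrow> carrier P" "d \<in> Pow I \<rightarrow> carrier P"
      using moebius_Pi[OF assms(2) I] d(1) I by auto
    have "F I \<oplus> H I = (\<Oplus>J\<in>Pow I. c J)"
      using moebius_sum[OF assms(3) I] H(2)[OF I] by simp
    also have "\<dots> = (\<Oplus>J\<in>Pow I. b J \<oplus> d J)"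
      using bd d(2) I by (intro finsum_cong') (auto simp: Pi_iff)
    also have "\<dots> = F I \<oplus> (\<Oplus>J\<in>Pow I. d J)"
      using bd moebius_sum[OF assms(2) I] by (simp add: finsum_addf)
    finally show ?thesis
      by (rule add_cancel[rotated 3]) (use moebius_closed[OF assms(2) I] H(1)[OF I] bd(2) in auto)
  qed
  then have "moebius P A H d"
    using d(1) by (auto simp: moebius_def)
  with d(2) show ?thesis by blast
qed

lemma moebius_const:
  assumes "finite A" "c \<in> carrier P"
  shows "moebius P A (\<lambda>_. c) (\<lambda>J. if J = {} then c else \<zero>)"
  unfolding moebius_def
proof (intro conjI ballI)
  fix I assume "I \<in> Pow A"
  then have "finite I" using assms finite_subset by auto
  have "(\<Oplus>J\<in>Pow I. if {} = J then c else \<zero>) = c"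
    using assms \<open>finite I\<close> by (intro finsum_singleton) auto
  then show "c = (\<Oplus>J\<in>Pow I. if J = {} then c else \<zero>)"
    by (simp add: eq_commute)
qed (use assms in auto)

text \<open>The monomials are singletons, since \<open>{t} \<subseteq> I\<close> iff
  \<open>t \<in> I\<close>: an affine function of the subset has no coefficients beyond degree
  one.\<close>

lemma moebius_linear:
  assumes "finite A" "x \<in> carrier P" "u \<in> A \<rightarrow> carrier P"
  shows "\<exists>b. moebius P A (\<lambda>I. x \<oplus> (\<Oplus>i\<in>I. u i)) b"
proof -
  have "moebius P A (\<lambda>I. \<Oplus>i\<in>I. u i) (\<lambda>J. \<Oplus>t\<in>{t \<in> A. {t} = J}. u t)"
    using assms by (intro moebius_collect) (auto intro!: arg_cong2[where f = "finsum P"])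
  from moebius_add[OF moebius_const[OF assms(1,2)] this] show ?thesis by blast
qed

text \<open>Each parity sum contains \<open>b J\<close> once for every member of its class that lies
  above \<open>J\<close>. These numbers agree for \<open>J \<noteq> A\<close>, while for
  \<open>J = A\<close> only the even class has such a member, namely \<open>A\<close>. So the top
  coefficient is the iterated difference, and the inequality of pre-stability expresses that it lies
  in the cone.\<close>

lemma moebius_delta:
  assumes A: "finite A" and b: "moebius P A F b"
  shows "(\<Oplus>I\<in>{I \<in> Pow A. even (card A - card I)}. F I)
       = (\<Oplus>I\<in>{I \<in> Pow A. odd (card A - card I)}. F I) \<oplus> b A"
proof -
  define S where "S p = {I \<in> Pow A. even (card A - card I) = p}" for p
  define X where "X p J = (\<Oplus>I\<in>{I \<in> S p. J \<subseteq> I}. b J)" for p J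
  have bc: "b J \<in> carrier P" if "J \<subseteq> A" for J
    using moebius_coeff[OF b that] .
  have fin: "finite (S p)" for p
    using A by (simp add: S_def)
  have Xc: "X p J \<in> carrier P" if "J \<subseteq> A" for p J
    using bc[OF that] by (auto simp: X_def intro!: finsum_closed)
  have sumX: "(\<Oplus>I\<in>S p. F I) = X p A \<oplus> (\<Oplus>J\<in>Pow A - {A}. X p J)" for p
  proof -
    have "(\<Oplus>I\<in>S p. F I) = (\<Oplus>I\<in>S p. \<Oplus>J\<in>{J \<in> Pow A. J \<subseteq> I}. b J)"
    proof (rule finsum_cong', goal_cases)
      case (3 I)
      then have "I \<subseteq> A" "{J \<in> Pow A. J \<subseteq> I} = Pow I" by (auto simp: S_def)
      then show ?case using moebius_sum[OF b] by simp
    qed (use bc in \<open>auto intro!: finsum_closed\<close>)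
    also have "\<dots> = (\<Oplus>J\<in>Pow A. X p J)"
      unfolding X_def using fin A bc by (intro finsum_swap_dep) auto
    also have "\<dots> = X p A \<oplus> (\<Oplus>J\<in>Pow A - {A}. X p J)"
      using A Xc by (intro moebius_split) auto
    finally show ?thesis .
  qed
  have "X True J = X False J" if "J \<in> Pow A - {A}" for J
  proof -
    from that obtain a where a: "J \<subseteq> A" "a \<in> A" "a \<notin> J" by auto
    \<comment> \<open>Toggling an element \<open>a\<close> of \<open>A\<close> outside
      \<open>J\<close> is an involution that keeps \<open>J\<close> inside and exchanges the two
      parity classes.\<close>
    define t where "t I = (if a \<in> I then I - {a} else insert a I)" for I
    have card: "even (card A - card (t I)) \<noteq> even (card A - card I)" if I: "I \<subseteq> A" for I
    proof -
      have "t I \<subseteq> A" using I a by (auto simp: t_def)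
      \<comment> \<open>The bounds by \<open>card A\<close> keep the truncated subtraction faithful,
        so that changing the cardinality by one flips the parity.\<close>
      then have "finite I" "card I \<le> card A" "card (t I) \<le> card A"
        using I A by (auto intro: card_mono finite_subset)
      moreover have "card I = Suc (card (t I)) \<or> card (t I) = Suc (card I)"
        using card.remove[of I a] \<open>finite I\<close> by (auto simp: t_def)
      ultimately show ?thesis by auto
    qed
    have inv: "t (t I) = I" for I by (auto simp: t_def)
    have sub: "t ` {I \<in> S p. J \<subseteq> I} \<subseteq> {I \<in> S (\<not> p). J \<subseteq> I}" for p
    proof (intro image_subsetI)
      fix I assume I: "I \<in> {I \<in> S p. J \<subseteq> I}"
      then have "t I \<subseteq> A" "J \<subseteq> t I" using a by (auto simp: S_def t_def)
      then show "t I \<in> {I \<in> S (\<not> p). J \<subseteq> I}"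
        using card[of I] I by (auto simp: S_def)
    qed
    have "{I \<in> S True. J \<subseteq> I} = t ` {I \<in> S False. J \<subseteq> I}"
    proof
      show "{I \<in> S True. J \<subseteq> I} \<subseteq> t ` {I \<in> S False. J \<subseteq> I}"
        using sub[of True] inv by (metis (no_types, lifting) image_iff image_subset_iff subsetI)
    qed (use sub[of False] in simp)
    moreover have "inj_on t {I \<in> S False. J \<subseteq> I}"
      using inv by (metis inj_onI)
    ultimately show ?thesis
      unfolding X_def using bc[OF a(1)] by (simp add: finsum_reindex)
  qed
  then have rest: "(\<Oplus>J\<in>Pow A - {A}. X True J) = (\<Oplus>J\<in>Pow A - {A}. X False J)"
    using Xc by (intro finsum_cong') auto
  have SA: "{I \<in> S True. A \<subseteq> I} = {A}" "{I \<in> S False. A \<subseteq> I} = {}"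
    by (auto simp: S_def)
  then have "X True A = b A" "X False A = \<zero>"
    unfolding X_def SA using bc by simp_all
  moreover have "(\<Oplus>J\<in>Pow A - {A}. X False J) \<in> carrier P"
    using Xc by (auto intro!: finsum_closed)
  ultimately have "(\<Oplus>I\<in>S True. F I) = (\<Oplus>I\<in>S False. F I) \<oplus> b A"
    using bc[of A] by (simp add: sumX rest a_comm)
  then show ?thesis by (simp add: S_def)
qed

text \<open>The hypothesis provides each \<open>b J\<close> as a difference of the two parity sums.
  By \<open>moebius_delta\<close> the function summed up from \<open>b\<close> satisfies the same
  relation, and by induction it agrees with \<open>F\<close> on all proper subsets of
  \<open>I\<close>; cancelling those terms gives agreement at \<open>I\<close>.\<close>

lemma moebius_exists:
  assumes A: "finite A" and F: "F \<in> Pow A \<rightarrow> carrier P"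
    and le: "\<And>J. J \<subseteq> A \<Longrightarrow> J \<noteq> {} \<Longrightarrow>
      (\<Oplus>I\<in>{I \<in> Pow J. odd (card J - card I)}. F I) \<preceq> (\<Oplus>I\<in>{I \<in> Pow J. even (card J - card I)}. F I)"
  shows "\<exists>b. moebius P A F b"
proof -
  let ?E = "\<lambda>J. {I \<in> Pow J. even (card J - card I)}" and ?O = "\<lambda>J. {I \<in> Pow J. odd (card J - card I)}"
  have "\<forall>J\<in>Pow A. \<exists>y\<in>carrier P. (\<Oplus>I\<in>?E J. F I) = (\<Oplus>I\<in>?O J. F I) \<oplus> y"
  proof
    fix J assume "J \<in> Pow A"
    show "\<exists>y\<in>carrier P. (\<Oplus>I\<in>?E J. F I) = (\<Oplus>I\<in>?O J. F I) \<oplus> y"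
    proof (cases "J = {}")
      \<comment> \<open>The inequalities start with one increment. For the empty set the odd sum is
        empty, so the coefficient is the value \<open>F {}\<close> itself.\<close>
      case True
      then have EO: "?E J = {{}}" "?O J = {}" by auto
      have "F {} \<in> carrier P" using F by auto
      then show ?thesis unfolding EO by (intro bexI[of _ "F {}"]) simp_all
    next
      case False
      then show ?thesis using le \<open>J \<in> Pow A\<close> by (simp add: cone_le_def)
    qed
  qed
  from bchoice[OF this[unfolded Bex_def]] obtain b where
    "\<forall>J\<in>Pow A. b J \<in> carrier P \<and> (\<Oplus>I\<in>?E J. F I) = (\<Oplus>I\<in>?O J. F I) \<oplus> b J"
    by blast
  then have b: "\<And>J. J \<subseteq> A \<Longrightarrow> b J \<in> carrier P"
      "\<And>J. J \<subseteq> A \<Longrightarrow> (\<Oplus>I\<in>?E J. F I) = (\<Oplus>I\<in>?O J. F I) \<oplus> b J"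
    by (simp_all only: Pow_iff)
  have "F I = (\<Oplus>J\<in>Pow I. b J)" if "I \<subseteq> A" for I
  proof -
    have "finite I" using A that by (rule rev_finite_subset)
    then show ?thesis using that
    proof (induction I rule: finite_psubset_induct)
      case (psubset I)
      let ?G = "\<lambda>K. \<Oplus>J\<in>Pow K. b J"
      have Gc: "?G K \<in> carrier P" if "K \<subseteq> I" for K
        using b(1) that psubset.prems by (auto intro!: finsum_closed)
      have G: "moebius P I ?G b"
        using b(1) psubset.prems by (auto simp: moebius_def)
      have E: "?E I = insert I (?E I - {I})" by auto
      have split: "(\<Oplus>K\<in>?E I. H K) = H I \<oplus> (\<Oplus>K\<in>?E I - {I}. H K)"
        if "H \<in> Pow I \<rightarrow> carrier P" for H
        using that psubset.hyps by (subst E, subst finsum_insert) auto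
      have eqE: "(\<Oplus>K\<in>?E I - {I}. F K) = (\<Oplus>K\<in>?E I - {I}. ?G K)"
        using psubset Gc by (intro finsum_cong') auto
      have eqO: "(\<Oplus>K\<in>?O I. F K) = (\<Oplus>K\<in>?O I. ?G K)"
        using psubset Gc by (intro finsum_cong') auto
      have "F I \<oplus> (\<Oplus>K\<in>?E I - {I}. ?G K) = (\<Oplus>K\<in>?E I. F K)"
        using split[of F] F psubset.prems unfolding eqE by force
      also have "\<dots> = (\<Oplus>K\<in>?O I. ?G K) \<oplus> b I"
        using b(2)[OF psubset.prems] unfolding eqO .
      also have "\<dots> = (\<Oplus>K\<in>?E I. ?G K)"
        by (rule moebius_delta[OF psubset.hyps G, symmetric])
      also have "\<dots> = ?G I \<oplus> (\<Oplus>K\<in>?E I - {I}. ?G K)"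
        using Gc by (intro split) auto
      finally have "F I \<oplus> (\<Oplus>K\<in>?E I - {I}. ?G K) = ?G I \<oplus> (\<Oplus>K\<in>?E I - {I}. ?G K)" .
      moreover have "(\<Oplus>K\<in>?E I - {I}. ?G K) \<in> carrier P"
        using Gc by (intro finsum_closed) auto
      moreover have "F I \<in> carrier P" using F psubset.prems by auto
      ultimately show ?case
        using add_cancel[of "\<Oplus>K\<in>?E I - {I}. ?G K" "F I" "?G I"] Gc[of I]
        by (simp add: a_comm)
    qed
  qed
  then have "moebius P A F b" using b(1) by (auto simp: moebius_def)
  then show ?thesis by blast
qed

end

section \<open>Pre-stability as existence of expansions\<close>

text \<open>The index set is any finite set instead of \<open>{1..n}\<close>, because expansions are
  also taken along families of coefficients, indexed by sets, and along the disjoint union of two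
  index sets.\<close>

definition increments :: "('a, 'm) pcone_scheme \<Rightarrow> 'i set \<Rightarrow> 'a \<Rightarrow> ('i \<Rightarrow> 'a) \<Rightarrow> bool" where
  "increments P A x u \<longleftrightarrow> finite A \<and> x \<in> carrier P \<and> u \<in> A \<rightarrow> carrier P \<and>
     x \<oplus>\<^bsub>P\<^esub> (\<Oplus>\<^bsub>P\<^esub>i\<in>A. u i) \<in> uball P"

definition expansion ::
  "('a, 'm) pcone_scheme \<Rightarrow> ('b, 'k) pcone_scheme \<Rightarrow> ('a \<Rightarrow> 'b) \<Rightarrow> 'i set \<Rightarrow> 'a \<Rightarrow> ('i \<Rightarrow> 'a) \<Rightarrow>
     ('i set \<Rightarrow> 'b) \<Rightarrow> bool" where
  "expansion P Q f A x u b \<longleftrightarrow> moebius Q A (\<lambda>I. f (x \<oplus>\<^bsub>P\<^esub> (\<Oplus>\<^bsub>P\<^esub>i\<in>I. u i))) b"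

context pcone
begin

lemma increments_finite: "increments P A x u \<Longrightarrow> finite A"
  by (simp add: increments_def)

lemma increments_Pi: "increments P A x u \<Longrightarrow> I \<subseteq> A \<Longrightarrow> u \<in> I \<rightarrow> carrier P"
  by (auto simp: increments_def)

lemma increments_le:
  assumes "increments P A x u" "I \<subseteq> A"
  shows "x \<oplus> (\<Oplus>i\<in>I. u i) \<preceq> x \<oplus> (\<Oplus>i\<in>A. u i)"
  using assms by (intro add_mono le_refl finsum_le_subset) (auto simp: increments_def)

lemma increments_uball: "increments P A x u \<Longrightarrow> I \<subseteq> A \<Longrightarrow> x \<oplus> (\<Oplus>i\<in>I. u i) \<in> uball P"
  using increments_le uball_le unfolding increments_def by blast

lemma increments_single:
  assumes "x \<preceq> y" "y \<in> uball P"
  shows "\<exists>v. increments P {0::nat} x (\<lambda>_. v) \<and> y = x \<oplus> v"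
  using assms by (auto simp: increments_def cone_le_def)

end

locale two_cones = P: pcone P + Q: pcone Q
  for P :: "('a, 'm) pcone_scheme" and Q :: "('b, 'k) pcone_scheme"
begin

lemma expansion_unique:
  "increments P A x u \<Longrightarrow> expansion P Q f A x u b \<Longrightarrow> expansion P Q f A x u c \<Longrightarrow> J \<subseteq> A \<Longrightarrow> b J = c J"
  unfolding expansion_def using P.increments_finite Q.moebius_unique by blast

lemma expansion_cong:
  assumes "increments P A x u" "expansion P Q f A x u b" "\<And>x. x \<in> uball P \<Longrightarrow> f x = g x"
  shows "expansion P Q g A x u b"
  unfolding expansion_def
  by (rule Q.moebius_cong[OF assms(2)[unfolded expansion_def]])
    (use P.increments_uball[OF assms(1)] assms(3) in simp)

lemma pre_stable_funcset: "pre_stable P Q f \<Longrightarrow> x \<in> uball P \<Longrightarrow> f x \<in> carrier Q"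
  by (auto simp: pre_stable_def)

text \<open>For each non-empty \<open>J\<close> the increments are renumbered by a bijection from
  \<open>{1..n}\<close>; the defining inequality of pre-stability then becomes the hypothesis of
  \<open>moebius_exists\<close>. The partial sums stay in the unit ball because it is downward
  closed.\<close>

lemma pre_stable_expansion:
  assumes f: "pre_stable P Q f" and inc: "increments P A x u"
  shows "\<exists>b. expansion P Q f A x u b"
  unfolding expansion_def
proof (rule Q.moebius_exists)
  let ?F = "\<lambda>I. f (x \<oplus>\<^bsub>P\<^esub> (\<Oplus>\<^bsub>P\<^esub>i\<in>I. u i))"
  have Fc: "?F I \<in> carrier Q" if "I \<subseteq> A" for I
    using pre_stable_funcset[OF f] P.increments_uball[OF inc that] .
  show "finite A" using inc by (rule P.increments_finite)
  show "?F \<in> Pow A \<rightarrow> carrier Q" using Fc by auto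
  fix J assume J: "J \<subseteq> A" "J \<noteq> {}"
  define n where "n = card J"
  have "finite J" using J \<open>finite A\<close> finite_subset by auto
  then obtain h where h: "bij_betw h {1..n} J"
    using ex_bij_betw_finite_nat[of J] bij_betw_iff_card[of "{1..n}" J] by (auto simp: n_def)
  have hJ: "h ` {1..n} = J" and inj: "inj_on h {1..n}"
    using h by (auto simp: bij_betw_def)
  have uJ: "u \<in> J \<rightarrow> carrier P" using P.increments_Pi[OF inc J(1)] .
  have sum_h: "(\<Oplus>\<^bsub>P\<^esub>i\<in>h ` I. u i) = (\<Oplus>\<^bsub>P\<^esub>i\<in>I. u (h i))" if "I \<subseteq> {1..n}" for I
    using that uJ hJ inj by (intro P.finsum_reindex) (auto intro: inj_on_subset)
  \<comment> \<open>\<open>R\<close> stands for either parity, so that one renumbering serves both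
    sums.\<close>
  have Delta: "(\<Oplus>\<^bsub>Q\<^esub>I\<in>{I \<in> Pow J. R (n - card I)}. ?F I)
      = (\<Oplus>\<^bsub>Q\<^esub>I\<in>{I. I \<subseteq> {1..n} \<and> R (n - card I)}. f (x \<oplus>\<^bsub>P\<^esub> (\<Oplus>\<^bsub>P\<^esub>i\<in>I. u (h i))))" for R
  proof -
    let ?S = "{I. I \<subseteq> {1..n} \<and> R (n - card I)}"
    have card_h: "card (h ` I) = card I" if "I \<subseteq> {1..n}" for I
      using inj that by (meson card_image inj_on_subset)
    have "{I \<in> Pow J. R (n - card I)} = image h ` ?S"
    proof
      show "{I \<in> Pow J. R (n - card I)} \<subseteq> image h ` ?S"
      proof
        fix I assume I: "I \<in> {I \<in> Pow J. R (n - card I)}"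
        then obtain K where "K \<subseteq> {1..n}" "I = h ` K"
          using hJ by (metis (no_types, lifting) CollectD PowD subset_imageE)
        then show "I \<in> image h ` ?S" using I card_h by auto
      qed
      show "image h ` ?S \<subseteq> {I \<in> Pow J. R (n - card I)}"
        using card_h hJ by auto
    qed
    moreover have "inj_on (image h) ?S"
      using inj_on_image_Pow[OF inj] by (rule inj_on_subset) auto
    moreover have "?F \<in> image h ` ?S \<rightarrow> carrier Q"
      using hJ J by (auto intro!: Fc)
    ultimately have "(\<Oplus>\<^bsub>Q\<^esub>I\<in>{I \<in> Pow J. R (n - card I)}. ?F I) = (\<Oplus>\<^bsub>Q\<^esub>I\<in>?S. ?F (h ` I))"
      by (simp add: Q.finsum_reindex)
    also have "\<dots> = (\<Oplus>\<^bsub>Q\<^esub>I\<in>?S. f (x \<oplus>\<^bsub>P\<^esub> (\<Oplus>\<^bsub>P\<^esub>i\<in>I. u (h i))))"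
    proof (rule Q.finsum_cong', goal_cases)
      case 2
      show ?case
      proof
        fix I assume I: "I \<in> ?S"
        then have "f (x \<oplus>\<^bsub>P\<^esub> (\<Oplus>\<^bsub>P\<^esub>i\<in>h ` I. u i)) \<in> carrier Q"
          using hJ J by (intro Fc) auto
        then show "f (x \<oplus>\<^bsub>P\<^esub> (\<Oplus>\<^bsub>P\<^esub>i\<in>I. u (h i))) \<in> carrier Q"
          using I sum_h by simp
      qed
    qed (use sum_h in simp_all)
    finally show ?thesis .
  qed
  have "n \<ge> 1" using J \<open>finite J\<close> by (simp add: n_def Suc_le_eq card_gt_0_iff)
  moreover have "(\<lambda>i. u (h i)) \<in> {1..n} \<rightarrow> carrier P" using uJ hJ by auto
  moreover have "x \<in> carrier P" using inc by (simp add: increments_def)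
  moreover have "x \<oplus>\<^bsub>P\<^esub> (\<Oplus>\<^bsub>P\<^esub>i\<in>{1..n}. u (h i)) \<in> uball P"
    using P.increments_uball[OF inc J(1)] sum_h[of "{1..n}"] hJ by simp
  ultimately have "Delta_minus P Q n f x (\<lambda>i. u (h i)) \<preceq>\<^bsub>Q\<^esub> Delta_plus P Q n f x (\<lambda>i. u (h i))"
    using f unfolding pre_stable_def by blast
  then show "(\<Oplus>\<^bsub>Q\<^esub>I\<in>{I \<in> Pow J. odd (card J - card I)}. ?F I)
      \<preceq>\<^bsub>Q\<^esub> (\<Oplus>\<^bsub>Q\<^esub>I\<in>{I \<in> Pow J. even (card J - card I)}. ?F I)"
    using Delta[of odd] Delta[of even]
    unfolding Delta_minus_def Delta_plus_def subsets_minus_def subsets_plus_def n_def by simp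
qed

text \<open>Expansions over sets of naturals suffice here because the definition sums over subsets
  of \<open>{1..n}\<close>; the inequality is read off from the top coefficient by
  \<open>moebius_delta\<close>.\<close>

lemma pre_stableI:
  assumes f: "\<And>x. x \<in> uball P \<Longrightarrow> f x \<in> carrier Q"
    and exp: "\<And>(A :: nat set) x u. increments P A x u \<Longrightarrow> \<exists>b. expansion P Q f A x u b"
  shows "pre_stable P Q f"
  unfolding pre_stable_def
proof (intro conjI allI impI ballI)
  show "f \<in> uball P \<rightarrow> carrier Q" using f by simp
  fix n :: nat and u x
  assume "u \<in> {1..n} \<rightarrow> carrier P" "x \<in> carrier P" "x \<oplus>\<^bsub>P\<^esub> (\<Oplus>\<^bsub>P\<^esub>i\<in>{1..n}. u i) \<in> uball P"
  then have inc: "increments P {1..n} x u" by (simp add: increments_def)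
  then obtain b where "expansion P Q f {1..n} x u b" using exp by blast
  then have b: "moebius Q {1..n} (\<lambda>I. f (x \<oplus>\<^bsub>P\<^esub> (\<Oplus>\<^bsub>P\<^esub>i\<in>I. u i))) b"
    by (simp add: expansion_def)
  have "Delta_plus P Q n f x u = Delta_minus P Q n f x u \<oplus>\<^bsub>Q\<^esub> b {1..n}"
    using Q.moebius_delta[OF _ b]
    unfolding Delta_minus_def Delta_plus_def subsets_minus_def subsets_plus_def by simp
  moreover have "Delta_minus P Q n f x u \<in> carrier Q"
    unfolding Delta_minus_def subsets_minus_def
    using f P.increments_uball[OF inc] by (intro Q.finsum_closed) auto
  ultimately show "Delta_minus P Q n f x u \<preceq>\<^bsub>Q\<^esub> Delta_plus P Q n f x u"
    using Q.le_add Q.moebius_coeff[OF b] by simp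
qed

text \<open>With the single increment from \<open>x\<close> to \<open>y\<close>, the value at
  \<open>x\<close> is the sub-sum of the expansion at \<open>y\<close> that consists of the empty
  monomial.\<close>

lemma pre_stable_mono:
  assumes "pre_stable P Q f" "x \<preceq>\<^bsub>P\<^esub> y" "y \<in> uball P"
  shows "f x \<preceq>\<^bsub>Q\<^esub> f y"
proof -
  obtain v where v: "increments P {0::nat} x (\<lambda>_. v)" "y = x \<oplus>\<^bsub>P\<^esub> v"
    using P.increments_single[OF assms(2,3)] by blast
  obtain b where "expansion P Q f {0::nat} x (\<lambda>_. v) b"
    using pre_stable_expansion[OF assms(1) v(1)] by blast
  then have b: "moebius Q {0::nat} (\<lambda>I. f (x \<oplus>\<^bsub>P\<^esub> (\<Oplus>\<^bsub>P\<^esub>i\<in>I. v))) b"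
    by (simp add: expansion_def)
  have c: "x \<in> carrier P" "v \<in> carrier P" using v by (auto simp: increments_def)
  have "(\<Oplus>\<^bsub>Q\<^esub>J\<in>Pow {}. b J) \<preceq>\<^bsub>Q\<^esub> (\<Oplus>\<^bsub>Q\<^esub>J\<in>Pow {0}. b J)"
    using Q.moebius_Pi[OF b] by (intro Q.finsum_le_subset) auto
  then show ?thesis
    using Q.moebius_sum[OF b, of "{}"] Q.moebius_sum[OF b, of "{0}"] v c by simp
qed

lemma pre_stable_cong:
  assumes "pre_stable P Q f" "\<And>x. x \<in> uball P \<Longrightarrow> f x = g x"
  shows "pre_stable P Q g"
proof (rule pre_stableI)
  show "g x \<in> carrier Q" if "x \<in> uball P" for x
    using assms that pre_stable_funcset by fastforce
  show "\<exists>b. expansion P Q g A x u b" if "increments P A x u" for A :: "nat set" and x u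
    using pre_stable_expansion[OF assms(1) that] expansion_cong[OF that, of f _ g] assms(2) by blast
qed

lemma pre_stable_add:
  assumes "pre_stable P Q f" "pre_stable P Q g"
  shows "pre_stable P Q (\<lambda>x. f x \<oplus>\<^bsub>Q\<^esub> g x)"
proof (rule pre_stableI)
  show "\<exists>b. expansion P Q (\<lambda>x. f x \<oplus>\<^bsub>Q\<^esub> g x) A x u b" if "increments P A x u" for A :: "nat set" and x u
    using pre_stable_expansion[OF assms(1) that] pre_stable_expansion[OF assms(2) that]
      Q.moebius_add unfolding expansion_def by blast
qed (use assms pre_stable_funcset in auto)

lemma pre_stable_smult:
  assumes "0 \<le> a" "pre_stable P Q f"
  shows "pre_stable P Q (\<lambda>x. a \<odot>\<^bsub>Q\<^esub> f x)"
proof (rule pre_stableI)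
  show "\<exists>b. expansion P Q (\<lambda>x. a \<odot>\<^bsub>Q\<^esub> f x) A x u b" if "increments P A x u" for A :: "nat set" and x u
    using pre_stable_expansion[OF assms(2) that] Q.moebius_smult[OF P.increments_finite[OF that] assms(1)]
    unfolding expansion_def by blast
qed (use assms pre_stable_funcset Q.smult_closed in auto)

lemma pre_stable_const:
  assumes "c \<in> carrier Q"
  shows "pre_stable P Q (\<lambda>_. c)"
proof (rule pre_stableI)
  show "\<exists>b. expansion P Q (\<lambda>_. c) A x u b" if "increments P A x u" for A :: "nat set" and x u
    using Q.moebius_const[OF P.increments_finite[OF that] assms] unfolding expansion_def by blast
qed (use assms in auto)

end

section \<open>Additive maps and composition\<close>

text \<open>Applied to projections and to evaluation at a point, it shows that sums in products and
  function spaces are formed componentwise.\<close>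

lemma finsum_additive:
  assumes "pcone P" "pcone Q" "finite A" "u \<in> A \<rightarrow> carrier P"
    and \<phi>: "\<And>x. x \<in> carrier P \<Longrightarrow> \<phi> x \<in> carrier Q" "\<phi> \<zero>\<^bsub>P\<^esub> = \<zero>\<^bsub>Q\<^esub>"
      "\<And>x y. x \<in> carrier P \<Longrightarrow> y \<in> carrier P \<Longrightarrow> \<phi> (x \<oplus>\<^bsub>P\<^esub> y) = \<phi> x \<oplus>\<^bsub>Q\<^esub> \<phi> y"
  shows "\<phi> (\<Oplus>\<^bsub>P\<^esub>i\<in>A. u i) = (\<Oplus>\<^bsub>Q\<^esub>i\<in>A. \<phi> (u i))"
proof -
  interpret two_cones P Q using assms by (simp add: two_cones_def)
  show ?thesis using assms(3,4)
  proof (induction A rule: finite_induct)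
    case empty
    then show ?case using \<phi> by simp
  next
    case (insert a A)
    then have u: "u a \<in> carrier P" "u \<in> A \<rightarrow> carrier P" by auto
    have "\<phi> (\<Oplus>\<^bsub>P\<^esub>i\<in>insert a A. u i) = \<phi> (u a \<oplus>\<^bsub>P\<^esub> (\<Oplus>\<^bsub>P\<^esub>i\<in>A. u i))"
      using insert.hyps u by (subst P.finsum_insert) auto
    also have "\<dots> = \<phi> (u a) \<oplus>\<^bsub>Q\<^esub> (\<Oplus>\<^bsub>Q\<^esub>i\<in>A. \<phi> (u i))"
      using u insert.IH \<phi>(3) P.finsum_closed by metis
    also have "\<dots> = (\<Oplus>\<^bsub>Q\<^esub>i\<in>insert a A. \<phi> (u i))"
      using insert.hyps u \<phi>(1) by (subst Q.finsum_insert) auto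
    finally show ?case .
  qed
qed

text \<open>An additive map turns partial sums into partial sums of the images, which expand by
  \<open>moebius_linear\<close>.\<close>

lemma (in two_cones) pre_stable_additive:
  assumes \<phi>: "\<And>x. x \<in> carrier P \<Longrightarrow> \<phi> x \<in> carrier Q" "\<phi> \<zero>\<^bsub>P\<^esub> = \<zero>\<^bsub>Q\<^esub>"
      "\<And>x y. x \<in> carrier P \<Longrightarrow> y \<in> carrier P \<Longrightarrow> \<phi> (x \<oplus>\<^bsub>P\<^esub> y) = \<phi> x \<oplus>\<^bsub>Q\<^esub> \<phi> y"
  shows "pre_stable P Q \<phi>"
proof (rule pre_stableI)
  show "\<phi> x \<in> carrier Q" if "x \<in> uball P" for x
    using \<phi>(1) P.uball_carrier[OF that] by simp
  fix A :: "nat set" and x u assume inc: "increments P A x u"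
  have x: "x \<in> carrier P" using inc by (simp add: increments_def)
  have A: "finite A" using inc by (rule P.increments_finite)
  have u: "u i \<in> carrier P" if "i \<in> A" for i
    using P.increments_Pi[OF inc subset_refl] that by auto
  obtain b where b: "moebius Q A (\<lambda>I. \<phi> x \<oplus>\<^bsub>Q\<^esub> (\<Oplus>\<^bsub>Q\<^esub>i\<in>I. \<phi> (u i))) b"
    using Q.moebius_linear[OF A \<phi>(1)[OF x], of "\<lambda>i. \<phi> (u i)"] \<phi>(1) u by auto
  have "moebius Q A (\<lambda>I. \<phi> (x \<oplus>\<^bsub>P\<^esub> (\<Oplus>\<^bsub>P\<^esub>i\<in>I. u i))) b"
  proof (rule Q.moebius_cong[OF b])
    fix I assume I: "I \<subseteq> A"
    have uI: "u \<in> I \<rightarrow> carrier P" using P.increments_Pi[OF inc I] .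
    have "\<phi> (\<Oplus>\<^bsub>P\<^esub>i\<in>I. u i) = (\<Oplus>\<^bsub>Q\<^esub>i\<in>I. \<phi> (u i))"
      using finsum_additive[OF P.pcone_axioms Q.pcone_axioms _ uI] finite_subset[OF I A] \<phi> by auto
    then show "\<phi> x \<oplus>\<^bsub>Q\<^esub> (\<Oplus>\<^bsub>Q\<^esub>i\<in>I. \<phi> (u i)) = \<phi> (x \<oplus>\<^bsub>P\<^esub> (\<Oplus>\<^bsub>P\<^esub>i\<in>I. u i))"
      using \<phi>(3)[OF x P.finsum_closed[OF uI]] by simp
  qed
  then show "\<exists>b. expansion P Q \<phi> A x u b" by (auto simp: expansion_def)
qed

text \<open>
  Expand \<open>g\<close> along the family of coefficients of \<open>f\<close>: a monomial \<open>L\<close> of this second expansion is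
  active at \<open>I\<close> iff \<open>\<Union>L \<subseteq> I\<close>.
\<close>

lemma pre_stable_compose:
  assumes "pcone P" "pcone Q" "pcone R"
    and f: "pre_stable P Q f" "f \<in> uball P \<rightarrow> uball Q" and g: "pre_stable Q R g"
  shows "pre_stable P R (\<lambda>x. g (f x))"
proof -
  interpret PQ: two_cones P Q using assms by (simp add: two_cones_def)
  interpret QR: two_cones Q R using assms by (simp add: two_cones_def)
  interpret PR: two_cones P R using assms by (simp add: two_cones_def)
  show ?thesis
  proof (rule PR.pre_stableI)
    show "g (f x) \<in> carrier R" if "x \<in> uball P" for x
      using f(2) that QR.pre_stable_funcset[OF g] by auto
    fix A :: "nat set" and x u assume inc: "increments P A x u"
    let ?F = "\<lambda>I. f (x \<oplus>\<^bsub>P\<^esub> (\<Oplus>\<^bsub>P\<^esub>i\<in>I. u i))"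
    have A: "finite A" using inc by (rule PQ.P.increments_finite)
    obtain b where b: "moebius Q A ?F b"
      using PQ.pre_stable_expansion[OF f(1) inc] by (auto simp: expansion_def)
    have bc: "b J \<in> carrier Q" if "J \<subseteq> A" for J using PQ.Q.moebius_coeff[OF b that] .
    have F: "?F I = b {} \<oplus>\<^bsub>Q\<^esub> (\<Oplus>\<^bsub>Q\<^esub>J\<in>Pow I - {{}}. b J)" if "I \<subseteq> A" for I
    proof -
      have "finite I" using finite_subset[OF that A] .
      have "(\<Oplus>\<^bsub>Q\<^esub>J\<in>insert {} (Pow I - {{}}). b J) = b {} \<oplus>\<^bsub>Q\<^esub> (\<Oplus>\<^bsub>Q\<^esub>J\<in>Pow I - {{}}. b J)"
        using \<open>finite I\<close> bc that by (intro PQ.Q.finsum_insert) auto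
      moreover have "insert {} (Pow I - {{}}) = Pow I" by auto
      ultimately show ?thesis using PQ.Q.moebius_sum[OF b that] by simp
    qed
    \<comment> \<open>The coefficient of \<open>f\<close> at the empty set is the base point for
      \<open>g\<close>; the coefficients at the non-empty sets are its increments.\<close>
    define B where "B = Pow A - {{}}"
    have "?F A \<in> uball Q" using f(2) PQ.P.increments_uball[OF inc subset_refl] by auto
    then have "increments Q B (b {}) b"
      using A bc F[of A] by (auto simp: increments_def B_def)
    from QR.pre_stable_expansion[OF g this] obtain c where
      c: "moebius R B (\<lambda>L. g (b {} \<oplus>\<^bsub>Q\<^esub> (\<Oplus>\<^bsub>Q\<^esub>J\<in>L. b J))) c"
      by (auto simp: expansion_def)
    have cc: "c L \<in> carrier R" if "L \<subseteq> B" for L using QR.Q.moebius_coeff[OF c that] .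
    have "moebius R A (\<lambda>I. g (?F I)) (\<lambda>J. \<Oplus>\<^bsub>R\<^esub>L\<in>{L \<in> Pow B. \<Union>L = J}. c L)"
    proof (rule QR.Q.moebius_collect[OF A])
      show "finite (Pow B)" using A by (simp add: B_def)
      show "Union \<in> Pow B \<rightarrow> Pow A" by (auto simp: B_def)
      show "c \<in> Pow B \<rightarrow> carrier R" using cc by auto
      fix I assume I: "I \<subseteq> A"
      have sub: "Pow I - {{}} \<subseteq> B" using I by (auto simp: B_def)
      have "g (?F I) = (\<Oplus>\<^bsub>R\<^esub>L\<in>Pow (Pow I - {{}}). c L)"
        using QR.Q.moebius_sum[OF c sub] F[OF I] by simp
      also have "Pow (Pow I - {{}}) = {L \<in> Pow B. \<Union>L \<subseteq> I}"
        using I by (auto simp: B_def)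
      finally show "g (?F I) = (\<Oplus>\<^bsub>R\<^esub>L\<in>{L \<in> Pow B. \<Union>L \<subseteq> I}. c L)" .
    qed
    then show "\<exists>b. expansion P R (\<lambda>x. g (f x)) A x u b" by (auto simp: expansion_def)
  qed
qed


section \<open>Stable functions\<close>

context two_cones
begin

lemma stableI:
  assumes "pre_stable P Q f" "\<And>x. x \<in> uball P \<Longrightarrow> cnorm Q (f x) \<le> \<alpha>"
    "\<And>s x. uball_chain P s \<Longrightarrow> x \<in> uball P \<Longrightarrow> is_lub_seq P s x \<Longrightarrow> is_lub_seq Q (\<lambda>n. f (s n)) (f x)"
  shows "stable P Q f"
  unfolding stable_def scott_continuous_def
proof (intro conjI)
  show "f \<in> uball P \<rightarrow> carrier Q" using pre_stable_funcset[OF assms(1)] by simp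
  show "\<forall>x\<in>uball P. \<forall>y\<in>uball P. x \<preceq>\<^bsub>P\<^esub> y \<longrightarrow> f x \<preceq>\<^bsub>Q\<^esub> f y"
    using pre_stable_mono[OF assms(1)] by blast
  show "\<exists>\<alpha>. \<forall>x\<in>uball P. cnorm Q (f x) \<le> \<alpha>" using assms(2) by blast
  show "\<forall>s. uball_chain P s \<longrightarrow>
        (\<forall>x\<in>uball P. is_lub_seq P s x \<longrightarrow> is_lub_seq Q (\<lambda>n. f (s n)) (f x))"
    using assms(3) by blast
qed (rule assms(1))

lemma stable_pre_stable: "stable P Q f \<Longrightarrow> pre_stable P Q f"
  by (simp add: stable_def)

lemma stable_funcset: "stable P Q f \<Longrightarrow> x \<in> uball P \<Longrightarrow> f x \<in> carrier Q"
  using stable_pre_stable pre_stable_funcset by blast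

lemma stable_mono: "stable P Q f \<Longrightarrow> x \<preceq>\<^bsub>P\<^esub> y \<Longrightarrow> y \<in> uball P \<Longrightarrow> f x \<preceq>\<^bsub>Q\<^esub> f y"
  using stable_pre_stable pre_stable_mono by blast

lemma stable_bounded:
  assumes "stable P Q f"
  obtains \<alpha> where "0 \<le> \<alpha>" "\<And>x. x \<in> uball P \<Longrightarrow> cnorm Q (f x) \<le> \<alpha>"
proof -
  obtain \<alpha> where \<alpha>: "\<forall>x\<in>uball P. cnorm Q (f x) \<le> \<alpha>"
    using assms by (auto simp: stable_def scott_continuous_def)
  have "0 \<le> \<alpha>"
    using \<alpha> P.zero_uball Q.cnorm_nonneg[OF stable_funcset[OF assms P.zero_uball]] by force
  with \<alpha> that show ?thesis by blast
qed

lemma stable_lub: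
  "stable P Q f \<Longrightarrow> uball_chain P s \<Longrightarrow> x \<in> uball P \<Longrightarrow> is_lub_seq P s x \<Longrightarrow>
    is_lub_seq Q (\<lambda>n. f (s n)) (f x)"
  by (simp add: stable_def scott_continuous_def)

lemma stable_chain:
  "stable P Q f \<Longrightarrow> uball_chain P s \<Longrightarrow> f (s n) \<preceq>\<^bsub>Q\<^esub> f (s (Suc n))"
  by (simp add: uball_chain_def stable_mono)

lemma chain_uball: "uball_chain P s \<Longrightarrow> s n \<in> uball P"
  by (simp add: uball_chain_def)

lemma stable_cong:
  assumes "stable P Q f" "\<And>x. x \<in> uball P \<Longrightarrow> f x = g x"
  shows "stable P Q g"
proof -
  obtain \<alpha> where \<alpha>: "\<And>x. x \<in> uball P \<Longrightarrow> cnorm Q (f x) \<le> \<alpha>"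
    using stable_bounded[OF assms(1)] by metis
  show ?thesis
  proof (rule stableI)
    show "pre_stable P Q g"
      using pre_stable_cong[OF stable_pre_stable[OF assms(1)]] assms(2) by blast
    show "cnorm Q (g x) \<le> \<alpha>" if "x \<in> uball P" for x
      using \<alpha>[OF that] assms(2)[OF that] by simp
    show "is_lub_seq Q (\<lambda>n. g (s n)) (g x)"
      if "uball_chain P s" "x \<in> uball P" "is_lub_seq P s x" for s x
      using stable_lub[OF assms(1) that] assms(2) that chain_uball by simp
  qed
qed

lemma stable_add:
  assumes f: "stable P Q f" and g: "stable P Q g"
  shows "stable P Q (\<lambda>x. f x \<oplus>\<^bsub>Q\<^esub> g x)"
proof -
  obtain \<alpha> \<beta> where b: "\<And>x. x \<in> uball P \<Longrightarrow> cnorm Q (f x) \<le> \<alpha>" "\<And>x. x \<in> uball P \<Longrightarrow> cnorm Q (g x) \<le> \<beta>"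
    using stable_bounded[OF f] stable_bounded[OF g] by metis
  show ?thesis
  proof (rule stableI)
    show "pre_stable P Q (\<lambda>x. f x \<oplus>\<^bsub>Q\<^esub> g x)"
      using f g stable_pre_stable pre_stable_add by blast
    show "cnorm Q (f x \<oplus>\<^bsub>Q\<^esub> g x) \<le> \<alpha> + \<beta>" if "x \<in> uball P" for x
      using Q.cnorm_triangle[OF stable_funcset[OF f that] stable_funcset[OF g that]] b[OF that] by linarith
    show "is_lub_seq Q (\<lambda>n. f (s n) \<oplus>\<^bsub>Q\<^esub> g (s n)) (f x \<oplus>\<^bsub>Q\<^esub> g x)"
      if s: "uball_chain P s" "x \<in> uball P" "is_lub_seq P s x" for s x
      by (rule Q.lub_add[OF stable_chain[OF f s(1)] stable_lub[OF f s] stable_chain[OF g s(1)] stable_lub[OF g s]])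
  qed
qed

lemma stable_smult:
  assumes a: "0 \<le> a" and f: "stable P Q f"
  shows "stable P Q (\<lambda>x. a \<odot>\<^bsub>Q\<^esub> f x)"
proof -
  obtain \<alpha> where b: "\<And>x. x \<in> uball P \<Longrightarrow> cnorm Q (f x) \<le> \<alpha>"
    using stable_bounded[OF f] by metis
  show ?thesis
  proof (rule stableI)
    show "pre_stable P Q (\<lambda>x. a \<odot>\<^bsub>Q\<^esub> f x)"
      using pre_stable_smult[OF a stable_pre_stable[OF f]] .
    show "cnorm Q (a \<odot>\<^bsub>Q\<^esub> f x) \<le> a * \<alpha>" if "x \<in> uball P" for x
      using b[OF that] a by (simp add: Q.cnorm_smult stable_funcset[OF f that] mult_left_mono)
    show "is_lub_seq Q (\<lambda>n. a \<odot>\<^bsub>Q\<^esub> f (s n)) (a \<odot>\<^bsub>Q\<^esub> f x)"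
      if s: "uball_chain P s" "x \<in> uball P" "is_lub_seq P s x" for s x
      by (rule Q.lub_smult[OF a stable_lub[OF f s]])
  qed
qed

lemma stable_const: "c \<in> carrier Q \<Longrightarrow> stable P Q (\<lambda>_. c)"
  by (rule stableI[where \<alpha> = "cnorm Q c"]) (simp_all add: pre_stable_const Q.lub_const)

text \<open>Subtraction is not monotone in \<open>f\<close>, so \<open>f (s n)\<close> is first
  replaced by its limit: if \<open>w\<close> bounds all \<open>h (s n)\<close>, then
  \<open>f x \<oplus> w\<close> bounds all \<open>g (s n)\<close>, hence also
  \<open>g x = f x \<oplus> h x\<close>, and \<open>f x\<close> cancels. The bound on
  \<open>g\<close> serves for \<open>h\<close> by monotonicity of the norm.\<close>

lemma stable_diff:
  assumes f: "stable P Q f" and g: "stable P Q g" and h: "pre_stable P Q h"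
    and eq: "\<And>x. x \<in> uball P \<Longrightarrow> g x = f x \<oplus>\<^bsub>Q\<^esub> h x"
  shows "stable P Q h"
proof -
  obtain \<alpha> where b: "\<And>x. x \<in> uball P \<Longrightarrow> cnorm Q (g x) \<le> \<alpha>"
    using stable_bounded[OF g] by metis
  show ?thesis
  proof (rule stableI[OF h])
    fix x assume x: "x \<in> uball P"
    have c: "f x \<in> carrier Q" "h x \<in> carrier Q"
      using stable_funcset[OF f x] pre_stable_funcset[OF h x] .
    have "cnorm Q (h x) \<le> cnorm Q (h x \<oplus>\<^bsub>Q\<^esub> f x)"
      using c by (rule Q.cnorm_mono[rotated])
    also have "h x \<oplus>\<^bsub>Q\<^esub> f x = g x"
      using c eq[OF x] Q.a_comm by simp
    finally show "cnorm Q (h x) \<le> \<alpha>" using b[OF x] by simp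
  next
    fix s x assume s: "uball_chain P s" "x \<in> uball P" "is_lub_seq P s x"
    have c: "f x \<in> carrier Q" "h x \<in> carrier Q"
      using stable_funcset[OF f s(2)] pre_stable_funcset[OF h s(2)] .
    show "is_lub_seq Q (\<lambda>n. h (s n)) (h x)"
    proof (rule Q.lubI[OF c(2)])
      show "h (s n) \<preceq>\<^bsub>Q\<^esub> h x" for n
        by (rule pre_stable_mono[OF h P.lub_upper[OF s(3)] s(2)])
      fix w assume w: "w \<in> carrier Q" "\<And>n. h (s n) \<preceq>\<^bsub>Q\<^esub> w"
      have "g (s n) \<preceq>\<^bsub>Q\<^esub> f x \<oplus>\<^bsub>Q\<^esub> w" for n
        using eq[OF chain_uball[OF s(1), of n]] Q.lub_upper[OF stable_lub[OF f s], of n] w(2)[of n]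
        by (simp add: Q.add_mono)
      then have "g x \<preceq>\<^bsub>Q\<^esub> f x \<oplus>\<^bsub>Q\<^esub> w"
        by (rule Q.lub_least[OF stable_lub[OF g s]])
      then show "h x \<preceq>\<^bsub>Q\<^esub> w"
        using eq[OF s(2)] Q.add_le_cancel[OF c w(1)] by simp
    qed
  qed
qed

end

lemma stable_compose:
  assumes "pcone P" "pcone Q" "pcone R"
    and f: "stable P Q f" "f \<in> uball P \<rightarrow> uball Q" and g: "stable Q R g"
  shows "stable P R (\<lambda>x. g (f x))"
proof -
  interpret PQ: two_cones P Q using assms by (simp add: two_cones_def)
  interpret QR: two_cones Q R using assms by (simp add: two_cones_def)
  interpret PR: two_cones P R using assms by (simp add: two_cones_def)
  have fu: "f x \<in> uball Q" if "x \<in> uball P" for x using f(2) that by auto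
  obtain \<alpha> where b: "\<And>x. x \<in> uball Q \<Longrightarrow> cnorm R (g x) \<le> \<alpha>"
    using QR.stable_bounded[OF g] by metis
  show ?thesis
  proof (rule PR.stableI)
    show "pre_stable P R (\<lambda>x. g (f x))"
      using pre_stable_compose[OF assms(1-3) PQ.stable_pre_stable[OF f(1)] f(2) QR.stable_pre_stable[OF g]] .
    show "cnorm R (g (f x)) \<le> \<alpha>" if "x \<in> uball P" for x
      using b fu that by blast
    fix s x assume s: "uball_chain P s" "x \<in> uball P" "is_lub_seq P s x"
    have "uball_chain Q (\<lambda>n. f (s n))"
      using PQ.stable_chain[OF f(1) s(1)] fu PQ.chain_uball[OF s(1)] by (simp add: uball_chain_def)
    then show "is_lub_seq R (\<lambda>n. g (f (s n))) (g (f x))"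
      using QR.stable_lub[OF g _ fu[OF s(2)] PQ.stable_lub[OF f(1) s]] by simp
  qed
qed


section \<open>Measurability\<close>

lemma le_nonneg_cone: "x \<preceq>\<^bsub>nonneg_cone\<^esub> y \<longleftrightarrow> 0 \<le> x \<and> x \<le> y"
proof
  assume "0 \<le> x \<and> x \<le> y"
  then show "x \<preceq>\<^bsub>nonneg_cone\<^esub> y"
    unfolding cone_le_def nonneg_cone_def by (auto intro!: bexI[of _ "y - x"])
qed (auto simp: cone_le_def nonneg_cone_def)

lemma carrier_nonneg_cone: "carrier nonneg_cone = {0..}"
  by (simp add: nonneg_cone_def)

text \<open>Scott-continuity of tests is used as convergence in the reals, where limits of sums and
  of measurable functions are available.\<close>

lemma lub_nonneg_cone_LIMSEQ:
  assumes "is_lub_seq nonneg_cone s u" "incseq s"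
  shows "s \<longlonglongrightarrow> u"
proof -
  have ub: "0 \<le> s n" "s n \<le> u" for n
    using assms(1) by (auto simp: is_lub_seq_def le_nonneg_cone)
  obtain L where L: "s \<longlonglongrightarrow> L" "\<forall>i. s i \<le> L"
    using incseq_convergent[OF assms(2), of u] ub by blast
  have "u \<preceq>\<^bsub>nonneg_cone\<^esub> L"
    using assms(1) L(2) ub(1) order_trans[OF ub(1) spec[OF L(2)]]
    by (auto simp: is_lub_seq_def le_nonneg_cone carrier_nonneg_cone)
  moreover have "L \<le> u" using L(1) ub(2) by (intro LIMSEQ_le_const2) auto
  ultimately show ?thesis using L(1) by (auto simp: le_nonneg_cone)
qed

lemma lub_nonneg_coneI:
  assumes "s \<longlonglongrightarrow> u" "incseq s" "\<And>n. 0 \<le> s n"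
  shows "is_lub_seq nonneg_cone s u"
  unfolding is_lub_seq_def le_nonneg_cone
proof (intro conjI ballI impI allI)
  have "0 \<le> u" using assms(1,3) by (intro LIMSEQ_le_const) auto
  then show "u \<in> carrier nonneg_cone" "0 \<le> u" by (auto simp: nonneg_cone_def)
  show "s n \<le> u" for n using assms(1,2) by (rule incseq_le[rotated])
  show "u \<le> v" if "\<forall>n. 0 \<le> s n \<and> s n \<le> v" for v
    using assms(1) that by (intro LIMSEQ_le_const2) auto
qed (rule assms)

section \<open>Parameter spaces and measurable paths\<close>

abbreviation first_coords :: "nat \<Rightarrow> (nat \<Rightarrow> real) \<Rightarrow> nat \<Rightarrow> real" where
  "first_coords k w \<equiv> (\<lambda>i\<in>{..<k}. w i)"

abbreviation last_coords :: "nat \<Rightarrow> nat \<Rightarrow> (nat \<Rightarrow> real) \<Rightarrow> nat \<Rightarrow> real" where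
  "last_coords k n w \<equiv> (\<lambda>i\<in>{..<n}. w (k + i))"

lemma space_Rn: "space (Rn n) = extensional {..<n}"
  by (auto simp: Rn_def space_PiM PiE_def)

lemma coords_space: "(\<lambda>i\<in>{..<n}. f i) \<in> space (Rn n)"
  by (simp add: space_Rn)

lemma coord_measurable: "i < n \<Longrightarrow> (\<lambda>w. w i) \<in> borel_measurable (Rn n)"
  unfolding Rn_def by (rule measurable_component_singleton) simp

lemma measurable_Rn: "(\<And>i. i < n \<Longrightarrow> (\<lambda>x. f x i) \<in> borel_measurable M) \<Longrightarrow> (\<lambda>x. \<lambda>i\<in>{..<n}. f x i) \<in> M \<rightarrow>\<^sub>M Rn n"
  unfolding Rn_def by (rule measurable_restrict) simp

lemma first_coords_measurable: "(\<lambda>w. first_coords k w) \<in> Rn (k + n) \<rightarrow>\<^sub>M Rn k"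
  by (intro measurable_Rn coord_measurable) simp

lemma last_coords_measurable: "(\<lambda>w. last_coords k n w) \<in> Rn (k + n) \<rightarrow>\<^sub>M Rn n"
  by (intro measurable_Rn coord_measurable) simp

text \<open>Any two measurable parameter maps factor through one map into the joint space, on which
  measurability of paths is formulated.\<close>

lemma Rn_pair:
  assumes f: "f \<in> M \<rightarrow>\<^sub>M Rn k" and g: "g \<in> M \<rightarrow>\<^sub>M Rn n"
  obtains h where "h \<in> M \<rightarrow>\<^sub>M Rn (k + n)"
    "\<And>x. x \<in> space M \<Longrightarrow> first_coords k (h x) = f x" "\<And>x. x \<in> space M \<Longrightarrow> last_coords k n (h x) = g x"
proof
  let ?h = "\<lambda>x. \<lambda>i\<in>{..<k + n}. if i < k then f x i else g x (i - k)"
  show "?h \<in> M \<rightarrow>\<^sub>M Rn (k + n)"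
  proof (rule measurable_Rn)
    fix i assume "i < k + n"
    then show "(\<lambda>x. if i < k then f x i else g x (i - k)) \<in> borel_measurable M"
      using measurable_compose[OF f coord_measurable, of i] measurable_compose[OF g coord_measurable, of "i - k"]
      by (cases "i < k") auto
  qed
  fix x assume "x \<in> space M"
  then have "f x \<in> extensional {..<k}" "g x \<in> extensional {..<n}"
    using measurable_space[OF f] measurable_space[OF g] by (auto simp: space_Rn)
  then show "first_coords k (?h x) = f x" "last_coords k n (?h x) = g x"
    by (auto simp: fun_eq_iff extensional_def)
qed

lemma path_funcset: "measurable_path P n \<gamma> \<Longrightarrow> s \<in> space (Rn n) \<Longrightarrow> \<gamma> s \<in> carrier P"
  by (auto simp: measurable_path_def)

lemma path_bounded:
  assumes "measurable_path P n \<gamma>"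
  obtains \<alpha> where "\<And>s. s \<in> space (Rn n) \<Longrightarrow> cnorm P (\<gamma> s) \<le> \<alpha>"
  using assms that unfolding measurable_path_def by blast

text \<open>The working form of joint measurability: test and path may take their parameters from
  any common space. With identities for \<open>f\<close> and \<open>g\<close> this is the diagonal
  case that belongs to \<open>path_test\<close>.\<close>

lemma path_measurable:
  assumes \<gamma>: "measurable_path P n \<gamma>" and l: "l \<in> tests P k"
    and f: "f \<in> M \<rightarrow>\<^sub>M Rn k" and g: "g \<in> M \<rightarrow>\<^sub>M Rn n"
  shows "(\<lambda>x. l (f x) (\<gamma> (g x))) \<in> borel_measurable M"
proof -
  obtain h where h: "h \<in> M \<rightarrow>\<^sub>M Rn (k + n)"
    "\<And>x. x \<in> space M \<Longrightarrow> first_coords k (h x) = f x" "\<And>x. x \<in> space M \<Longrightarrow> last_coords k n (h x) = g x"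
    using Rn_pair[OF f g] by metis
  have "(\<lambda>w. l (first_coords k w) (\<gamma> (last_coords k n w))) \<in> borel_measurable (Rn (k + n))"
    using \<gamma> l by (simp add: measurable_path_def)
  from measurable_compose[OF h(1) this] show ?thesis
    using h(2,3) by (subst measurable_cong[where g = "\<lambda>x. l (first_coords k (h x)) (\<gamma> (last_coords k n (h x)))"]) simp_all
qed

lemma measurable_pathI:
  assumes "\<And>s. s \<in> space (Rn n) \<Longrightarrow> \<gamma> s \<in> carrier P" "\<And>s. s \<in> space (Rn n) \<Longrightarrow> cnorm P (\<gamma> s) \<le> \<alpha>"
    and "\<And>k l. l \<in> tests P k \<Longrightarrow>
      (\<lambda>w. l (first_coords k w) (\<gamma> (last_coords k n w))) \<in> borel_measurable (Rn (k + n))"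
  shows "measurable_path P n \<gamma>"
  using assms unfolding measurable_path_def by blast

lemma measurable_path_cong:
  assumes "measurable_path P n \<gamma>" "\<And>s. s \<in> space (Rn n) \<Longrightarrow> \<gamma> s = \<delta> s"
  shows "measurable_path P n \<delta>"
  using assms by (auto simp: measurable_path_def coords_space Pi_iff)

lemma measurable_path_compose:
  assumes \<gamma>: "measurable_path P n \<gamma>" and h: "h \<in> Rn p \<rightarrow>\<^sub>M Rn n"
  shows "measurable_path P p (\<lambda>s. \<gamma> (h s))"
proof -
  obtain \<alpha> where \<alpha>: "\<And>s. s \<in> space (Rn n) \<Longrightarrow> cnorm P (\<gamma> s) \<le> \<alpha>"
    using path_bounded[OF \<gamma>] by metis
  show ?thesis
  proof (rule measurable_pathI)
    fix k l assume "l \<in> tests P k"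
    then show "(\<lambda>w. l (first_coords k w) (\<gamma> (h (last_coords k p w)))) \<in> borel_measurable (Rn (k + p))"
      by (rule path_measurable[OF \<gamma> _ first_coords_measurable measurable_compose[OF last_coords_measurable h]])
  qed (use path_funcset[OF \<gamma>] \<alpha> measurable_space[OF h] in auto)
qed

lemma uball_paths_compose:
  "\<gamma> \<in> uball_paths P n \<Longrightarrow> h \<in> Rn p \<rightarrow>\<^sub>M Rn n \<Longrightarrow> (\<lambda>s. \<gamma> (h s)) \<in> uball_paths P p"
  using measurable_path_compose measurable_space[of h "Rn p" "Rn n"] by (fastforce simp: uball_paths_def)

lemma uball_paths_uball: "\<gamma> \<in> uball_paths P n \<Longrightarrow> s \<in> space (Rn n) \<Longrightarrow> \<gamma> s \<in> uball P"
  by (auto simp: uball_paths_def)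

lemma uball_paths_path: "\<gamma> \<in> uball_paths P n \<Longrightarrow> measurable_path P n \<gamma>"
  by (simp add: uball_paths_def)

section \<open>Measurability tests\<close>

context measurable_cone
begin

lemma test_dual: "l \<in> tests P n \<Longrightarrow> r \<in> space (Rn n) \<Longrightarrow> l r \<in> cone_dual P"
  using tests_dual by blast

lemma test_nonneg: "l \<in> tests P n \<Longrightarrow> r \<in> space (Rn n) \<Longrightarrow> x \<in> carrier P \<Longrightarrow> 0 \<le> l r x"
  using test_dual by (fastforce simp: cone_dual_def PiE_iff)

lemma test_add:
  "l \<in> tests P n \<Longrightarrow> r \<in> space (Rn n) \<Longrightarrow> x \<in> carrier P \<Longrightarrow> y \<in> carrier P \<Longrightarrow> l r (x \<oplus> y) = l r x + l r y"
  using test_dual by (fastforce simp: cone_dual_def)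

lemma test_smult:
  "l \<in> tests P n \<Longrightarrow> r \<in> space (Rn n) \<Longrightarrow> 0 \<le> a \<Longrightarrow> x \<in> carrier P \<Longrightarrow> l r (a \<odot> x) = a * l r x"
  using test_dual by (fastforce simp: cone_dual_def)

lemma test_mono: "l \<in> tests P n \<Longrightarrow> r \<in> space (Rn n) \<Longrightarrow> x \<preceq> y \<Longrightarrow> l r x \<le> l r y"
  unfolding cone_le_def using test_nonneg test_add by fastforce

lemma test_scott: "l \<in> tests P n \<Longrightarrow> r \<in> space (Rn n) \<Longrightarrow> scott_continuous P nonneg_cone (l r)"
  using test_dual by (fastforce simp: cone_dual_def)

lemma test_LIMSEQ:
  assumes "l \<in> tests P n" "r \<in> space (Rn n)" "uball_chain P s" "x \<in> uball P" "is_lub_seq P s x"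
  shows "(\<lambda>n. l r (s n)) \<longlonglongrightarrow> l r x"
proof (rule lub_nonneg_cone_LIMSEQ)
  show "is_lub_seq nonneg_cone (\<lambda>n. l r (s n)) (l r x)"
    using test_scott[OF assms(1,2)] assms(3-5) by (simp add: scott_continuous_def)
  show "incseq (\<lambda>n. l r (s n))"
    using assms(3) test_mono[OF assms(1,2)] by (auto intro!: incseq_SucI simp: uball_chain_def)
qed

lemma test_bounded:
  assumes "l \<in> tests P n" "r \<in> space (Rn n)"
  obtains \<alpha> where "\<And>x. x \<in> uball P \<Longrightarrow> l r x \<le> \<alpha>"
  using test_scott[OF assms] by (auto simp: scott_continuous_def nonneg_cone_def)

lemma measurable_path_const: "c \<in> carrier P \<Longrightarrow> measurable_path P n (\<lambda>_. c)"
  by (rule measurable_pathI[where \<alpha> = "cnorm P c"])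
    (auto intro: measurable_compose[OF first_coords_measurable tests_measurable])

end

section \<open>Measurable stable functions\<close>

locale two_mcones = P: measurable_cone P + Q: measurable_cone Q
  for P :: "('a, 'm) mcone_scheme" and Q :: "('b, 'k) mcone_scheme"

sublocale two_mcones \<subseteq> two_cones P Q
  by unfold_locales

context two_mcones
begin

lemma measurable_stable_stable: "measurable_stable P Q f \<Longrightarrow> stable P Q f"
  by (simp add: measurable_stable_def)

lemma measurable_stable_path:
  "measurable_stable P Q f \<Longrightarrow> \<gamma> \<in> uball_paths P n \<Longrightarrow> measurable_path Q n (\<lambda>s. f (\<gamma> s))"
  by (simp add: measurable_stable_def)

lemma measurable_stableI:
  assumes f: "stable P Q f"
    and m: "\<And>n \<gamma> k l. \<gamma> \<in> uball_paths P n \<Longrightarrow> l \<in> tests Q k \<Longrightarrow>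
      (\<lambda>w. l (first_coords k w) (f (\<gamma> (last_coords k n w)))) \<in> borel_measurable (Rn (k + n))"
  shows "measurable_stable P Q f"
  unfolding measurable_stable_def
proof (intro conjI allI ballI f)
  obtain \<alpha> where b: "\<And>x. x \<in> uball P \<Longrightarrow> cnorm Q (f x) \<le> \<alpha>"
    using stable_bounded[OF f] by metis
  fix n \<gamma> assume \<gamma>: "\<gamma> \<in> uball_paths P n"
  show "measurable_path Q n (\<lambda>s. f (\<gamma> s))"
    by (rule measurable_pathI)
      (use uball_paths_uball[OF \<gamma>] stable_funcset[OF f] b m[OF \<gamma>] in auto)
qed

lemma measurable_stable_measurable:
  assumes "measurable_stable P Q f" "\<gamma> \<in> uball_paths P n" "l \<in> tests Q k"
  shows "(\<lambda>w. l (first_coords k w) (f (\<gamma> (last_coords k n w)))) \<in> borel_measurable (Rn (k + n))"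
  using path_measurable[OF measurable_stable_path[OF assms(1,2)] assms(3)
      first_coords_measurable last_coords_measurable] .

lemma measurable_stable_cong:
  assumes f: "measurable_stable P Q f" and eq: "\<And>x. x \<in> uball P \<Longrightarrow> f x = g x"
  shows "measurable_stable P Q g"
  unfolding measurable_stable_def
proof (intro conjI allI ballI)
  show "stable P Q g"
    using stable_cong[OF measurable_stable_stable[OF f]] eq by blast
  show "measurable_path Q n (\<lambda>s. g (\<gamma> s))" if "\<gamma> \<in> uball_paths P n" for n \<gamma>
    by (rule measurable_path_cong[OF measurable_stable_path[OF f that]])
      (use eq uball_paths_uball[OF that] in simp)
qed

lemma measurable_stable_add:
  assumes f: "measurable_stable P Q f" and g: "measurable_stable P Q g"
  shows "measurable_stable P Q (\<lambda>x. f x \<oplus>\<^bsub>Q\<^esub> g x)"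
proof (rule measurable_stableI)
  show "stable P Q (\<lambda>x. f x \<oplus>\<^bsub>Q\<^esub> g x)"
    using stable_add[OF measurable_stable_stable[OF f] measurable_stable_stable[OF g]] .
  fix n \<gamma> k l assume *: "\<gamma> \<in> uball_paths P n" "l \<in> tests Q k"
  have "(\<lambda>w. l (first_coords k w) (f (\<gamma> (last_coords k n w))) + l (first_coords k w) (g (\<gamma> (last_coords k n w))))
      \<in> borel_measurable (Rn (k + n))"
    using measurable_stable_measurable[OF f *] measurable_stable_measurable[OF g *] by (rule borel_measurable_add)
  then show "(\<lambda>w. l (first_coords k w) (f (\<gamma> (last_coords k n w)) \<oplus>\<^bsub>Q\<^esub> g (\<gamma> (last_coords k n w))))
      \<in> borel_measurable (Rn (k + n))"
    by (simp add: Q.test_add[OF *(2)] coords_space uball_paths_uball[OF *(1)]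
      stable_funcset[OF measurable_stable_stable[OF f]] stable_funcset[OF measurable_stable_stable[OF g]])
qed

lemma measurable_stable_smult:
  assumes a: "0 \<le> a" and f: "measurable_stable P Q f"
  shows "measurable_stable P Q (\<lambda>x. a \<odot>\<^bsub>Q\<^esub> f x)"
proof (rule measurable_stableI)
  show "stable P Q (\<lambda>x. a \<odot>\<^bsub>Q\<^esub> f x)"
    using stable_smult[OF a measurable_stable_stable[OF f]] .
  fix n \<gamma> k l assume *: "\<gamma> \<in> uball_paths P n" "l \<in> tests Q k"
  have "(\<lambda>w. a * l (first_coords k w) (f (\<gamma> (last_coords k n w)))) \<in> borel_measurable (Rn (k + n))"
    using measurable_stable_measurable[OF f *] by simp
  then show "(\<lambda>w. l (first_coords k w) (a \<odot>\<^bsub>Q\<^esub> f (\<gamma> (last_coords k n w)))) \<in> borel_measurable (Rn (k + n))"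
    by (simp add: Q.test_smult[OF *(2) _ a] coords_space uball_paths_uball[OF *(1)]
      stable_funcset[OF measurable_stable_stable[OF f]])
qed

lemma measurable_stable_const: "c \<in> carrier Q \<Longrightarrow> measurable_stable P Q (\<lambda>_. c)"
  by (simp add: measurable_stable_def stable_const Q.measurable_path_const)

text \<open>Tests are additive, so under a test the difference in the cone becomes a genuine
  subtraction of measurable real functions.\<close>

lemma measurable_stable_diff:
  assumes f: "measurable_stable P Q f" and g: "measurable_stable P Q g" and h: "pre_stable P Q h"
    and eq: "\<And>x. x \<in> uball P \<Longrightarrow> g x = f x \<oplus>\<^bsub>Q\<^esub> h x"
  shows "measurable_stable P Q h"
proof (rule measurable_stableI)
  show "stable P Q h"
    using stable_diff[OF measurable_stable_stable[OF f] measurable_stable_stable[OF g] h eq] .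
  fix n \<gamma> k l assume *: "\<gamma> \<in> uball_paths P n" "l \<in> tests Q k"
  have "(\<lambda>w. l (first_coords k w) (g (\<gamma> (last_coords k n w))) - l (first_coords k w) (f (\<gamma> (last_coords k n w))))
      \<in> borel_measurable (Rn (k + n))"
    using measurable_stable_measurable[OF g *] measurable_stable_measurable[OF f *] by (rule borel_measurable_diff)
  then show "(\<lambda>w. l (first_coords k w) (h (\<gamma> (last_coords k n w)))) \<in> borel_measurable (Rn (k + n))"
    by (simp add: eq Q.test_add[OF *(2)] coords_space uball_paths_uball[OF *(1)]
      stable_funcset[OF measurable_stable_stable[OF f]] pre_stable_funcset[OF h])
qed

lemma measurable_stable_finsum:
  assumes "finite A" "\<And>i. i \<in> A \<Longrightarrow> measurable_stable P Q (f i)"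
  shows "measurable_stable P Q (\<lambda>x. \<Oplus>\<^bsub>Q\<^esub>i\<in>A. f i x)"
  using assms
proof (induction A rule: finite_induct)
  case empty
  then show ?case by (simp add: measurable_stable_const)
next
  case (insert a A)
  then have "measurable_stable P Q (\<lambda>x. f a x \<oplus>\<^bsub>Q\<^esub> (\<Oplus>\<^bsub>Q\<^esub>i\<in>A. f i x))"
    by (intro measurable_stable_add) auto
  then show ?case
  proof (rule measurable_stable_cong)
    fix x assume "x \<in> uball P"
    then have "f i x \<in> carrier Q" if "i \<in> insert a A" for i
      using insert.prems[OF that] measurable_stable_stable stable_funcset by blast
    then show "f a x \<oplus>\<^bsub>Q\<^esub> (\<Oplus>\<^bsub>Q\<^esub>i\<in>A. f i x) = (\<Oplus>\<^bsub>Q\<^esub>i\<in>insert a A. f i x)"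
      using insert.hyps by (subst Q.finsum_insert) auto
  qed
qed

lemma Cstab_iff: "f \<in> Cstab P Q \<longleftrightarrow> f \<in> uball P \<rightarrow>\<^sub>E uball Q \<and> measurable_stable P Q f"
  by (simp add: Cstab_def)

end

lemma measurable_stable_compose:
  assumes "measurable_cone P" "measurable_cone Q" "measurable_cone R"
    and f: "measurable_stable P Q f" "f \<in> uball P \<rightarrow> uball Q" and g: "measurable_stable Q R g"
  shows "measurable_stable P R (\<lambda>x. g (f x))"
proof -
  interpret PQ: two_mcones P Q using assms by (simp add: two_mcones_def)
  interpret QR: two_mcones Q R using assms by (simp add: two_mcones_def)
  have "stable P R (\<lambda>x. g (f x))"
    by (rule stable_compose[OF PQ.P.pcone_axioms PQ.Q.pcone_axioms QR.Q.pcone_axioms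
          PQ.measurable_stable_stable[OF f(1)] f(2) QR.measurable_stable_stable[OF g]])
  moreover have "(\<lambda>s. f (\<gamma> s)) \<in> uball_paths Q n" if "\<gamma> \<in> uball_paths P n" for \<gamma> n
    using PQ.measurable_stable_path[OF f(1) that] uball_paths_uball[OF that] f(2)
    by (auto simp: uball_paths_def)
  ultimately show ?thesis
    using QR.measurable_stable_path[OF g] by (simp add: measurable_stable_def)
qed

lemma Cstab_restrict:
  assumes "measurable_cone P" "measurable_cone Q" "measurable_stable P Q f" "\<And>x. x \<in> uball P \<Longrightarrow> f x \<in> uball Q"
  shows "(\<lambda>x\<in>uball P. f x) \<in> Cstab P Q"
proof -
  interpret two_mcones P Q using assms by (simp add: two_mcones_def)
  show ?thesis
    using assms(4) measurable_stable_cong[OF assms(3), of "\<lambda>x\<in>uball P. f x"] by (auto simp: Cstab_iff)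
qed

lemma Cstab_apply: "f \<in> Cstab P Q \<Longrightarrow> x \<in> uball P \<Longrightarrow> f x \<in> uball Q"
  by (auto simp: Cstab_def)

lemma Cstab_extensional: "f \<in> Cstab P Q \<Longrightarrow> f \<in> extensional (uball P)"
  by (auto simp: Cstab_def PiE_iff)

lemma Cstab_measurable_stable: "f \<in> Cstab P Q \<Longrightarrow> measurable_stable P Q f"
  by (simp add: Cstab_def)

lemma measurable_stable_id:
  assumes "measurable_cone P"
  shows "measurable_stable P P (\<lambda>x. x)"
proof -
  interpret two_mcones P P using assms by (simp add: two_mcones_def)
  have "pre_stable P P (\<lambda>x. x)" by (rule pre_stable_additive) auto
  then have "stable P P (\<lambda>x. x)"
    by (rule stableI[where \<alpha> = 1]) (auto simp: uball_def)
  then show ?thesis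
    by (simp add: measurable_stable_def uball_paths_def)
qed

lemma Cstab_id: "measurable_cone P \<Longrightarrow> cone_id P \<in> Cstab P P"
  unfolding cone_id_def by (rule Cstab_restrict[OF _ _ measurable_stable_id])

lemma Cstab_comp:
  assumes "measurable_cone P" "measurable_cone Q" "measurable_cone R" "f \<in> Cstab P Q" "g \<in> Cstab Q R"
  shows "cone_comp P g f \<in> Cstab P R"
  unfolding cone_comp_def compose_def
proof (rule Cstab_restrict[OF assms(1,3)])
  show "measurable_stable P R (\<lambda>x. g (f x))"
    using assms(4,5) by (intro measurable_stable_compose[OF assms(1-3)]) (auto simp: Cstab_def)
qed (use Cstab_apply[OF assms(4)] Cstab_apply[OF assms(5)] in blast)


section \<open>Terminal object and products\<close>

lemma carrier_one_cone: "carrier one_cone = UNIV"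
  by (auto simp: one_cone_def)

lemma one_cone_measurable_complete: "measurable_complete_cone one_cone"
proof -
  have pc: "pcone one_cone"
    by (intro pcone.intro abelian_monoidI pcone_axioms.intro) (simp_all add: one_cone_def)
  interpret pcone one_cone by (rule pc)
  have "(\<lambda>_\<in>carrier one_cone. 0) \<in> cone_dual one_cone"
    by (auto simp: cone_dual_def scott_continuous_def le_nonneg_cone one_cone_def
        carrier_nonneg_cone uball_def is_lub_seq_def)
  then have dual: "(\<lambda>_. 0) \<in> cone_dual one_cone"
    by (simp add: carrier_one_cone restrict_def)
  have "measurable_cone one_cone"
  proof (intro measurable_cone.intro pc measurable_cone_axioms.intro)
    show "tests one_cone n \<subseteq> space (Rn n) \<rightarrow>\<^sub>E cone_dual one_cone" for n
      using dual by (auto simp: one_cone_def)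
    show "(\<lambda>r\<in>space (Rn n). \<lambda>x\<in>carrier one_cone. 0) \<in> tests one_cone n" for n
      unfolding carrier_one_cone by (simp add: one_cone_def restrict_def)
    show "compose (space (Rn p)) l h \<in> tests one_cone p"
      if "l \<in> tests one_cone n" "h \<in> Rn p \<rightarrow>\<^sub>M Rn n" for l n h p
      using that measurable_space[OF that(2)] by (auto simp: one_cone_def compose_def fun_eq_iff)
    show "(\<lambda>r. l r x) \<in> borel_measurable (Rn n)" if "l \<in> tests one_cone n" for l n x
    proof -
      have "(\<lambda>r. l r x) \<in> borel_measurable (Rn n) \<longleftrightarrow> (\<lambda>_. 0 :: real) \<in> borel_measurable (Rn n)"
        using that by (intro measurable_cong) (auto simp: one_cone_def)
      then show ?thesis by simp
    qed
  qed
  moreover have "complete_pcone one_cone"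
    by (intro complete_pcone.intro pc complete_pcone_axioms.intro)
      (auto simp: uball_def is_lub_seq_def cone_le_def one_cone_def)
  ultimately show ?thesis by (simp add: measurable_complete_cone_def)
qed

lemma terminal_unique:
  assumes "measurable_cone R"
  shows "\<exists>!f. f \<in> Cstab R one_cone"
proof -
  interpret one: measurable_complete_cone one_cone by (rule one_cone_measurable_complete)
  interpret two_mcones R one_cone using assms one.measurable_cone_axioms by (simp add: two_mcones_def)
  have "(\<lambda>x\<in>uball R. ()) \<in> Cstab R one_cone"
    by (rule Cstab_restrict[OF assms one.measurable_cone_axioms measurable_stable_const])
      (auto simp: one_cone_def uball_def)
  moreover have "f = g" if "f \<in> Cstab R one_cone" "g \<in> Cstab R one_cone" for f g
    by (rule ext) simp
  ultimately show ?thesis by blast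
qed

section \<open>Binary products\<close>

lemma carrier_prod_cone: "carrier (prod_cone P Q) = carrier P \<times> carrier Q"
  and zero_prod_cone: "\<zero>\<^bsub>prod_cone P Q\<^esub> = (\<zero>\<^bsub>P\<^esub>, \<zero>\<^bsub>Q\<^esub>)"
  and add_prod_cone: "z \<oplus>\<^bsub>prod_cone P Q\<^esub> z' = (fst z \<oplus>\<^bsub>P\<^esub> fst z', snd z \<oplus>\<^bsub>Q\<^esub> snd z')"
  and smult_prod_cone: "a \<odot>\<^bsub>prod_cone P Q\<^esub> z = (a \<odot>\<^bsub>P\<^esub> fst z, a \<odot>\<^bsub>Q\<^esub> snd z)"
  and cnorm_prod_cone: "cnorm (prod_cone P Q) z = max (cnorm P (fst z)) (cnorm Q (snd z))"
  by (simp_all add: prod_cone_def case_prod_beta)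

lemmas prod_cone_simps = carrier_prod_cone zero_prod_cone add_prod_cone smult_prod_cone cnorm_prod_cone

lemma uball_prod_cone: "uball (prod_cone P Q) = uball P \<times> uball Q"
  by (auto simp: uball_def prod_cone_simps)

lemma le_prod_cone: "z \<preceq>\<^bsub>prod_cone P Q\<^esub> z' \<longleftrightarrow> fst z \<preceq>\<^bsub>P\<^esub> fst z' \<and> snd z \<preceq>\<^bsub>Q\<^esub> snd z'"
  by (cases z; cases z') (auto simp: cone_le_def prod_cone_simps)

lemma uball_chain_prod_cone:
  "uball_chain (prod_cone P Q) s \<longleftrightarrow> uball_chain P (\<lambda>n. fst (s n)) \<and> uball_chain Q (\<lambda>n. snd (s n))"
  by (auto simp: uball_chain_def uball_prod_cone le_prod_cone mem_Times_iff)

lemma lub_prod_cone: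
  "is_lub_seq (prod_cone P Q) s z \<longleftrightarrow>
    is_lub_seq P (\<lambda>n. fst (s n)) (fst z) \<and> is_lub_seq Q (\<lambda>n. snd (s n)) (snd z)"
  by (cases z) (auto simp: is_lub_seq_def carrier_prod_cone le_prod_cone)

locale mcone_pair = two_mcones P Q for P :: "'a mcone" and Q :: "'b mcone"

lemma prod_cone_pcone:
  assumes "pcone P" "pcone Q"
  shows "pcone (prod_cone P Q)"
proof -
  interpret two_cones P Q using assms by (simp add: two_cones_def)
  show ?thesis
  proof (intro pcone.intro abelian_monoidI pcone_axioms.intro; (elim conjE)?)
    fix x y y' assume "x \<in> carrier (prod_cone P Q)" "y \<in> carrier (prod_cone P Q)"
      "y' \<in> carrier (prod_cone P Q)" "x \<oplus>\<^bsub>prod_cone P Q\<^esub> y = x \<oplus>\<^bsub>prod_cone P Q\<^esub> y'"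
    then show "y = y'"
      using P.add_cancel[of "fst x" "fst y" "fst y'"] Q.add_cancel[of "snd x" "snd y" "snd y'"]
      by (auto simp: prod_cone_simps prod_eq_iff)
  next
    fix x assume x: "x \<in> carrier (prod_cone P Q)" "cnorm (prod_cone P Q) x = 0"
    then have "cnorm P (fst x) = 0" "cnorm Q (snd x) = 0"
      using P.cnorm_nonneg[of "fst x"] Q.cnorm_nonneg[of "snd x"]
      by (auto simp: prod_cone_simps max_def split: if_splits)
    then show "x = \<zero>\<^bsub>prod_cone P Q\<^esub>"
      using x P.cnorm_zero Q.cnorm_zero by (auto simp: prod_cone_simps prod_eq_iff)
  next
    fix x x' assume x: "x \<in> carrier (prod_cone P Q)" "x' \<in> carrier (prod_cone P Q)"
    then show "cnorm (prod_cone P Q) (x \<oplus>\<^bsub>prod_cone P Q\<^esub> x')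
        \<le> cnorm (prod_cone P Q) x + cnorm (prod_cone P Q) x'"
      using P.cnorm_triangle[of "fst x" "fst x'"] Q.cnorm_triangle[of "snd x" "snd x'"]
      by (auto simp: prod_cone_simps max_def)
    show "cnorm (prod_cone P Q) x \<le> cnorm (prod_cone P Q) (x \<oplus>\<^bsub>prod_cone P Q\<^esub> x')"
      using x P.cnorm_mono[of "fst x" "fst x'"] Q.cnorm_mono[of "snd x" "snd x'"]
      by (auto simp: prod_cone_simps max_def)
  qed (auto simp: prod_cone_simps P.a_ac Q.a_ac P.smult_closed Q.smult_closed
      P.smult_r_distr Q.smult_r_distr P.smult_l_distr Q.smult_l_distr P.smult_assoc Q.smult_assoc
      P.smult_one Q.smult_one P.smult_zero_scalar Q.smult_zero_scalar P.smult_zero Q.smult_zero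
      P.cnorm_smult Q.cnorm_smult max_mult_distrib_left le_max_iff_disj P.cnorm_nonneg)
qed

lemma prod_cone_complete:
  assumes "complete_pcone P" "complete_pcone Q"
  shows "complete_pcone (prod_cone P Q)"
proof (intro complete_pcone.intro complete_pcone_axioms.intro)
  interpret P: complete_pcone P + Q: complete_pcone Q using assms by auto
  show "pcone (prod_cone P Q)" by (rule prod_cone_pcone[OF P.pcone_axioms Q.pcone_axioms])
  fix s assume "uball_chain (prod_cone P Q) s"
  then obtain x y where "x \<in> uball P" "is_lub_seq P (\<lambda>n. fst (s n)) x"
    "y \<in> uball Q" "is_lub_seq Q (\<lambda>n. snd (s n)) y"
    using P.complete Q.complete unfolding uball_chain_prod_cone by metis
  then show "\<exists>u\<in>uball (prod_cone P Q). is_lub_seq (prod_cone P Q) s u"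
    by (intro bexI[of _ "(x, y)"]) (auto simp: uball_prod_cone lub_prod_cone)
qed

context mcone_pair
begin

abbreviation (input) prod_test where
  "prod_test n l m \<equiv> (\<lambda>r\<in>space (Rn n). \<lambda>(x, y)\<in>carrier P \<times> carrier Q. l r x + m r y)"

lemma tests_prod_cone: "tests (prod_cone P Q) n = {prod_test n l m |l m. l \<in> tests P n \<and> m \<in> tests Q n}"
  by (simp add: prod_cone_def)

text \<open>Least upper bounds in the product are componentwise, so Scott-continuity of the test
  reduces to the sum of two convergent real sequences.\<close>

lemma prod_test_dual:
  assumes l: "l \<in> tests P n" and m: "m \<in> tests Q n" and r: "r \<in> space (Rn n)"
  shows "(\<lambda>(x, y)\<in>carrier P \<times> carrier Q. l r x + m r y) \<in> cone_dual (prod_cone P Q)"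
proof -
  let ?t = "\<lambda>(x, y)\<in>carrier P \<times> carrier Q. l r x + m r y"
  have app: "?t z = l r (fst z) + m r (snd z)" if "z \<in> carrier P \<times> carrier Q" for z
    using that by auto
  have ub: "z \<in> carrier P \<times> carrier Q" if "z \<in> uball (prod_cone P Q)" for z
    using that by (auto simp: uball_prod_cone P.uball_carrier Q.uball_carrier)
  have nonneg: "0 \<le> ?t z" if "z \<in> carrier P \<times> carrier Q" for z
    using that P.test_nonneg[OF l r] Q.test_nonneg[OF m r] by (auto intro!: add_nonneg_nonneg)
  have mono: "?t z \<le> ?t z'" if "z \<preceq>\<^bsub>prod_cone P Q\<^esub> z'" for z z'
  proof -
    have "z \<in> carrier P \<times> carrier Q" "z' \<in> carrier P \<times> carrier Q"
      using that P.le_carrier Q.le_carrier by (auto simp: le_prod_cone mem_Times_iff)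
    then show ?thesis
      using that P.test_mono[OF l r] Q.test_mono[OF m r] unfolding app
      by (simp only: app) (auto simp: le_prod_cone intro!: add_mono)
  qed
  have "scott_continuous (prod_cone P Q) nonneg_cone ?t"
    unfolding scott_continuous_def
  proof (intro conjI allI ballI impI)
    show "?t \<in> uball (prod_cone P Q) \<rightarrow> carrier nonneg_cone"
      using nonneg ub by (simp add: carrier_nonneg_cone)
    obtain \<alpha> where \<alpha>: "\<And>x. x \<in> uball P \<Longrightarrow> l r x \<le> \<alpha>" using P.test_bounded[OF l r] by metis
    obtain \<beta> where \<beta>: "\<And>x. x \<in> uball Q \<Longrightarrow> m r x \<le> \<beta>" using Q.test_bounded[OF m r] by metis
    show "\<exists>\<alpha>. \<forall>x\<in>uball (prod_cone P Q). cnorm nonneg_cone (?t x) \<le> \<alpha>"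
    proof (intro exI ballI)
      fix z assume "z \<in> uball (prod_cone P Q)"
      then show "cnorm nonneg_cone (?t z) \<le> \<alpha> + \<beta>"
        using \<alpha>[of "fst z"] \<beta>[of "snd z"] app[OF ub] by (simp add: nonneg_cone_def uball_prod_cone mem_Times_iff)
    qed
    show "?t z \<preceq>\<^bsub>nonneg_cone\<^esub> ?t z'"
      if "z \<in> uball (prod_cone P Q)" "z' \<in> uball (prod_cone P Q)" "z \<preceq>\<^bsub>prod_cone P Q\<^esub> z'" for z z'
      using nonneg[OF ub[OF that(1)]] mono[OF that(3)] by (simp only: le_nonneg_cone)
    fix s z
    assume s: "uball_chain (prod_cone P Q) s" "z \<in> uball (prod_cone P Q)" "is_lub_seq (prod_cone P Q) s z"
    have su: "s n \<in> carrier P \<times> carrier Q" for n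
      using s(1) ub by (simp add: uball_chain_def)
    have "(\<lambda>n. l r (fst (s n)) + m r (snd (s n))) \<longlonglongrightarrow> l r (fst z) + m r (snd z)"
      using s P.test_LIMSEQ[OF l r, of "\<lambda>n. fst (s n)" "fst z"] Q.test_LIMSEQ[OF m r, of "\<lambda>n. snd (s n)" "snd z"]
      by (intro tendsto_add) (auto simp: uball_chain_prod_cone lub_prod_cone uball_prod_cone)
    then have "(\<lambda>n. ?t (s n)) \<longlonglongrightarrow> ?t z"
      by (simp only: app[OF su] app[OF ub[OF s(2)]])
    moreover have "incseq (\<lambda>n. ?t (s n))"
      using s(1) mono by (intro incseq_SucI) (simp only: uball_chain_def)
    ultimately show "is_lub_seq nonneg_cone (\<lambda>n. ?t (s n)) (?t z)"
      using nonneg[OF su] by (intro lub_nonneg_coneI)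
  qed
  moreover have "?t \<in> carrier (prod_cone P Q) \<rightarrow>\<^sub>E {0..}"
    using nonneg by (auto simp: carrier_prod_cone)
  moreover have "?t (z \<oplus>\<^bsub>prod_cone P Q\<^esub> z') = ?t z + ?t z'"
    if "z \<in> carrier (prod_cone P Q)" "z' \<in> carrier (prod_cone P Q)" for z z'
    using that P.test_add[OF l r] Q.test_add[OF m r] by (auto simp: prod_cone_simps)
  moreover have "?t (a \<odot>\<^bsub>prod_cone P Q\<^esub> z) = a * ?t z"
    if "0 \<le> a" "z \<in> carrier (prod_cone P Q)" for a z
    using that P.test_smult[OF l r] Q.test_smult[OF m r] P.smult_closed Q.smult_closed
    by (auto simp: prod_cone_simps distrib_left)
  ultimately show ?thesis unfolding cone_dual_def by blast
qed

lemma prod_cone_measurable: "measurable_cone (prod_cone P Q)"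
proof (intro measurable_cone.intro measurable_cone_axioms.intro)
  show "pcone (prod_cone P Q)" by (rule prod_cone_pcone[OF P.pcone_axioms Q.pcone_axioms])
  show "tests (prod_cone P Q) n \<subseteq> space (Rn n) \<rightarrow>\<^sub>E cone_dual (prod_cone P Q)" for n
    unfolding tests_prod_cone using prod_test_dual by fastforce
  have "(\<lambda>r\<in>space (Rn n). \<lambda>x\<in>carrier (prod_cone P Q). 0 :: real)
      = prod_test n (\<lambda>r\<in>space (Rn n). \<lambda>x\<in>carrier P. 0) (\<lambda>r\<in>space (Rn n). \<lambda>x\<in>carrier Q. 0)" for n
    by (auto simp: fun_eq_iff restrict_def carrier_prod_cone)
  then show "(\<lambda>r\<in>space (Rn n). \<lambda>x\<in>carrier (prod_cone P Q). 0) \<in> tests (prod_cone P Q) n" for n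
    unfolding tests_prod_cone using P.tests_zero Q.tests_zero by blast
next
  fix t n h p assume t: "t \<in> tests (prod_cone P Q) n" and h: "h \<in> Rn p \<rightarrow>\<^sub>M Rn n"
  then obtain l m where lm: "l \<in> tests P n" "m \<in> tests Q n" "t = prod_test n l m"
    by (auto simp: tests_prod_cone)
  have "compose (space (Rn p)) t h
      = prod_test p (compose (space (Rn p)) l h) (compose (space (Rn p)) m h)"
    using measurable_space[OF h] by (auto simp: lm(3) compose_def fun_eq_iff restrict_def)
  then show "compose (space (Rn p)) t h \<in> tests (prod_cone P Q) p"
    unfolding tests_prod_cone using P.tests_compose[OF lm(1) h] Q.tests_compose[OF lm(2) h] by blast
next
  fix t n z assume t: "t \<in> tests (prod_cone P Q) n" and z: "z \<in> carrier (prod_cone P Q)"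
  then obtain l m where lm: "l \<in> tests P n" "m \<in> tests Q n" "t = prod_test n l m"
    by (auto simp: tests_prod_cone)
  have "(\<lambda>r. l r (fst z) + m r (snd z)) \<in> borel_measurable (Rn n)"
    using z lm P.tests_measurable Q.tests_measurable by (intro borel_measurable_add) (auto simp: carrier_prod_cone)
  moreover have "t r z = l r (fst z) + m r (snd z)" if "r \<in> space (Rn n)" for r
    using z that by (auto simp: lm(3) carrier_prod_cone)
  ultimately show "(\<lambda>r. t r z) \<in> borel_measurable (Rn n)"
    by (subst measurable_cong) auto
qed

text \<open>A test on one factor becomes a test on the product by pairing it with the zero test of
  the other; conversely, product tests are sums of tests on the components.\<close>

lemma measurable_path_prod_cone:
  "measurable_path (prod_cone P Q) n \<gamma> \<longleftrightarrow>
    measurable_path P n (\<lambda>s. fst (\<gamma> s)) \<and> measurable_path Q n (\<lambda>s. snd (\<gamma> s))"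
proof (intro iffI conjI; (elim conjE)?)
  assume \<gamma>: "measurable_path (prod_cone P Q) n \<gamma>"
  have c: "fst (\<gamma> s) \<in> carrier P" "snd (\<gamma> s) \<in> carrier Q" if "s \<in> space (Rn n)" for s
    using path_funcset[OF \<gamma> that] by (auto simp: carrier_prod_cone)
  obtain \<alpha> where \<alpha>: "\<And>s. s \<in> space (Rn n) \<Longrightarrow> cnorm (prod_cone P Q) (\<gamma> s) \<le> \<alpha>"
    using path_bounded[OF \<gamma>] by metis
  have meas: "(\<lambda>w. t (first_coords k w) (\<gamma> (last_coords k n w))) \<in> borel_measurable (Rn (k + n))"
    if "t \<in> tests (prod_cone P Q) k" for t k
    by (rule path_measurable[OF \<gamma> that first_coords_measurable last_coords_measurable])
  show "measurable_path P n (\<lambda>s. fst (\<gamma> s))"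
  proof (rule measurable_pathI[where \<alpha> = \<alpha>])
    fix k l assume "l \<in> tests P k"
    then have "prod_test k l (\<lambda>r\<in>space (Rn k). \<lambda>x\<in>carrier Q. 0) \<in> tests (prod_cone P Q) k"
      unfolding tests_prod_cone using Q.tests_zero by blast
    from meas[OF this] show "(\<lambda>w. l (first_coords k w) (fst (\<gamma> (last_coords k n w)))) \<in> borel_measurable (Rn (k + n))"
      using c by (simp add: coords_space case_prod_beta mem_Times_iff)
  qed (use c \<alpha> in \<open>auto simp: cnorm_prod_cone\<close>)
  show "measurable_path Q n (\<lambda>s. snd (\<gamma> s))"
  proof (rule measurable_pathI[where \<alpha> = \<alpha>])
    fix k l assume "l \<in> tests Q k"
    then have "prod_test k (\<lambda>r\<in>space (Rn k). \<lambda>x\<in>carrier P. 0) l \<in> tests (prod_cone P Q) k"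
      unfolding tests_prod_cone using P.tests_zero by blast
    from meas[OF this] show "(\<lambda>w. l (first_coords k w) (snd (\<gamma> (last_coords k n w)))) \<in> borel_measurable (Rn (k + n))"
      using c by (simp add: coords_space case_prod_beta mem_Times_iff)
  qed (use c \<alpha> in \<open>auto simp: cnorm_prod_cone\<close>)
next
  assume \<gamma>: "measurable_path P n (\<lambda>s. fst (\<gamma> s))" "measurable_path Q n (\<lambda>s. snd (\<gamma> s))"
  have c: "\<gamma> s \<in> carrier P \<times> carrier Q" if "s \<in> space (Rn n)" for s
    using path_funcset[OF \<gamma>(1) that] path_funcset[OF \<gamma>(2) that] by (auto simp: mem_Times_iff)
  obtain \<alpha> \<beta> where b: "\<And>s. s \<in> space (Rn n) \<Longrightarrow> cnorm P (fst (\<gamma> s)) \<le> \<alpha>"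
      "\<And>s. s \<in> space (Rn n) \<Longrightarrow> cnorm Q (snd (\<gamma> s)) \<le> \<beta>"
    using path_bounded[OF \<gamma>(1)] path_bounded[OF \<gamma>(2)] by metis
  show "measurable_path (prod_cone P Q) n \<gamma>"
  proof (rule measurable_pathI[where \<alpha> = "max \<alpha> \<beta>"])
    show "\<gamma> s \<in> carrier (prod_cone P Q)" if "s \<in> space (Rn n)" for s
      using c[OF that] by (simp add: carrier_prod_cone)
    show "cnorm (prod_cone P Q) (\<gamma> s) \<le> max \<alpha> \<beta>" if "s \<in> space (Rn n)" for s
      using b[OF that] by (auto simp: cnorm_prod_cone intro: max.mono)
    fix k t assume "t \<in> tests (prod_cone P Q) k"
    then obtain l m where lm: "l \<in> tests P k" "m \<in> tests Q k" "t = prod_test k l m"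
      by (auto simp: tests_prod_cone)
    have "(\<lambda>w. l (first_coords k w) (fst (\<gamma> (last_coords k n w))) + m (first_coords k w) (snd (\<gamma> (last_coords k n w))))
        \<in> borel_measurable (Rn (k + n))"
      by (intro borel_measurable_add path_measurable[OF \<gamma>(1) lm(1)] path_measurable[OF \<gamma>(2) lm(2)]
          first_coords_measurable last_coords_measurable)
    then show "(\<lambda>w. t (first_coords k w) (\<gamma> (last_coords k n w))) \<in> borel_measurable (Rn (k + n))"
      using c by (simp add: lm(3) coords_space case_prod_beta)
  qed
qed

lemma uball_paths_prod_cone:
  "\<gamma> \<in> uball_paths (prod_cone P Q) n \<longleftrightarrow>
    (\<lambda>s. fst (\<gamma> s)) \<in> uball_paths P n \<and> (\<lambda>s. snd (\<gamma> s)) \<in> uball_paths Q n"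
  by (auto simp: uball_paths_def measurable_path_prod_cone uball_prod_cone Pi_iff mem_Times_iff)

lemma finsum_prod_cone:
  assumes "finite A" "u \<in> A \<rightarrow> carrier P \<times> carrier Q"
  shows "(\<Oplus>\<^bsub>prod_cone P Q\<^esub>i\<in>A. u i) = (\<Oplus>\<^bsub>P\<^esub>i\<in>A. fst (u i), \<Oplus>\<^bsub>Q\<^esub>i\<in>A. snd (u i))"
proof -
  interpret PQ: pcone "prod_cone P Q" by (rule prod_cone_pcone[OF P.pcone_axioms Q.pcone_axioms])
  have "fst (\<Oplus>\<^bsub>prod_cone P Q\<^esub>i\<in>A. u i) = (\<Oplus>\<^bsub>P\<^esub>i\<in>A. fst (u i))"
    by (rule finsum_additive[OF PQ.pcone_axioms P.pcone_axioms])
      (use assms in \<open>auto simp: prod_cone_simps\<close>)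
  moreover have "snd (\<Oplus>\<^bsub>prod_cone P Q\<^esub>i\<in>A. u i) = (\<Oplus>\<^bsub>Q\<^esub>i\<in>A. snd (u i))"
    by (rule finsum_additive[OF PQ.pcone_axioms Q.pcone_axioms])
      (use assms in \<open>auto simp: prod_cone_simps\<close>)
  ultimately show ?thesis by (simp add: prod_eq_iff)
qed

lemma increments_prod_cone:
  "increments (prod_cone P Q) A z u \<longleftrightarrow>
    increments P A (fst z) (\<lambda>i. fst (u i)) \<and> increments Q A (snd z) (\<lambda>i. snd (u i))"
proof (cases "finite A \<and> u \<in> A \<rightarrow> carrier P \<times> carrier Q")
  case True
  then show ?thesis
    by (auto simp: increments_def prod_cone_simps uball_prod_cone finsum_prod_cone mem_Times_iff Pi_iff)
next
  case False
  then show ?thesis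
    by (auto simp: increments_def carrier_prod_cone mem_Times_iff Pi_iff)
qed

lemma Cstab_fst: "cone_fst P Q \<in> Cstab (prod_cone P Q) P"
proof -
  interpret PQ: measurable_cone "prod_cone P Q" by (rule prod_cone_measurable)
  interpret F: two_mcones "prod_cone P Q" P by unfold_locales
  have "pre_stable (prod_cone P Q) P fst"
    by (rule F.pre_stable_additive) (auto simp: prod_cone_simps)
  then have "stable (prod_cone P Q) P fst"
    by (rule F.stableI[where \<alpha> = 1]) (auto simp: lub_prod_cone uball_def prod_cone_simps)
  then have "measurable_stable (prod_cone P Q) P fst"
    by (simp add: measurable_stable_def uball_paths_prod_cone uball_paths_path)
  then show ?thesis
    unfolding cone_fst_def
    by (rule Cstab_restrict[OF PQ.measurable_cone_axioms P.measurable_cone_axioms]) (auto simp: uball_prod_cone)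
qed

lemma Cstab_snd: "cone_snd P Q \<in> Cstab (prod_cone P Q) Q"
proof -
  interpret PQ: measurable_cone "prod_cone P Q" by (rule prod_cone_measurable)
  interpret F: two_mcones "prod_cone P Q" Q by unfold_locales
  have "pre_stable (prod_cone P Q) Q snd"
    by (rule F.pre_stable_additive) (auto simp: prod_cone_simps)
  then have "stable (prod_cone P Q) Q snd"
    by (rule F.stableI[where \<alpha> = 1]) (auto simp: lub_prod_cone uball_def prod_cone_simps)
  then have "measurable_stable (prod_cone P Q) Q snd"
    by (simp add: measurable_stable_def uball_paths_prod_cone uball_paths_path)
  then show ?thesis
    unfolding cone_snd_def
    by (rule Cstab_restrict[OF PQ.measurable_cone_axioms Q.measurable_cone_axioms]) (auto simp: uball_prod_cone)
qed

lemma moebius_Pair: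
  assumes "finite A" "moebius P A F b" "moebius Q A G c"
  shows "moebius (prod_cone P Q) A (\<lambda>I. (F I, G I)) (\<lambda>J. (b J, c J))"
  unfolding moebius_def
proof (intro conjI ballI)
  show "(\<lambda>J. (b J, c J)) \<in> Pow A \<rightarrow> carrier (prod_cone P Q)"
    using assms by (auto simp: moebius_def carrier_prod_cone)
  fix I assume "I \<in> Pow A"
  then have I: "I \<subseteq> A" "finite (Pow I)" using assms(1) finite_subset by auto
  have "(\<lambda>J. (b J, c J)) \<in> Pow I \<rightarrow> carrier P \<times> carrier Q"
    using P.moebius_Pi[OF assms(2) I(1)] Q.moebius_Pi[OF assms(3) I(1)] by auto
  then show "(F I, G I) = (\<Oplus>\<^bsub>prod_cone P Q\<^esub>J\<in>Pow I. (b J, c J))"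
    using finsum_prod_cone[OF I(2)] P.moebius_sum[OF assms(2) I(1)] Q.moebius_sum[OF assms(3) I(1)]
    by simp
qed

lemma measurable_stable_Pair:
  assumes "measurable_cone R" and f: "measurable_stable R P f" and g: "measurable_stable R Q g"
  shows "measurable_stable R (prod_cone P Q) (\<lambda>z. (f z, g z))"
proof -
  interpret R: measurable_cone R by fact
  interpret PQ: measurable_cone "prod_cone P Q" by (rule prod_cone_measurable)
  interpret F: two_mcones R P by unfold_locales
  interpret G: two_mcones R Q by unfold_locales
  interpret H: two_mcones R "prod_cone P Q" by unfold_locales
  note sf = F.measurable_stable_stable[OF f] and sg = G.measurable_stable_stable[OF g]
  have "pre_stable R (prod_cone P Q) (\<lambda>z. (f z, g z))"
  proof (rule H.pre_stableI)
    show "(f x, g x) \<in> carrier (prod_cone P Q)" if "x \<in> uball R" for x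
      using F.stable_funcset[OF sf that] G.stable_funcset[OF sg that] by (simp add: carrier_prod_cone)
    show "\<exists>b. expansion R (prod_cone P Q) (\<lambda>z. (f z, g z)) A x u b" if "increments R A x u"
      for A :: "nat set" and x u
      using F.pre_stable_expansion[OF F.stable_pre_stable[OF sf] that]
        G.pre_stable_expansion[OF G.stable_pre_stable[OF sg] that]
        moebius_Pair[OF R.increments_finite[OF that]]
      unfolding expansion_def by blast
  qed
  moreover obtain \<alpha> \<beta> where "\<And>x. x \<in> uball R \<Longrightarrow> cnorm P (f x) \<le> \<alpha>" "\<And>x. x \<in> uball R \<Longrightarrow> cnorm Q (g x) \<le> \<beta>"
    using F.stable_bounded[OF sf] G.stable_bounded[OF sg] by metis
  ultimately have "stable R (prod_cone P Q) (\<lambda>z. (f z, g z))"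
    by (intro H.stableI[where \<alpha> = "max \<alpha> \<beta>"])
      (auto simp: lub_prod_cone cnorm_prod_cone F.stable_lub[OF sf] G.stable_lub[OF sg]
        max.coboundedI1 max.coboundedI2)
  then show ?thesis
    using F.measurable_stable_path[OF f] G.measurable_stable_path[OF g]
    by (simp add: measurable_stable_def measurable_path_prod_cone)
qed

lemma product_universal:
  assumes "measurable_cone R" and f: "f \<in> Cstab R P" and g: "g \<in> Cstab R Q"
  shows "\<exists>!h. h \<in> Cstab R (prod_cone P Q) \<and>
    cone_comp R (cone_fst P Q) h = f \<and> cone_comp R (cone_snd P Q) h = g"
proof (rule ex1I[of _ "\<lambda>z\<in>uball R. (f z, g z)"])
  have "(\<lambda>z\<in>uball R. (f z, g z)) \<in> Cstab R (prod_cone P Q)"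
    by (rule Cstab_restrict[OF assms(1) prod_cone_measurable measurable_stable_Pair[OF assms(1)]])
      (use f Cstab_apply[OF f] Cstab_apply[OF g] g in \<open>auto simp: Cstab_measurable_stable uball_prod_cone\<close>)
  moreover have "cone_comp R (cone_fst P Q) (\<lambda>z\<in>uball R. (f z, g z)) = f"
    by (rule extensionalityI[OF _ Cstab_extensional[OF f]])
      (use Cstab_apply[OF f] Cstab_apply[OF g] in
        \<open>auto simp: cone_comp_def compose_def cone_fst_def uball_prod_cone\<close>)
  moreover have "cone_comp R (cone_snd P Q) (\<lambda>z\<in>uball R. (f z, g z)) = g"
    by (rule extensionalityI[OF _ Cstab_extensional[OF g]])
      (use Cstab_apply[OF f] Cstab_apply[OF g] in
        \<open>auto simp: cone_comp_def compose_def cone_snd_def uball_prod_cone\<close>)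
  ultimately show "(\<lambda>z\<in>uball R. (f z, g z)) \<in> Cstab R (prod_cone P Q) \<and>
      cone_comp R (cone_fst P Q) (\<lambda>z\<in>uball R. (f z, g z)) = f \<and>
      cone_comp R (cone_snd P Q) (\<lambda>z\<in>uball R. (f z, g z)) = g"
    by blast
next
  fix h assume h: "h \<in> Cstab R (prod_cone P Q) \<and>
    cone_comp R (cone_fst P Q) h = f \<and> cone_comp R (cone_snd P Q) h = g"
  then have h1: "h \<in> Cstab R (prod_cone P Q)" by blast
  show "h = (\<lambda>z\<in>uball R. (f z, g z))"
  proof (rule extensionalityI[OF Cstab_extensional[OF h1]])
    fix z assume z: "z \<in> uball R"
    have "f z = fst (h z)" "g z = snd (h z)"
      using h z Cstab_apply[OF h1 z] by (auto simp: cone_comp_def compose_def cone_fst_def cone_snd_def)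
    then show "h z = (\<lambda>z\<in>uball R. (f z, g z)) z" using z by simp
  qed simp
qed

end


section \<open>The cone of measurable stable functions\<close>

text \<open>
  By \<open>fun_cone_le_iff\<close> below this is the cone order of the function space, which is in general finer
  than the pointwise order.
\<close>

definition coeff_le ::
  "('a, 'm) pcone_scheme \<Rightarrow> ('b, 'k) pcone_scheme \<Rightarrow> ('a \<Rightarrow> 'b) \<Rightarrow> ('a \<Rightarrow> 'b) \<Rightarrow> bool" where
  "coeff_le P Q f g \<longleftrightarrow> (\<forall>(A :: nat set) x u b c. increments P A x u \<longrightarrow>
     expansion P Q f A x u b \<longrightarrow> expansion P Q g A x u c \<longrightarrow> (\<forall>J\<subseteq>A. b J \<preceq>\<^bsub>Q\<^esub> c J))"

context two_cones
begin

lemma coeff_leD: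
  fixes A :: "nat set"
  shows "coeff_le P Q f g \<Longrightarrow> increments P A x u \<Longrightarrow> expansion P Q f A x u b \<Longrightarrow>
    expansion P Q g A x u c \<Longrightarrow> J \<subseteq> A \<Longrightarrow> b J \<preceq>\<^bsub>Q\<^esub> c J"
  unfolding coeff_le_def by blast

lemma increments_empty: "x \<in> uball P \<Longrightarrow> increments P {} x u"
  by (simp add: increments_def P.uball_carrier)

text \<open>With no increments at all, the only coefficient is the value at the base point.\<close>

lemma coeff_le_pointwise:
  assumes "coeff_le P Q f g" "pre_stable P Q f" "pre_stable P Q g" "x \<in> uball P"
  shows "f x \<preceq>\<^bsub>Q\<^esub> g x"
proof -
  have inc: "increments P ({} :: nat set) x (\<lambda>_. \<zero>\<^bsub>P\<^esub>)"
    using assms(4) by (rule increments_empty)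
  obtain b c where b: "expansion P Q f ({} :: nat set) x (\<lambda>_. \<zero>\<^bsub>P\<^esub>) b"
    and c: "expansion P Q g ({} :: nat set) x (\<lambda>_. \<zero>\<^bsub>P\<^esub>) c"
    using pre_stable_expansion[OF assms(2) inc] pre_stable_expansion[OF assms(3) inc] by blast
  have "b {} \<preceq>\<^bsub>Q\<^esub> c {}" by (rule coeff_leD[OF assms(1) inc b c subset_refl])
  moreover have "f x = b {}"
    using Q.moebius_sum[OF b[unfolded expansion_def] subset_refl] Q.moebius_coeff[OF b[unfolded expansion_def] subset_refl]
      P.uball_carrier[OF assms(4)] by simp
  moreover have "g x = c {}"
    using Q.moebius_sum[OF c[unfolded expansion_def] subset_refl] Q.moebius_coeff[OF c[unfolded expansion_def] subset_refl]
      P.uball_carrier[OF assms(4)] by simp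
  ultimately show ?thesis by simp
qed

text \<open>By uniqueness, the coefficients of \<open>g\<close> are the sums of those of
  \<open>f\<close> and of \<open>h\<close>.\<close>

lemma coeff_le_add:
  assumes f: "pre_stable P Q f" and h: "pre_stable P Q h"
    and eq: "\<And>x. x \<in> uball P \<Longrightarrow> g x = f x \<oplus>\<^bsub>Q\<^esub> h x"
  shows "coeff_le P Q f g"
  unfolding coeff_le_def
proof (intro allI impI)
  fix A :: "nat set" and x u b c J
  assume inc: "increments P A x u" and b: "expansion P Q f A x u b" and c: "expansion P Q g A x u c"
    and J: "J \<subseteq> A"
  obtain d where d: "expansion P Q h A x u d"
    using pre_stable_expansion[OF h inc] by blast
  have "expansion P Q (\<lambda>x. f x \<oplus>\<^bsub>Q\<^esub> h x) A x u (\<lambda>J. b J \<oplus>\<^bsub>Q\<^esub> d J)"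
    using Q.moebius_add b d unfolding expansion_def by blast
  from expansion_cong[OF inc this, of g] have "expansion P Q g A x u (\<lambda>J. b J \<oplus>\<^bsub>Q\<^esub> d J)"
    using eq by simp
  then have "c J = b J \<oplus>\<^bsub>Q\<^esub> d J"
    using expansion_unique[OF inc c _ J] by blast
  then show "b J \<preceq>\<^bsub>Q\<^esub> c J"
    using Q.le_add Q.moebius_coeff[OF b[unfolded expansion_def] J] Q.moebius_coeff[OF d[unfolded expansion_def] J]
    by simp
qed

text \<open>Comparability of all coefficients is what \<open>moebius_diff\<close> needs;
  comparability of the values alone would give the function \<open>h\<close> but no expansion of
  it.\<close>

lemma pre_stable_diff:
  assumes f: "pre_stable P Q f" and g: "pre_stable P Q g" and le: "coeff_le P Q f g"
    and h: "\<And>x. x \<in> uball P \<Longrightarrow> h x \<in> carrier Q"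
    and eq: "\<And>x. x \<in> uball P \<Longrightarrow> g x = f x \<oplus>\<^bsub>Q\<^esub> h x"
  shows "pre_stable P Q h"
proof (rule pre_stableI[OF h])
  fix A :: "nat set" and x u assume inc: "increments P A x u"
  obtain b c where b: "expansion P Q f A x u b" and c: "expansion P Q g A x u c"
    using pre_stable_expansion[OF f inc] pre_stable_expansion[OF g inc] by blast
  have "\<exists>d. moebius Q A (\<lambda>I. h (x \<oplus>\<^bsub>P\<^esub> (\<Oplus>\<^bsub>P\<^esub>i\<in>I. u i))) d \<and> (\<forall>J\<subseteq>A. c J = b J \<oplus>\<^bsub>Q\<^esub> d J)"
    by (rule Q.moebius_diff[OF P.increments_finite[OF inc] b[unfolded expansion_def] c[unfolded expansion_def]])
      (use coeff_leD[OF le inc b c] h eq P.increments_uball[OF inc] in auto)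
  then show "\<exists>b. expansion P Q h A x u b" unfolding expansion_def by blast
qed

end

section \<open>Algebra, norm and order of the function space\<close>

context mcone_pair
begin

lemma carrier_fun_cone: "carrier (fun_cone P Q) = fun_cone_carrier P Q"
  and zero_fun_cone: "\<zero>\<^bsub>fun_cone P Q\<^esub> = (\<lambda>x\<in>uball P. \<zero>\<^bsub>Q\<^esub>)"
  and add_fun_cone: "f \<oplus>\<^bsub>fun_cone P Q\<^esub> g = (\<lambda>x\<in>uball P. f x \<oplus>\<^bsub>Q\<^esub> g x)"
  and smult_fun_cone: "a \<odot>\<^bsub>fun_cone P Q\<^esub> f = (\<lambda>x\<in>uball P. a \<odot>\<^bsub>Q\<^esub> f x)"
  and cnorm_fun_cone: "cnorm (fun_cone P Q) f = (SUP x\<in>uball P. cnorm Q (f x))"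
  and tests_fun_cone: "tests (fun_cone P Q) n =
    {path_test P Q n \<gamma> m | \<gamma> m. \<gamma> \<in> uball_paths P n \<and> m \<in> tests Q n}"
  by (simp_all add: fun_cone_def)

text \<open>A stable function is bounded, hence some positive multiple maps into the unit ball;
  conversely the factor \<open>\<epsilon>\<close> is undone by its inverse. This replaces the
  scaling in the definition of the carrier by plain measurable stability.\<close>

lemma fun_carrier_iff:
  "f \<in> carrier (fun_cone P Q) \<longleftrightarrow> f \<in> extensional (uball P) \<and> measurable_stable P Q f"
proof
  assume "f \<in> carrier (fun_cone P Q)"
  then obtain \<epsilon> where f: "f \<in> uball P \<rightarrow>\<^sub>E carrier Q"
    and \<epsilon>: "\<epsilon> > 0" "(\<lambda>x\<in>uball P. \<epsilon> \<odot>\<^bsub>Q\<^esub> f x) \<in> Cstab P Q"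
    by (auto simp: carrier_fun_cone fun_cone_carrier_def)
  have "measurable_stable P Q (\<lambda>x. inverse \<epsilon> \<odot>\<^bsub>Q\<^esub> (\<lambda>x\<in>uball P. \<epsilon> \<odot>\<^bsub>Q\<^esub> f x) x)"
    using measurable_stable_smult[OF _ Cstab_measurable_stable[OF \<epsilon>(2)]] \<epsilon>(1) by simp
  then have "measurable_stable P Q f"
    by (rule measurable_stable_cong) (use f \<epsilon> Q.smult_inverse in auto)
  then show "f \<in> extensional (uball P) \<and> measurable_stable P Q f"
    using f by (auto simp: PiE_iff)
next
  assume f: "f \<in> extensional (uball P) \<and> measurable_stable P Q f"
  then have st: "stable P Q f" by (simp add: measurable_stable_stable)
  obtain \<alpha> where \<alpha>: "0 \<le> \<alpha>" "\<And>x. x \<in> uball P \<Longrightarrow> cnorm Q (f x) \<le> \<alpha>"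
    using stable_bounded[OF st] by metis
  \<comment> \<open>The added 1 keeps the scaling factor positive when the bound
    \<open>\<alpha>\<close> is 0.\<close>
  let ?e = "inverse (\<alpha> + 1)"
  have "?e > 0" using \<alpha>(1) by simp
  moreover have "(\<lambda>x\<in>uball P. ?e \<odot>\<^bsub>Q\<^esub> f x) \<in> Cstab P Q"
  proof (rule Cstab_restrict[OF P.measurable_cone_axioms Q.measurable_cone_axioms])
    show "measurable_stable P Q (\<lambda>x. ?e \<odot>\<^bsub>Q\<^esub> f x)"
      using f \<open>?e > 0\<close> by (intro measurable_stable_smult) auto
    fix x assume x: "x \<in> uball P"
    have "?e * cnorm Q (f x) \<le> ?e * (\<alpha> + 1)"
      using \<alpha>(1) \<alpha>(2)[OF x] by (intro mult_left_mono) auto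
    then show "?e \<odot>\<^bsub>Q\<^esub> f x \<in> uball Q"
      using \<alpha>(1) stable_funcset[OF st x] by (simp add: uball_def Q.smult_closed Q.cnorm_smult)
  qed
  moreover have "f \<in> uball P \<rightarrow>\<^sub>E carrier Q"
    using f stable_funcset[OF st] by (simp add: PiE_iff)
  ultimately show "f \<in> carrier (fun_cone P Q)"
    unfolding carrier_fun_cone fun_cone_carrier_def by blast
qed

lemma fun_carrier_stable: "f \<in> carrier (fun_cone P Q) \<Longrightarrow> stable P Q f"
  by (simp add: fun_carrier_iff measurable_stable_stable)

lemma fun_carrier_pre_stable: "f \<in> carrier (fun_cone P Q) \<Longrightarrow> pre_stable P Q f"
  by (simp add: fun_carrier_stable stable_pre_stable)

lemma fun_carrier_apply: "f \<in> carrier (fun_cone P Q) \<Longrightarrow> x \<in> uball P \<Longrightarrow> f x \<in> carrier Q"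
  by (simp add: fun_carrier_stable stable_funcset)

lemma fun_carrier_restrict: "measurable_stable P Q f \<Longrightarrow> (\<lambda>x\<in>uball P. f x) \<in> carrier (fun_cone P Q)"
  using measurable_stable_cong[of f "\<lambda>x\<in>uball P. f x"] by (simp add: fun_carrier_iff)

lemma fun_ext:
  "f \<in> carrier (fun_cone P Q) \<Longrightarrow> g \<in> carrier (fun_cone P Q) \<Longrightarrow> (\<And>x. x \<in> uball P \<Longrightarrow> f x = g x) \<Longrightarrow> f = g"
  by (auto simp: fun_carrier_iff intro: extensionalityI)

lemma fun_norm_le_iff:
  assumes "f \<in> carrier (fun_cone P Q)"
  shows "cnorm (fun_cone P Q) f \<le> c \<longleftrightarrow> (\<forall>x\<in>uball P. cnorm Q (f x) \<le> c)"
proof -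
  obtain \<alpha> where "\<And>x. x \<in> uball P \<Longrightarrow> cnorm Q (f x) \<le> \<alpha>"
    using stable_bounded[OF fun_carrier_stable[OF assms]] by metis
  then have "bdd_above ((\<lambda>x. cnorm Q (f x)) ` uball P)" by (rule bdd_aboveI2)
  then show ?thesis
    unfolding cnorm_fun_cone using P.zero_uball by (intro cSUP_le_iff) auto
qed

lemma fun_norm_upper:
  "f \<in> carrier (fun_cone P Q) \<Longrightarrow> x \<in> uball P \<Longrightarrow> cnorm Q (f x) \<le> cnorm (fun_cone P Q) f"
  using fun_norm_le_iff[of f "cnorm (fun_cone P Q) f"] by simp

lemma uball_fun_cone: "uball (fun_cone P Q) = Cstab P Q"
proof (intro equalityI subsetI)
  fix f assume "f \<in> uball (fun_cone P Q)"
  then have f: "f \<in> carrier (fun_cone P Q)" and "cnorm (fun_cone P Q) f \<le> 1"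
    by (simp_all add: uball_def)
  then have "f x \<in> uball Q" if "x \<in> uball P" for x
    using that fun_norm_le_iff[OF f] fun_carrier_apply[OF f that] by (simp add: uball_def)
  then show "f \<in> Cstab P Q"
    using f by (simp add: Cstab_iff fun_carrier_iff PiE_iff)
next
  fix f assume f: "f \<in> Cstab P Q"
  then have "f \<in> carrier (fun_cone P Q)"
    by (simp add: Cstab_iff fun_carrier_iff PiE_iff)
  then show "f \<in> uball (fun_cone P Q)"
    using Cstab_apply[OF f] by (simp add: uball_def fun_norm_le_iff)
qed

lemma fun_cone_pcone: "pcone (fun_cone P Q)"
proof -
  have add: "f \<oplus>\<^bsub>fun_cone P Q\<^esub> g \<in> carrier (fun_cone P Q)"
    if "f \<in> carrier (fun_cone P Q)" "g \<in> carrier (fun_cone P Q)" for f g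
    unfolding add_fun_cone using that
    by (intro fun_carrier_restrict measurable_stable_add) (auto simp: fun_carrier_iff)
  have smult: "a \<odot>\<^bsub>fun_cone P Q\<^esub> f \<in> carrier (fun_cone P Q)"
    if "0 \<le> a" "f \<in> carrier (fun_cone P Q)" for a f
    unfolding smult_fun_cone using that
    by (intro fun_carrier_restrict measurable_stable_smult) (auto simp: fun_carrier_iff)
  have zero: "\<zero>\<^bsub>fun_cone P Q\<^esub> \<in> carrier (fun_cone P Q)"
    unfolding zero_fun_cone by (intro fun_carrier_restrict measurable_stable_const) simp
  note c = add smult zero fun_carrier_apply
  note ops = add_fun_cone smult_fun_cone zero_fun_cone
  \<comment> \<open>One inequality suffices for homogeneity: for \<open>a > 0\<close> the reverse
    one follows by applying it to \<open>inverse a\<close>, and for \<open>a = 0\<close> by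
    non-negativity of the norm.\<close>
  have smult_le: "cnorm (fun_cone P Q) (a \<odot>\<^bsub>fun_cone P Q\<^esub> f) \<le> a * cnorm (fun_cone P Q) f"
    if "0 \<le> a" "f \<in> carrier (fun_cone P Q)" for a f
    unfolding fun_norm_le_iff[OF smult[OF that]]
    using that fun_norm_upper[OF that(2)] by (auto simp: ops Q.cnorm_smult fun_carrier_apply mult_left_mono)
  have norm_nonneg: "0 \<le> cnorm (fun_cone P Q) f" if f: "f \<in> carrier (fun_cone P Q)" for f
    using fun_norm_upper[OF f P.zero_uball] Q.cnorm_nonneg[OF fun_carrier_apply[OF f P.zero_uball]] by linarith
  show ?thesis
  proof (intro pcone.intro abelian_monoidI pcone_axioms.intro)
    fix f g h assume fg: "f \<in> carrier (fun_cone P Q)" "g \<in> carrier (fun_cone P Q)" "h \<in> carrier (fun_cone P Q)"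
      "f \<oplus>\<^bsub>fun_cone P Q\<^esub> g = f \<oplus>\<^bsub>fun_cone P Q\<^esub> h"
    show "g = h"
    proof (rule fun_ext[OF fg(2,3)])
      fix x assume x: "x \<in> uball P"
      then have "f x \<oplus>\<^bsub>Q\<^esub> g x = f x \<oplus>\<^bsub>Q\<^esub> h x"
        using fun_cong[OF fg(4), of x] by (simp add: ops)
      then show "g x = h x"
        using Q.add_cancel[of "f x" "g x" "h x"] fg(1-3) x by (simp add: fun_carrier_apply)
    qed
  next
    fix f assume f: "f \<in> carrier (fun_cone P Q)" "cnorm (fun_cone P Q) f = 0"
    show "f = \<zero>\<^bsub>fun_cone P Q\<^esub>"
    proof (rule fun_ext[OF f(1) zero])
      fix x assume x: "x \<in> uball P"
      have "cnorm Q (f x) = 0"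
        using fun_norm_upper[OF f(1) x] f(2) Q.cnorm_nonneg[OF fun_carrier_apply[OF f(1) x]] by linarith
      then show "f x = \<zero>\<^bsub>fun_cone P Q\<^esub> x"
        using x f(1) by (simp add: ops Q.cnorm_zero fun_carrier_apply)
    qed
  next
    fix f g assume fg: "f \<in> carrier (fun_cone P Q)" "g \<in> carrier (fun_cone P Q)"
    show "cnorm (fun_cone P Q) (f \<oplus>\<^bsub>fun_cone P Q\<^esub> g) \<le> cnorm (fun_cone P Q) f + cnorm (fun_cone P Q) g"
      unfolding fun_norm_le_iff[OF add[OF fg]]
    proof
      fix x assume x: "x \<in> uball P"
      show "cnorm Q ((f \<oplus>\<^bsub>fun_cone P Q\<^esub> g) x) \<le> cnorm (fun_cone P Q) f + cnorm (fun_cone P Q) g"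
        using Q.cnorm_triangle[OF fun_carrier_apply[OF fg(1) x] fun_carrier_apply[OF fg(2) x]]
          fun_norm_upper[OF fg(1) x] fun_norm_upper[OF fg(2) x] x by (simp add: ops)
    qed
    show "cnorm (fun_cone P Q) f \<le> cnorm (fun_cone P Q) (f \<oplus>\<^bsub>fun_cone P Q\<^esub> g)"
      unfolding fun_norm_le_iff[OF fg(1)]
    proof
      fix x assume x: "x \<in> uball P"
      show "cnorm Q (f x) \<le> cnorm (fun_cone P Q) (f \<oplus>\<^bsub>fun_cone P Q\<^esub> g)"
        using Q.cnorm_mono[OF fun_carrier_apply[OF fg(1) x] fun_carrier_apply[OF fg(2) x]]
          fun_norm_upper[OF add[OF fg] x] x by (simp add: ops)
    qed
  next
    fix a :: real and f assume a: "0 \<le> a" and f: "f \<in> carrier (fun_cone P Q)"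
    show "cnorm (fun_cone P Q) (a \<odot>\<^bsub>fun_cone P Q\<^esub> f) = a * cnorm (fun_cone P Q) f"
    proof (cases "a = 0")
      case True
      then show ?thesis
        using smult_le[OF a f] norm_nonneg[OF smult[OF a f]] by simp
    next
      case False
      then have "inverse a \<odot>\<^bsub>fun_cone P Q\<^esub> (a \<odot>\<^bsub>fun_cone P Q\<^esub> f) = f"
        using a f by (intro fun_ext smult) (auto simp: ops Q.smult_inverse c)
      then have "cnorm (fun_cone P Q) f \<le> inverse a * cnorm (fun_cone P Q) (a \<odot>\<^bsub>fun_cone P Q\<^esub> f)"
        using smult_le[of "inverse a", OF _ smult[OF a f]] a by simp
      then have "a * cnorm (fun_cone P Q) f \<le> cnorm (fun_cone P Q) (a \<odot>\<^bsub>fun_cone P Q\<^esub> f)"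
        using a False by (simp add: field_simps)
      then show ?thesis using smult_le[OF a f] by simp
    qed
  qed ((rule norm_nonneg, assumption) | (intro fun_ext add smult zero;
      simp add: ops fun_carrier_apply Q.a_ac Q.smult_r_distr Q.smult_l_distr
        Q.smult_assoc Q.smult_one Q.smult_zero_scalar Q.smult_zero Q.smult_closed))+
qed

lemma finsum_fun_cone:
  assumes "finite A" "h \<in> A \<rightarrow> carrier (fun_cone P Q)" "x \<in> uball P"
  shows "(\<Oplus>\<^bsub>fun_cone P Q\<^esub>i\<in>A. h i) x = (\<Oplus>\<^bsub>Q\<^esub>i\<in>A. h i x)"
  by (rule finsum_additive[OF fun_cone_pcone Q.pcone_axioms assms(1,2), where \<phi> = "\<lambda>f. f x"])
    (use assms(3) in \<open>auto simp: fun_carrier_apply zero_fun_cone add_fun_cone\<close>)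

text \<open>From right to left, differences are chosen point by point. Comparing coefficients makes
  the resulting function pre-stable, and \<open>measurable_stable_diff\<close> then adds continuity
  and measurability, so it lies in the function space.\<close>

lemma fun_cone_le_iff:
  assumes f: "f \<in> carrier (fun_cone P Q)" and g: "g \<in> carrier (fun_cone P Q)"
  shows "f \<preceq>\<^bsub>fun_cone P Q\<^esub> g \<longleftrightarrow> coeff_le P Q f g"
proof
  assume "f \<preceq>\<^bsub>fun_cone P Q\<^esub> g"
  then obtain h where h: "h \<in> carrier (fun_cone P Q)" "g = f \<oplus>\<^bsub>fun_cone P Q\<^esub> h"
    by (auto simp: cone_le_def)
  then show "coeff_le P Q f g"
    by (intro coeff_le_add[OF fun_carrier_pre_stable[OF f] fun_carrier_pre_stable[OF h(1)]])
      (simp add: add_fun_cone)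
next
  assume le: "coeff_le P Q f g"
  note pf = fun_carrier_pre_stable[OF f] and pg = fun_carrier_pre_stable[OF g]
  have "\<forall>x\<in>uball P. \<exists>y. y \<in> carrier Q \<and> g x = f x \<oplus>\<^bsub>Q\<^esub> y"
    using coeff_le_pointwise[OF le pf pg] by (auto simp: cone_le_def)
  from bchoice[OF this] obtain h where
    h: "\<And>x. x \<in> uball P \<Longrightarrow> h x \<in> carrier Q" "\<And>x. x \<in> uball P \<Longrightarrow> g x = f x \<oplus>\<^bsub>Q\<^esub> h x"
    by blast
  have "pre_stable P Q h"
    using pre_stable_diff[OF pf pg le h] by simp
  then have "measurable_stable P Q h"
    using f g by (intro measurable_stable_diff[OF _ _ _ h(2)]) (auto simp: fun_carrier_iff)
  then have hr: "(\<lambda>x\<in>uball P. h x) \<in> carrier (fun_cone P Q)" by (rule fun_carrier_restrict)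
  have "g = f \<oplus>\<^bsub>fun_cone P Q\<^esub> (\<lambda>x\<in>uball P. h x)"
    using g h(2) by (intro extensionalityI[of g "uball P"]) (auto simp: fun_carrier_iff add_fun_cone)
  then show "f \<preceq>\<^bsub>fun_cone P Q\<^esub> g"
    using f hr by (auto simp: cone_le_def)
qed

lemma fun_cone_le_pointwise:
  assumes "f \<preceq>\<^bsub>fun_cone P Q\<^esub> g" "x \<in> uball P"
  shows "f x \<preceq>\<^bsub>Q\<^esub> g x"
proof -
  obtain h where "f \<in> carrier (fun_cone P Q)" "h \<in> carrier (fun_cone P Q)" "g = f \<oplus>\<^bsub>fun_cone P Q\<^esub> h"
    using assms(1) by (auto simp: cone_le_def)
  then show ?thesis using assms(2) by (simp add: add_fun_cone fun_carrier_apply Q.le_add)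
qed

lemma fun_cone_chain_pointwise:
  assumes "uball_chain (fun_cone P Q) f" "x \<in> uball P"
  shows "uball_chain Q (\<lambda>n. f n x)"
  using assms(1) fun_cone_le_pointwise[OF _ assms(2)] Cstab_apply[of _ P Q, OF _ assms(2)]
  by (simp add: uball_chain_def uball_fun_cone)

end

section \<open>Least upper bounds in the function space\<close>

locale complete_mcone_pair = mcone_pair P Q + Q: complete_pcone Q for P :: "'a mcone" and Q :: "'b mcone"
begin

context
  fixes f :: "nat \<Rightarrow> 'a \<Rightarrow> 'b" and g :: "'a \<Rightarrow> 'b"
  assumes chain: "uball_chain (fun_cone P Q) f"
    and ptw: "\<And>x. x \<in> uball P \<Longrightarrow> is_lub_seq Q (\<lambda>n. f n x) (g x)"
begin

lemma chain_Cstab: "f n \<in> Cstab P Q"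
  using chain by (simp add: uball_chain_def uball_fun_cone)

lemma chain_carrier: "f n \<in> carrier (fun_cone P Q)"
  using chain by (simp add: uball_chain_def uball_def)

lemma chain_le: "f n \<preceq>\<^bsub>fun_cone P Q\<^esub> f (Suc n)"
  using chain by (simp add: uball_chain_def)

lemma chain_lub_uball: "x \<in> uball P \<Longrightarrow> g x \<in> uball Q"
  using Q.complete[OF fun_cone_chain_pointwise[OF chain]] Q.lub_unique[OF ptw] by blast

text \<open>The order of the function space makes the coefficients at each \<open>J\<close> a chain
  in the complete cone \<open>Q\<close>. Least upper bounds commute with finite sums, so their
  limits are coefficients of the pointwise limit \<open>g\<close>.\<close>

lemma chain_lub_expansion:
  fixes A :: "nat set"
  assumes inc: "increments P A x u" and b: "\<And>n. expansion P Q (f n) A x u (b n)"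
  shows "\<exists>c. expansion P Q g A x u c \<and> (\<forall>J\<subseteq>A. is_lub_seq Q (\<lambda>n. b n J) (c J))"
proof -
  note bm = b[unfolded expansion_def]
  have fin: "finite (Pow A)" using P.increments_finite[OF inc] by simp
  have up: "b n J \<preceq>\<^bsub>Q\<^esub> b (Suc n) J" if "J \<subseteq> A" for n J
    using coeff_leD[OF _ inc b b that] fun_cone_le_iff[OF chain_carrier chain_carrier] chain_le by blast
  \<comment> \<open>A coefficient is a single summand of a value of \<open>f n\<close> and therefore
    lies below a point of the unit ball.\<close>
  have bu: "b n J \<in> uball Q" if J: "J \<subseteq> A" for n J
  proof (rule Q.uball_le)
    have "finite (Pow J)" using J fin by (meson Pow_mono finite_subset)
    then have "(\<Oplus>\<^bsub>Q\<^esub>K\<in>{J}. b n K) \<preceq>\<^bsub>Q\<^esub> (\<Oplus>\<^bsub>Q\<^esub>K\<in>Pow J. b n K)"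
      using Q.moebius_Pi[OF bm J] by (intro Q.finsum_le_subset) auto
    then show "b n J \<preceq>\<^bsub>Q\<^esub> f n (x \<oplus>\<^bsub>P\<^esub> (\<Oplus>\<^bsub>P\<^esub>i\<in>J. u i))"
      using Q.moebius_sum[OF bm J] Q.moebius_coeff[OF bm J] by simp
    show "f n (x \<oplus>\<^bsub>P\<^esub> (\<Oplus>\<^bsub>P\<^esub>i\<in>J. u i)) \<in> uball Q"
      using Cstab_apply[OF chain_Cstab P.increments_uball[OF inc J]] .
  qed
  have "\<forall>J\<in>Pow A. \<exists>c. c \<in> uball Q \<and> is_lub_seq Q (\<lambda>n. b n J) c"
  proof
    fix J assume "J \<in> Pow A"
    then have "uball_chain Q (\<lambda>n. b n J)" using bu up by (simp add: uball_chain_def)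
    then show "\<exists>c. c \<in> uball Q \<and> is_lub_seq Q (\<lambda>n. b n J) c" using Q.complete by blast
  qed
  from bchoice[OF this] obtain c where
    c: "\<And>J. J \<subseteq> A \<Longrightarrow> c J \<in> uball Q" "\<And>J. J \<subseteq> A \<Longrightarrow> is_lub_seq Q (\<lambda>n. b n J) (c J)"
    by blast
  have "g (x \<oplus>\<^bsub>P\<^esub> (\<Oplus>\<^bsub>P\<^esub>i\<in>I. u i)) = (\<Oplus>\<^bsub>Q\<^esub>J\<in>Pow I. c J)" if I: "I \<subseteq> A" for I
  proof -
    have "finite (Pow I)" using I fin by (meson Pow_mono finite_subset)
    then have "is_lub_seq Q (\<lambda>n. \<Oplus>\<^bsub>Q\<^esub>J\<in>Pow I. b n J) (\<Oplus>\<^bsub>Q\<^esub>J\<in>Pow I. c J)"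
      using Q.lub_finsum[of "Pow I" b c] up c(2) I by (metis Pow_iff subset_trans)
    then have "is_lub_seq Q (\<lambda>n. f n (x \<oplus>\<^bsub>P\<^esub> (\<Oplus>\<^bsub>P\<^esub>i\<in>I. u i))) (\<Oplus>\<^bsub>Q\<^esub>J\<in>Pow I. c J)"
      using Q.moebius_sum[OF bm I] by simp
    then show ?thesis
      using ptw[OF P.increments_uball[OF inc I]] Q.lub_unique by blast
  qed
  then have "expansion P Q g A x u c"
    using c(1) Q.uball_carrier by (auto simp: expansion_def moebius_def)
  with c(2) show ?thesis by blast
qed

lemma chain_expansions:
  fixes A :: "nat set"
  assumes inc: "increments P A x u"
  shows "\<exists>b. \<forall>n. expansion P Q (f n) A x u (b n)"
  using pre_stable_expansion[OF fun_carrier_pre_stable[OF chain_carrier] inc] by metis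

text \<open>Each property passes to the limit in its own way: pre-stability through the
  coefficients, Scott-continuity by interchanging two suprema, measurability as a pointwise limit of
  real functions.\<close>

lemma chain_lub_measurable_stable: "measurable_stable P Q g"
proof (rule measurable_stableI)
  have pre: "pre_stable P Q g"
  proof (rule pre_stableI)
    show "g x \<in> carrier Q" if "x \<in> uball P" for x
      using Q.lub_carrier[OF ptw[OF that]] .
    show "\<exists>b. expansion P Q g A x u b" if inc: "increments P A x u" for A :: "nat set" and x u
    proof -
      obtain b where "\<And>n. expansion P Q (f n) A x u (b n)"
        using chain_expansions[OF inc] by blast
      from chain_lub_expansion[OF inc this] show ?thesis by blast
    qed
  qed
  then show "stable P Q g"
  proof (rule stableI[where \<alpha> = 1])
    show "cnorm Q (g x) \<le> 1" if "x \<in> uball P" for x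
      using chain_lub_uball[OF that] by (simp add: uball_def)
    fix s x assume s: "uball_chain P s" "x \<in> uball P" "is_lub_seq P s x"
    have su: "s n \<in> uball P" for n using chain_uball[OF s(1)] .
    show "is_lub_seq Q (\<lambda>n. g (s n)) (g x)"
    proof (rule Q.lubI[OF Q.lub_carrier[OF ptw[OF s(2)]]])
      show "g (s n) \<preceq>\<^bsub>Q\<^esub> g x" for n
        by (rule pre_stable_mono[OF pre P.lub_upper[OF s(3)] s(2)])
      fix v assume v: "\<And>n. g (s n) \<preceq>\<^bsub>Q\<^esub> v"
      show "g x \<preceq>\<^bsub>Q\<^esub> v"
      \<comment> \<open>For fixed \<open>m\<close>, all \<open>f m (s n)\<close> lie below
        \<open>g (s n)\<close> and hence below \<open>v\<close>; Scott-continuity of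
        \<open>f m\<close> carries the bound to \<open>f m x\<close>.\<close>
      proof (rule Q.lub_least[OF ptw[OF s(2)]])
        show "f m x \<preceq>\<^bsub>Q\<^esub> v" for m
          by (rule Q.lub_least[OF stable_lub[OF fun_carrier_stable[OF chain_carrier] s]])
            (rule Q.le_trans[OF Q.lub_upper[OF ptw[OF su]] v])
      qed
    qed
  qed
  fix n \<gamma> k l assume *: "\<gamma> \<in> uball_paths P n" "l \<in> tests Q k"
  show "(\<lambda>w. l (first_coords k w) (g (\<gamma> (last_coords k n w)))) \<in> borel_measurable (Rn (k + n))"
  \<comment> \<open>The functions \<open>f m\<close> form a chain at every point, so a test sends
    their values to a convergent real sequence.\<close>
  proof (rule borel_measurable_LIMSEQ_real)
    show "(\<lambda>w. l (first_coords k w) (f m (\<gamma> (last_coords k n w)))) \<in> borel_measurable (Rn (k + n))" for m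
      using measurable_stable_measurable[OF _ *] chain_carrier by (simp add: fun_carrier_iff)
    fix w
    have "\<gamma> (last_coords k n w) \<in> uball P"
      using uball_paths_uball[OF *(1) coords_space] .
    then show "(\<lambda>m. l (first_coords k w) (f m (\<gamma> (last_coords k n w))))
        \<longlonglongrightarrow> l (first_coords k w) (g (\<gamma> (last_coords k n w)))"
      by (intro Q.test_LIMSEQ[OF *(2) coords_space] fun_cone_chain_pointwise[OF chain] chain_lub_uball ptw)
  qed
qed

text \<open>The order is coefficientwise and the coefficients of the limit are the least upper
  bounds of the coefficients of the chain, so both halves of the claim reduce to least upper bounds
  in \<open>Q\<close>.\<close>

lemma fun_cone_lub:
  shows "(\<lambda>x\<in>uball P. g x) \<in> Cstab P Q" "is_lub_seq (fun_cone P Q) f (\<lambda>x\<in>uball P. g x)"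
proof -
  let ?g = "\<lambda>x\<in>uball P. g x"
  show "?g \<in> Cstab P Q"
    by (rule Cstab_restrict[OF P.measurable_cone_axioms Q.measurable_cone_axioms chain_lub_measurable_stable chain_lub_uball])
  have gc: "?g \<in> carrier (fun_cone P Q)"
    by (rule fun_carrier_restrict[OF chain_lub_measurable_stable])
  have cong: "expansion P Q g A x u c" if "increments P A x u" "expansion P Q ?g A x u c"
    for A :: "nat set" and x u c
    using expansion_cong[OF that, of g] by simp
  interpret F: pcone "fun_cone P Q" by (rule fun_cone_pcone)
  \<comment> \<open>The order quantifies over arbitrary expansions; uniqueness identifies the given
    coefficients of the limit with the ones built as least upper bounds.\<close>
  have lub: "is_lub_seq Q (\<lambda>n. b n J) (c J)"
    if "increments P A x u" "\<And>n. expansion P Q (f n) A x u (b n)" "expansion P Q ?g A x u c" "J \<subseteq> A"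
    for A :: "nat set" and x u b c J
    using chain_lub_expansion[OF that(1,2)] expansion_unique[OF that(1) cong[OF that(1,3)] _ that(4)] that(4)
    by metis
  show "is_lub_seq (fun_cone P Q) f ?g"
  proof (rule F.lubI[OF gc])
    fix n
    show "f n \<preceq>\<^bsub>fun_cone P Q\<^esub> ?g"
      unfolding fun_cone_le_iff[OF chain_carrier gc] coeff_le_def
    proof (intro allI impI)
      fix A :: "nat set" and x u b c J
      assume inc: "increments P A x u" and b: "expansion P Q (f n) A x u b"
        and c: "expansion P Q ?g A x u c" and J: "J \<subseteq> A"
      obtain b' where b': "\<And>n. expansion P Q (f n) A x u (b' n)" using chain_expansions[OF inc] by blast
      have "b J = b' n J" using expansion_unique[OF inc b b' J] .
      then show "b J \<preceq>\<^bsub>Q\<^esub> c J" using Q.lub_upper[OF lub[OF inc b' c J]] by simp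
    qed
  next
    fix v assume v: "v \<in> carrier (fun_cone P Q)" "\<And>n. f n \<preceq>\<^bsub>fun_cone P Q\<^esub> v"
    show "?g \<preceq>\<^bsub>fun_cone P Q\<^esub> v"
      unfolding fun_cone_le_iff[OF gc v(1)] coeff_le_def
    proof (intro allI impI)
      fix A :: "nat set" and x u c d J
      assume inc: "increments P A x u" and c: "expansion P Q ?g A x u c"
        and d: "expansion P Q v A x u d" and J: "J \<subseteq> A"
      obtain b where b: "\<And>n. expansion P Q (f n) A x u (b n)" using chain_expansions[OF inc] by blast
      show "c J \<preceq>\<^bsub>Q\<^esub> d J"
      proof (rule Q.lub_least[OF lub[OF inc b c J]])
        show "b n J \<preceq>\<^bsub>Q\<^esub> d J" for n
          using coeff_leD[OF _ inc b d J] v fun_cone_le_iff[OF chain_carrier v(1)] by blast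
      qed
    qed
  qed
qed

end

lemma fun_cone_complete: "complete_pcone (fun_cone P Q)"
proof (intro complete_pcone.intro complete_pcone_axioms.intro fun_cone_pcone)
  fix f assume f: "uball_chain (fun_cone P Q) f"
  have "uball_chain Q (\<lambda>n. f n x)" if "x \<in> uball P" for x
    by (rule fun_cone_chain_pointwise[OF f that])
  then have "\<forall>x\<in>uball P. \<exists>y. is_lub_seq Q (\<lambda>n. f n x) y" using Q.complete by blast
  from bchoice[OF this] obtain g where "\<And>x. x \<in> uball P \<Longrightarrow> is_lub_seq Q (\<lambda>n. f n x) (g x)"
    by blast
  from fun_cone_lub[OF f this] show "\<exists>u\<in>uball (fun_cone P Q). is_lub_seq (fun_cone P Q) f u"
    by (auto simp: uball_fun_cone)
qed

text \<open>From left to right: completeness of \<open>Q\<close> yields a pointwise limit, which is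
  also a least upper bound in the function space and therefore equals \<open>g\<close> on the unit
  ball.\<close>

lemma fun_cone_lub_iff:
  assumes "uball_chain (fun_cone P Q) f" "g \<in> carrier (fun_cone P Q)"
  shows "is_lub_seq (fun_cone P Q) f g \<longleftrightarrow> (\<forall>x\<in>uball P. is_lub_seq Q (\<lambda>n. f n x) (g x))"
proof
  interpret F: pcone "fun_cone P Q" by (rule fun_cone_pcone)
  {
    assume "\<forall>x\<in>uball P. is_lub_seq Q (\<lambda>n. f n x) (g x)"
    then have "is_lub_seq (fun_cone P Q) f (\<lambda>x\<in>uball P. g x)"
      using fun_cone_lub(2)[OF assms(1)] by blast
    then show "is_lub_seq (fun_cone P Q) f g"
      using assms(2) by (simp add: fun_carrier_iff extensional_restrict)
  }
  assume g: "is_lub_seq (fun_cone P Q) f g"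
  have "uball_chain Q (\<lambda>n. f n x)" if "x \<in> uball P" for x
    by (rule fun_cone_chain_pointwise[OF assms(1) that])
  then have "\<forall>x\<in>uball P. \<exists>y. is_lub_seq Q (\<lambda>n. f n x) y" using Q.complete by blast
  from bchoice[OF this] obtain h where h: "\<And>x. x \<in> uball P \<Longrightarrow> is_lub_seq Q (\<lambda>n. f n x) (h x)"
    by blast
  have "g = (\<lambda>x\<in>uball P. h x)"
    using F.lub_unique[OF g fun_cone_lub(2)[OF assms(1) h]] by blast
  then show "\<forall>x\<in>uball P. is_lub_seq Q (\<lambda>n. f n x) (g x)" using h by simp
qed

section \<open>Tests of the function space\<close>

lemma path_test_apply:
  "r \<in> space (Rn n) \<Longrightarrow> f \<in> carrier (fun_cone P Q) \<Longrightarrow> path_test P Q n \<gamma> m r f = m r (f (\<gamma> r))"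
  by (simp add: path_test_def carrier_fun_cone)

text \<open>The functional evaluates at the point \<open>\<gamma> r\<close> and then applies
  \<open>m r\<close>. Evaluation at a point preserves least upper bounds because they are pointwise
  in the function space.\<close>

lemma path_test_dual:
  assumes \<gamma>: "\<gamma> \<in> uball_paths P n" and m: "m \<in> tests Q n" and r: "r \<in> space (Rn n)"
  shows "path_test P Q n \<gamma> m r \<in> cone_dual (fun_cone P Q)"
proof -
  interpret F: pcone "fun_cone P Q" by (rule fun_cone_pcone)
  let ?t = "path_test P Q n \<gamma> m r"
  note app = path_test_apply[OF r]
  have x: "\<gamma> r \<in> uball P" using uball_paths_uball[OF \<gamma> r] .
  have nonneg: "0 \<le> ?t f" if "f \<in> carrier (fun_cone P Q)" for f
    using that Q.test_nonneg[OF m r] x by (simp add: app fun_carrier_apply)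
  have "scott_continuous (fun_cone P Q) nonneg_cone ?t"
    unfolding scott_continuous_def
  proof (intro conjI allI ballI impI)
    show "?t \<in> uball (fun_cone P Q) \<rightarrow> carrier nonneg_cone"
      using nonneg F.uball_carrier by (simp add: carrier_nonneg_cone)
    obtain \<alpha> where \<alpha>: "\<And>y. y \<in> uball Q \<Longrightarrow> m r y \<le> \<alpha>" using Q.test_bounded[OF m r] by metis
    show "\<exists>\<alpha>. \<forall>f\<in>uball (fun_cone P Q). cnorm nonneg_cone (?t f) \<le> \<alpha>"
    proof (intro exI ballI)
      fix f assume f: "f \<in> uball (fun_cone P Q)"
      then show "cnorm nonneg_cone (?t f) \<le> \<alpha>"
        using \<alpha>[OF Cstab_apply[OF _ x]] F.uball_carrier[OF f]
        by (simp add: app nonneg_cone_def uball_fun_cone)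
    qed
    show "?t f \<preceq>\<^bsub>nonneg_cone\<^esub> ?t g"
      if "f \<in> uball (fun_cone P Q)" "g \<in> uball (fun_cone P Q)" "f \<preceq>\<^bsub>fun_cone P Q\<^esub> g" for f g
      using that nonneg[of f] Q.test_mono[OF m r fun_cone_le_pointwise[OF that(3) x]]
      by (simp add: le_nonneg_cone app F.uball_carrier)
    fix s f
    assume s: "uball_chain (fun_cone P Q) s" "f \<in> uball (fun_cone P Q)" "is_lub_seq (fun_cone P Q) s f"
    have su: "s n \<in> carrier (fun_cone P Q)" for n
      using s(1) F.uball_carrier by (simp add: uball_chain_def)
    have fc: "f \<in> carrier (fun_cone P Q)" using F.uball_carrier[OF s(2)] .
    have "uball_chain Q (\<lambda>n. s n (\<gamma> r))"
      by (rule fun_cone_chain_pointwise[OF s(1) x])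
    moreover have "f (\<gamma> r) \<in> uball Q" using s(2) Cstab_apply[OF _ x] by (simp add: uball_fun_cone)
    moreover have "is_lub_seq Q (\<lambda>n. s n (\<gamma> r)) (f (\<gamma> r))"
      using fun_cone_lub_iff[OF s(1) fc] s(3) x by blast
    ultimately have "(\<lambda>n. m r (s n (\<gamma> r))) \<longlonglongrightarrow> m r (f (\<gamma> r))"
      by (rule Q.test_LIMSEQ[OF m r])
    moreover have "incseq (\<lambda>n. ?t (s n))"
    proof (rule incseq_SucI)
      show "?t (s n) \<le> ?t (s (Suc n))" for n
        using s(1) Q.test_mono[OF m r fun_cone_le_pointwise[OF _ x]] su
        by (simp add: uball_chain_def app)
    qed
    ultimately show "is_lub_seq nonneg_cone (\<lambda>n. ?t (s n)) (?t f)"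
      using nonneg[OF su] by (intro lub_nonneg_coneI) (simp_all add: app su fc)
  qed
  moreover have "?t \<in> carrier (fun_cone P Q) \<rightarrow>\<^sub>E {0..}"
    using nonneg r by (auto simp: path_test_def carrier_fun_cone)
  moreover have "?t (f \<oplus>\<^bsub>fun_cone P Q\<^esub> g) = ?t f + ?t g"
    if "f \<in> carrier (fun_cone P Q)" "g \<in> carrier (fun_cone P Q)" for f g
  proof -
    have "f \<oplus>\<^bsub>fun_cone P Q\<^esub> g \<in> carrier (fun_cone P Q)" using that by simp
    then show ?thesis
      using that x Q.test_add[OF m r] by (simp add: app fun_carrier_apply) (simp add: add_fun_cone fun_carrier_apply)
  qed
  moreover have "?t (a \<odot>\<^bsub>fun_cone P Q\<^esub> f) = a * ?t f"
    if "0 \<le> a" "f \<in> carrier (fun_cone P Q)" for a f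
  proof -
    have "a \<odot>\<^bsub>fun_cone P Q\<^esub> f \<in> carrier (fun_cone P Q)" using that F.smult_closed by simp
    then show ?thesis
      using that x Q.test_smult[OF m r] by (simp add: app) (simp add: smult_fun_cone fun_carrier_apply)
  qed
  ultimately show ?thesis unfolding cone_dual_def by blast
qed

lemma fun_cone_measurable: "measurable_cone (fun_cone P Q)"
proof (intro measurable_cone.intro measurable_cone_axioms.intro fun_cone_pcone)
  show "tests (fun_cone P Q) n \<subseteq> space (Rn n) \<rightarrow>\<^sub>E cone_dual (fun_cone P Q)" for n
  proof
    fix t assume "t \<in> tests (fun_cone P Q) n"
    then obtain \<gamma> m where t: "\<gamma> \<in> uball_paths P n" "m \<in> tests Q n" "t = path_test P Q n \<gamma> m"
      by (auto simp: tests_fun_cone)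
    show "t \<in> space (Rn n) \<rightarrow>\<^sub>E cone_dual (fun_cone P Q)"
    proof (rule PiE_I)
      show "t r \<in> cone_dual (fun_cone P Q)" if "r \<in> space (Rn n)" for r
        using path_test_dual[OF t(1,2) that] t(3) by simp
      show "t r = undefined" if "r \<notin> space (Rn n)" for r
        using that by (simp add: t(3) path_test_def)
    qed
  qed
  fix n :: nat
  let ?z = "\<lambda>r\<in>space (Rn n). \<lambda>x\<in>carrier Q. 0 :: real"
  \<comment> \<open>A path into the unit ball has to accompany the zero test; the constant path at
    zero exists in every cone.\<close>
  have "(\<lambda>_. \<zero>\<^bsub>P\<^esub>) \<in> uball_paths P n"
    using P.measurable_path_const[OF P.zero_closed] P.zero_uball by (simp add: uball_paths_def)
  moreover have "(\<lambda>r\<in>space (Rn n). \<lambda>x\<in>carrier (fun_cone P Q). 0) = path_test P Q n (\<lambda>_. \<zero>\<^bsub>P\<^esub>) ?z"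
    using fun_carrier_apply[OF _ P.zero_uball]
    by (auto simp: path_test_def carrier_fun_cone fun_eq_iff restrict_def)
  ultimately show "(\<lambda>r\<in>space (Rn n). \<lambda>x\<in>carrier (fun_cone P Q). 0) \<in> tests (fun_cone P Q) n"
    unfolding tests_fun_cone using Q.tests_zero by blast
next
  fix t n h p assume t: "t \<in> tests (fun_cone P Q) n" and h: "h \<in> Rn p \<rightarrow>\<^sub>M Rn n"
  then obtain \<gamma> m where g: "\<gamma> \<in> uball_paths P n" "m \<in> tests Q n" "t = path_test P Q n \<gamma> m"
    by (auto simp: tests_fun_cone)
  have "compose (space (Rn p)) t h = path_test P Q p (\<lambda>s. \<gamma> (h s)) (compose (space (Rn p)) m h)"
    using measurable_space[OF h] by (auto simp: g(3) path_test_def compose_def fun_eq_iff restrict_def)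
  then show "compose (space (Rn p)) t h \<in> tests (fun_cone P Q) p"
    unfolding tests_fun_cone using uball_paths_compose[OF g(1) h] Q.tests_compose[OF g(2) h] by blast
next
  fix t n f assume t: "t \<in> tests (fun_cone P Q) n" and f: "f \<in> carrier (fun_cone P Q)"
  then obtain \<gamma> m where g: "\<gamma> \<in> uball_paths P n" "m \<in> tests Q n" "t = path_test P Q n \<gamma> m"
    by (auto simp: tests_fun_cone)
  have "measurable_path Q n (\<lambda>s. f (\<gamma> s))"
    using measurable_stable_path[OF _ g(1)] f by (simp add: fun_carrier_iff)
  \<comment> \<open>Both parameter maps are the identity, because a test of the function space reads
    its path and its test of \<open>Q\<close> on the diagonal.\<close>
  from path_measurable[OF this g(2) measurable_ident_sets[OF refl] measurable_ident_sets[OF refl]]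
  have "(\<lambda>r. m r (f (\<gamma> r))) \<in> borel_measurable (Rn n)" .
  then show "(\<lambda>r. t r f) \<in> borel_measurable (Rn n)"
    using f by (subst measurable_cong[where g = "\<lambda>r. m r (f (\<gamma> r))"]) (simp_all add: g(3) path_test_apply)
qed

end


section \<open>Evaluation and currying\<close>

lemma (in complete_mcone_pair) Ev_apply: "g \<in> Cstab P Q \<Longrightarrow> x \<in> uball P \<Longrightarrow> Ev P Q (g, x) = g x"
  by (simp add: Ev_def uball_fun_cone)

text \<open>
  Expanding each increment \<open>h i\<close> of the function along the increments of the argument, the monomial
  \<open>(i, J)\<close> is active at \<open>I\<close> iff \<open>insert i J \<subseteq> I\<close>.
\<close>

lemma (in complete_mcone_pair) eval_pre_stable:
  "pre_stable (prod_cone (fun_cone P Q) P) Q (\<lambda>z. fst z (snd z))"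
proof -
  interpret F: measurable_cone "fun_cone P Q" by (rule fun_cone_measurable)
  interpret FP: mcone_pair "fun_cone P Q" P by unfold_locales
  interpret FPc: measurable_cone "prod_cone (fun_cone P Q) P" by (rule FP.prod_cone_measurable)
  interpret E: two_mcones "prod_cone (fun_cone P Q) P" Q by unfold_locales
  show ?thesis
  proof (rule E.pre_stableI)
    show "fst z (snd z) \<in> carrier Q" if "z \<in> uball (prod_cone (fun_cone P Q) P)" for z
      using that by (auto simp: uball_prod_cone F.uball_carrier fun_carrier_apply)
    fix A :: "nat set" and z u assume inc: "increments (prod_cone (fun_cone P Q) P) A z u"
    let ?f = "fst z" and ?x = "snd z" and ?h = "\<lambda>i. fst (u i)" and ?v = "\<lambda>i. snd (u i)"
    let ?y = "\<lambda>I. ?x \<oplus>\<^bsub>P\<^esub> (\<Oplus>\<^bsub>P\<^esub>i\<in>I. ?v i)"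
    have incF: "increments (fun_cone P Q) A ?f ?h" and incP: "increments P A ?x ?v"
      using inc by (simp_all add: FP.increments_prod_cone)
    have A: "finite A" by (rule P.increments_finite[OF incP])
    have y: "?y I \<in> uball P" if "I \<subseteq> A" for I by (rule P.increments_uball[OF incP that])
    have fc: "?f \<in> carrier (fun_cone P Q)" using incF by (simp add: increments_def)
    have hc: "?h \<in> I \<rightarrow> carrier (fun_cone P Q)" if "I \<subseteq> A" for I by (rule F.increments_Pi[OF incF that])
    obtain b where b: "moebius Q A (\<lambda>I. ?f (?y I)) b"
      using pre_stable_expansion[OF fun_carrier_pre_stable[OF fc] incP] by (auto simp: expansion_def)
    have "\<forall>i\<in>A. \<exists>c. moebius Q A (\<lambda>I. ?h i (?y I)) c"
      using pre_stable_expansion[OF fun_carrier_pre_stable incP] hc[OF subset_refl] by (auto simp: expansion_def)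
    from bchoice[OF this] obtain c where c: "\<And>i. i \<in> A \<Longrightarrow> moebius Q A (\<lambda>I. ?h i (?y I)) (c i)"
      by blast
    have cc: "c i J \<in> carrier Q" if "i \<in> A" "J \<subseteq> A" for i J
      using Q.moebius_coeff[OF c[OF that(1)] that(2)] .
    have "moebius Q A (\<lambda>I. \<Oplus>\<^bsub>Q\<^esub>i\<in>I. ?h i (?y I))
        (\<lambda>K. \<Oplus>\<^bsub>Q\<^esub>t\<in>{t \<in> A \<times> Pow A. insert (fst t) (snd t) = K}. c (fst t) (snd t))"
    proof (rule Q.moebius_collect[OF A])
      show "finite (A \<times> Pow A)" using A by simp
      show "(\<lambda>t. insert (fst t) (snd t)) \<in> A \<times> Pow A \<rightarrow> Pow A" by auto
      show "(\<lambda>t. c (fst t) (snd t)) \<in> A \<times> Pow A \<rightarrow> carrier Q" using cc by auto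
      fix I assume I: "I \<subseteq> A"
      have cI: "c i J \<in> carrier Q" if "i \<in> I" "J \<subseteq> I" for i J
        using that I by (intro cc) auto
      have "(\<Oplus>\<^bsub>Q\<^esub>i\<in>I. ?h i (?y I)) = (\<Oplus>\<^bsub>Q\<^esub>i\<in>I. \<Oplus>\<^bsub>Q\<^esub>J\<in>Pow I. c i J)"
        using I cI Q.moebius_sum[OF c I] by (intro Q.finsum_cong') (auto intro!: Q.finsum_closed)
      also have "\<dots> = (\<Oplus>\<^bsub>Q\<^esub>t\<in>I \<times> Pow I. c (fst t) (snd t))"
        using cI finite_subset[OF I A] by (intro Q.finsum_Sigma) auto
      also have "I \<times> Pow I = {t \<in> A \<times> Pow A. insert (fst t) (snd t) \<subseteq> I}"
        using I by auto
      finally show "(\<Oplus>\<^bsub>Q\<^esub>i\<in>I. ?h i (?y I))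
          = (\<Oplus>\<^bsub>Q\<^esub>t\<in>{t \<in> A \<times> Pow A. insert (fst t) (snd t) \<subseteq> I}. c (fst t) (snd t))" .
    qed
    from Q.moebius_add[OF b this] obtain d where
      d: "moebius Q A (\<lambda>I. ?f (?y I) \<oplus>\<^bsub>Q\<^esub> (\<Oplus>\<^bsub>Q\<^esub>i\<in>I. ?h i (?y I))) d"
      by blast
    let ?s = "\<lambda>I. z \<oplus>\<^bsub>prod_cone (fun_cone P Q) P\<^esub> (\<Oplus>\<^bsub>prod_cone (fun_cone P Q) P\<^esub>i\<in>I. u i)"
    have "moebius Q A (\<lambda>I. fst (?s I) (snd (?s I))) d"
    proof (rule Q.moebius_cong[OF d])
      fix I assume I: "I \<subseteq> A"
      have fin: "finite I" using I A by (rule finite_subset)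
      have "u \<in> I \<rightarrow> carrier (fun_cone P Q) \<times> carrier P"
        using FPc.increments_Pi[OF inc I] by (simp add: carrier_prod_cone)
      from FP.finsum_prod_cone[OF fin this]
      have "?s I = (?f \<oplus>\<^bsub>fun_cone P Q\<^esub> (\<Oplus>\<^bsub>fun_cone P Q\<^esub>i\<in>I. ?h i), ?y I)"
        by (simp add: add_prod_cone)
      then show "?f (?y I) \<oplus>\<^bsub>Q\<^esub> (\<Oplus>\<^bsub>Q\<^esub>i\<in>I. ?h i (?y I)) = fst (?s I) (snd (?s I))"
        using finsum_fun_cone[OF fin hc[OF I] y[OF I]] y[OF I] by (simp add: add_fun_cone)
    qed
    then show "\<exists>b. expansion (prod_cone (fun_cone P Q) P) Q (\<lambda>z. fst z (snd z)) A z u b"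
      by (auto simp: expansion_def)
  qed
qed

text \<open>Joint Scott-continuity follows from continuity in each argument, since diagonal values
  dominate all mixed ones. For measurability, the argument component of the path is made part of a
  test that is applied to the function component.\<close>

lemma (in complete_mcone_pair) Cstab_Ev: "Ev P Q \<in> Cstab (prod_cone (fun_cone P Q) P) Q"
proof -
  interpret F: measurable_cone "fun_cone P Q" by (rule fun_cone_measurable)
  interpret FP: mcone_pair "fun_cone P Q" P by unfold_locales
  interpret FPc: measurable_cone "prod_cone (fun_cone P Q) P" by (rule FP.prod_cone_measurable)
  interpret E: two_mcones "prod_cone (fun_cone P Q) P" Q by unfold_locales
  have eval_uball: "fst z (snd z) \<in> uball Q" if "z \<in> uball (prod_cone (fun_cone P Q) P)" for z
    using that Cstab_apply[of "fst z" P Q] by (auto simp: uball_prod_cone uball_fun_cone)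
  have "stable (prod_cone (fun_cone P Q) P) Q (\<lambda>z. fst z (snd z))"
  proof (rule E.stableI[where \<alpha> = 1, OF eval_pre_stable])
    show "cnorm Q (fst z (snd z)) \<le> 1" if "z \<in> uball (prod_cone (fun_cone P Q) P)" for z
      using eval_uball[OF that] by (simp add: uball_def)
    fix s z
    assume s: "uball_chain (prod_cone (fun_cone P Q) P) s" and z: "z \<in> uball (prod_cone (fun_cone P Q) P)"
      and lub: "is_lub_seq (prod_cone (fun_cone P Q) P) s z"
    have sF: "uball_chain (fun_cone P Q) (\<lambda>n. fst (s n))" and sP: "uball_chain P (\<lambda>n. snd (s n))"
      using s by (simp_all add: uball_chain_prod_cone)
    have zF: "fst z \<in> carrier (fun_cone P Q)" and zP: "snd z \<in> uball P"
      using z by (auto simp: uball_prod_cone F.uball_carrier)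
    have lF: "is_lub_seq Q (\<lambda>n. fst (s n) x) (fst z x)" if "x \<in> uball P" for x
      using lub fun_cone_lub_iff[OF sF zF] that by (simp add: lub_prod_cone)
    have lP: "is_lub_seq P (\<lambda>n. snd (s n)) (snd z)"
      using lub by (simp add: lub_prod_cone)
    have leF: "fst (s m) \<preceq>\<^bsub>fun_cone P Q\<^esub> fst (s n)" if "m \<le> n" for m n
      using F.le_seq_mono[of "\<lambda>n. fst (s n)", OF _ that] sF by (simp add: uball_chain_def)
    have leP: "snd (s m) \<preceq>\<^bsub>P\<^esub> snd (s n)" if "m \<le> n" for m n
      using P.le_seq_mono[of "\<lambda>n. snd (s n)", OF _ that] sP by (simp add: uball_chain_def)
    have uP: "snd (s n) \<in> uball P" for n using sP by (simp add: uball_chain_def)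
    have cF: "fst (s n) \<in> carrier (fun_cone P Q)" for n
      using sF by (simp add: uball_chain_def F.uball_carrier)
    show "is_lub_seq Q (\<lambda>n. fst (s n) (snd (s n))) (fst z (snd z))"
    proof (rule Q.lubI)
      show "fst z (snd z) \<in> carrier Q" using fun_carrier_apply[OF zF zP] .
      show "fst (s n) (snd (s n)) \<preceq>\<^bsub>Q\<^esub> fst z (snd z)" for n
        by (rule E.pre_stable_mono[OF eval_pre_stable FPc.lub_upper[OF lub] z])
      fix v assume v: "\<And>n. fst (s n) (snd (s n)) \<preceq>\<^bsub>Q\<^esub> v"
      \<comment> \<open>Both indices are raised to their maximum, so a bound of the diagonal bounds
        the whole double sequence; the limits can then be taken one argument at a time.\<close>
      have mn: "fst (s m) (snd (s n)) \<preceq>\<^bsub>Q\<^esub> v" for m n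
      proof -
        have "fst (s m) (snd (s n)) \<preceq>\<^bsub>Q\<^esub> fst (s (max m n)) (snd (s n))"
          by (rule fun_cone_le_pointwise[OF leF uP]) simp
        also have "\<dots> \<preceq>\<^bsub>Q\<^esub> fst (s (max m n)) (snd (s (max m n)))"
          by (rule stable_mono[OF fun_carrier_stable[OF cF] leP uP]) simp
        also have "\<dots> \<preceq>\<^bsub>Q\<^esub> v" by (rule v)
        finally show ?thesis .
      qed
      show "fst z (snd z) \<preceq>\<^bsub>Q\<^esub> v"
        by (rule Q.lub_least[OF lF[OF zP]])
          (rule Q.lub_least[OF stable_lub[OF fun_carrier_stable[OF cF] sP zP lP] mn])
    qed
  qed
  then have "measurable_stable (prod_cone (fun_cone P Q) P) Q (\<lambda>z. fst z (snd z))"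
  proof (rule E.measurable_stableI)
    fix n \<gamma> k l assume \<gamma>: "\<gamma> \<in> uball_paths (prod_cone (fun_cone P Q) P) n" and l: "l \<in> tests Q k"
    let ?\<phi> = "\<lambda>s. fst (\<gamma> s)" and ?\<delta> = "\<lambda>s. snd (\<gamma> s)"
    have \<phi>: "?\<phi> \<in> uball_paths (fun_cone P Q) n" and \<delta>: "?\<delta> \<in> uball_paths P n"
      using \<gamma> by (simp_all add: FP.uball_paths_prod_cone)
    \<comment> \<open>A path test has only one parameter, yet \<open>l\<close> depends on the first
      and the path on the last coordinates. Both are therefore pulled back to
      \<open>Rn (k + n)\<close> before being combined.\<close>
    let ?l = "compose (space (Rn (k + n))) l (\<lambda>w. first_coords k w)"
    let ?t = "path_test P Q (k + n) (\<lambda>w. ?\<delta> (last_coords k n w)) ?l"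
    have "?t \<in> tests (fun_cone P Q) (k + n)"
      unfolding tests_fun_cone
      using uball_paths_compose[OF \<delta> last_coords_measurable] Q.tests_compose[OF l first_coords_measurable]
      by blast
    from path_measurable[OF uball_paths_path[OF \<phi>] this measurable_ident_sets[OF refl] last_coords_measurable]
    have "(\<lambda>w. ?t w (?\<phi> (last_coords k n w))) \<in> borel_measurable (Rn (k + n))" .
    moreover have "?t w (?\<phi> (last_coords k n w)) = l (first_coords k w) (?\<phi> (last_coords k n w) (?\<delta> (last_coords k n w)))"
      if "w \<in> space (Rn (k + n))" for w
      using that F.uball_carrier[OF uball_paths_uball[OF \<phi> coords_space]]
      by (simp add: path_test_apply compose_def)
    ultimately show "(\<lambda>w. l (first_coords k w) (fst (\<gamma> (last_coords k n w)) (snd (\<gamma> (last_coords k n w)))))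
        \<in> borel_measurable (Rn (k + n))"
      by (subst measurable_cong[where g = "\<lambda>w. ?t w (?\<phi> (last_coords k n w))"]) simp_all
  qed
  then have "(\<lambda>z\<in>uball (prod_cone (fun_cone P Q) P). fst z (snd z)) \<in> Cstab (prod_cone (fun_cone P Q) P) Q"
    by (rule Cstab_restrict[OF FPc.measurable_cone_axioms Q.measurable_cone_axioms _ eval_uball])
  then show ?thesis
    by (simp add: Ev_def uball_prod_cone case_prod_unfold)
qed

section \<open>Currying\<close>

text \<open>Increments of one factor of a product are padded by zero on the indices that belong to
  the other factor; the padding drops out of every sum.\<close>

lemma (in pcone) finsum_left:
  fixes S :: "('i + 'j) set"
  assumes "finite S" "\<And>a. Inl a \<in> S \<Longrightarrow> w a \<in> carrier P"
  shows "(\<Oplus>i\<in>S. case i of Inl a \<Rightarrow> w a | Inr b \<Rightarrow> \<zero>) = (\<Oplus>a\<in>Inl -` S. w a)"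
proof -
  have "(\<Oplus>i\<in>S. case i of Inl a \<Rightarrow> w a | Inr b \<Rightarrow> \<zero>)
      = (\<Oplus>i\<in>(Inl :: _ \<Rightarrow> 'i + 'j) ` (Inl -` S). case i of Inl a \<Rightarrow> w a | Inr b \<Rightarrow> \<zero>)"
    using assms by (intro add.finprod_mono_neutral_cong_right) (auto split: sum.splits)
  also have "\<dots> = (\<Oplus>a\<in>Inl -` S. w a)"
    using assms by (subst finsum_reindex) auto
  finally show ?thesis .
qed

lemma (in pcone) finsum_right:
  fixes S :: "('i + 'j) set"
  assumes "finite S" "\<And>b. Inr b \<in> S \<Longrightarrow> w b \<in> carrier P"
  shows "(\<Oplus>i\<in>S. case i of Inl a \<Rightarrow> \<zero> | Inr b \<Rightarrow> w b) = (\<Oplus>b\<in>Inr -` S. w b)"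
proof -
  have "(\<Oplus>i\<in>S. case i of Inl a \<Rightarrow> \<zero> | Inr b \<Rightarrow> w b)
      = (\<Oplus>i\<in>(Inr :: _ \<Rightarrow> 'i + 'j) ` (Inr -` S). case i of Inl a \<Rightarrow> \<zero> | Inr b \<Rightarrow> w b)"
    using assms by (intro add.finprod_mono_neutral_cong_right) (auto split: sum.splits)
  also have "\<dots> = (\<Oplus>b\<in>Inr -` S. w b)"
    using assms by (subst finsum_reindex) auto
  finally show ?thesis .
qed

locale currying = complete_mcone_pair P Q + R: measurable_cone R
  for P :: "'a mcone" and Q :: "'b mcone" and R :: "'r mcone" +
  fixes f :: "'r \<times> 'a \<Rightarrow> 'b"
  assumes f: "f \<in> Cstab (prod_cone R P) Q"
begin

sublocale RP: mcone_pair R P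
  by unfold_locales

sublocale RPc: measurable_cone "prod_cone R P"
  by (rule RP.prod_cone_measurable)

sublocale H: two_mcones "prod_cone R P" Q
  by unfold_locales

lemma f_measurable_stable: "measurable_stable (prod_cone R P) Q f"
  using f by (rule Cstab_measurable_stable)

lemma f_stable: "stable (prod_cone R P) Q f"
  by (rule H.measurable_stable_stable[OF f_measurable_stable])

lemma f_pre_stable: "pre_stable (prod_cone R P) Q f"
  by (rule H.stable_pre_stable[OF f_stable])

lemma f_uball: "z \<in> uball R \<Longrightarrow> x \<in> uball P \<Longrightarrow> f (z, x) \<in> uball Q"
  using Cstab_apply[OF f] by (simp add: uball_prod_cone)

lemma section_measurable_stable:
  assumes "z \<in> uball R"
  shows "measurable_stable P Q (\<lambda>x. f (z, x))"
proof (rule measurable_stable_compose[OF P.measurable_cone_axioms RPc.measurable_cone_axioms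
      Q.measurable_cone_axioms _ _ f_measurable_stable])
  interpret PR: two_mcones P R by unfold_locales
  show "measurable_stable P (prod_cone R P) (\<lambda>x. (z, x))"
    using PR.measurable_stable_const[OF R.uball_carrier[OF assms]] measurable_stable_id[OF P.measurable_cone_axioms]
    by (rule RP.measurable_stable_Pair[OF P.measurable_cone_axioms])
  show "(\<lambda>x. (z, x)) \<in> uball P \<rightarrow> uball (prod_cone R P)"
    using assms by (simp add: uball_prod_cone)
qed

context
  fixes A :: "nat set" and z w and b :: "'a \<Rightarrow> nat set \<Rightarrow> 'b"
  assumes inc: "increments R A z w"
    and b: "\<And>x. x \<in> uball P \<Longrightarrow> moebius Q A (\<lambda>I. f (z \<oplus>\<^bsub>R\<^esub> (\<Oplus>\<^bsub>R\<^esub>i\<in>I. w i), x)) (b x)"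
begin

text \<open>
  Over the joint increments \<open>A <+> B\<close> of both arguments, \<open>c\<close> refines \<open>b\<close>: the coefficient of \<open>b\<close> at
  \<open>J\<close> collects those of \<open>c\<close> at the sets with left part \<open>J\<close>.
\<close>

lemma coeff_pre_stable:
  assumes J: "J \<subseteq> A"
  shows "pre_stable P Q (\<lambda>x. b x J)"
proof (rule pre_stableI)
  show "b x J \<in> carrier Q" if "x \<in> uball P" for x
    using Q.moebius_coeff[OF b[OF that] J] .
  fix B :: "nat set" and x u assume incP: "increments P B x u"
  \<comment> \<open>Left indices move only the argument in \<open>R\<close>, right indices only the
    argument in \<open>P\<close>, so the partial sum over \<open>I <+> K\<close> moves both
    independently.\<close>
  define U where "U i = (case i of Inl a \<Rightarrow> w a | Inr b \<Rightarrow> \<zero>\<^bsub>R\<^esub>, case i of Inl a \<Rightarrow> \<zero>\<^bsub>P\<^esub> | Inr b \<Rightarrow> u b)"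
    for i :: "nat + nat"
  have A: "finite A" and B: "finite B"
    using R.increments_finite[OF inc] P.increments_finite[OF incP] .
  have wc: "w a \<in> carrier R" if "a \<in> A" for a using R.increments_Pi[OF inc subset_refl] that by auto
  have uc: "u a \<in> carrier P" if "a \<in> B" for a using P.increments_Pi[OF incP subset_refl] that by auto
  have sumR: "(\<Oplus>\<^bsub>R\<^esub>i\<in>S. fst (U i)) = (\<Oplus>\<^bsub>R\<^esub>a\<in>Inl -` S. w a)" if "S \<subseteq> A <+> B" for S
    unfolding U_def fst_conv using that A B wc by (intro R.finsum_left) (auto intro: finite_subset)
  have sumP: "(\<Oplus>\<^bsub>P\<^esub>i\<in>S. snd (U i)) = (\<Oplus>\<^bsub>P\<^esub>a\<in>Inr -` S. u a)" if "S \<subseteq> A <+> B" for S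
    unfolding U_def snd_conv using that A B uc by (intro P.finsum_right) (auto intro: finite_subset)
  have vim: "Inl -` (I <+> K) = I" "Inr -` (I <+> K) = K" for I K :: "nat set" by auto
  have Uc: "fst (U i) \<in> carrier R" "snd (U i) \<in> carrier P" if "i \<in> A <+> B" for i
    using that wc uc by (auto simp: U_def)
  have "increments R (A <+> B) z (\<lambda>i. fst (U i))"
    unfolding increments_def sumR[OF subset_refl] vim
    using inc A B Uc(1) by (auto simp: increments_def simp del: fst_conv)
  moreover have "increments P (A <+> B) x (\<lambda>i. snd (U i))"
    unfolding increments_def sumP[OF subset_refl] vim
    using incP A B Uc(2) by (auto simp: increments_def simp del: snd_conv)
  ultimately have incRP: "increments (prod_cone R P) (A <+> B) (z, x) U"
    by (simp add: RP.increments_prod_cone)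
  obtain c where "expansion (prod_cone R P) Q f (A <+> B) (z, x) U c"
    using H.pre_stable_expansion[OF f_pre_stable incRP] by blast
  then have c: "moebius Q (A <+> B)
      (\<lambda>S. f ((z, x) \<oplus>\<^bsub>prod_cone R P\<^esub> (\<Oplus>\<^bsub>prod_cone R P\<^esub>i\<in>S. U i))) c"
    by (simp add: expansion_def)
  have cc: "c S \<in> carrier Q" if "S \<subseteq> A <+> B" for S using Q.moebius_coeff[OF c that] .
  have fc: "f (z \<oplus>\<^bsub>R\<^esub> (\<Oplus>\<^bsub>R\<^esub>i\<in>I. w i), x \<oplus>\<^bsub>P\<^esub> (\<Oplus>\<^bsub>P\<^esub>i\<in>K. u i)) = (\<Oplus>\<^bsub>Q\<^esub>S\<in>Pow (I <+> K). c S)"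
    if "I \<subseteq> A" "K \<subseteq> B" for I K
  proof -
    have S: "I <+> K \<subseteq> A <+> B" using that by auto
    have "finite (I <+> K)" using S A B by (auto intro: finite_subset)
    moreover have "U \<in> I <+> K \<rightarrow> carrier R \<times> carrier P"
      using Uc[OF subsetD[OF S]] by (intro Pi_I) (simp only: mem_Times_iff simp_thms)
    ultimately have "(\<Oplus>\<^bsub>prod_cone R P\<^esub>i\<in>I <+> K. U i) = (\<Oplus>\<^bsub>R\<^esub>i\<in>I. w i, \<Oplus>\<^bsub>P\<^esub>i\<in>K. u i)"
      by (simp only: RP.finsum_prod_cone sumR[OF S] sumP[OF S] vim)
    then show ?thesis
      using Q.moebius_sum[OF c S] by (simp add: add_prod_cone)
  qed
  \<comment> \<open>For fixed \<open>K\<close> the left part of a joint index acts as the monomial;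
    uniqueness of coefficients over \<open>A\<close> identifies the collected sum with
    \<open>b\<close> at the shifted argument.\<close>
  have coeff: "b (x \<oplus>\<^bsub>P\<^esub> (\<Oplus>\<^bsub>P\<^esub>i\<in>K. u i)) J = (\<Oplus>\<^bsub>Q\<^esub>S\<in>{S \<in> Pow (A <+> K). Inl -` S = J}. c S)"
    if K: "K \<subseteq> B" for K
  proof (rule Q.moebius_unique[OF A b[OF P.increments_uball[OF incP K]] _ J])
    show "moebius Q A (\<lambda>I. f (z \<oplus>\<^bsub>R\<^esub> (\<Oplus>\<^bsub>R\<^esub>i\<in>I. w i), x \<oplus>\<^bsub>P\<^esub> (\<Oplus>\<^bsub>P\<^esub>i\<in>K. u i)))
        (\<lambda>J. \<Oplus>\<^bsub>Q\<^esub>S\<in>{S \<in> Pow (A <+> K). Inl -` S = J}. c S)"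
    proof (rule Q.moebius_collect[OF A])
      show "finite (Pow (A <+> K))" using A B K by (simp add: finite_subset)
      show "(\<lambda>S. Inl -` S) \<in> Pow (A <+> K) \<rightarrow> Pow A" by auto
      show "c \<in> Pow (A <+> K) \<rightarrow> carrier Q" using K by (intro Pi_I cc) auto
      fix I assume I: "I \<subseteq> A"
      have "Pow (I <+> K) = {S \<in> Pow (A <+> K). Inl -` S \<subseteq> I}"
        using I by auto
      then show "f (z \<oplus>\<^bsub>R\<^esub> (\<Oplus>\<^bsub>R\<^esub>i\<in>I. w i), x \<oplus>\<^bsub>P\<^esub> (\<Oplus>\<^bsub>P\<^esub>i\<in>K. u i))
          = (\<Oplus>\<^bsub>Q\<^esub>S\<in>{S \<in> Pow (A <+> K). Inl -` S \<subseteq> I}. c S)"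
        using fc[OF I K] by simp
    qed
  qed
  \<comment> \<open>Now \<open>J\<close> is fixed and \<open>K\<close> varies, so the right part of
    a joint index becomes the monomial.\<close>
  have "moebius Q B (\<lambda>K. b (x \<oplus>\<^bsub>P\<^esub> (\<Oplus>\<^bsub>P\<^esub>i\<in>K. u i)) J)
      (\<lambda>L. \<Oplus>\<^bsub>Q\<^esub>S\<in>{S \<in> {S \<in> Pow (A <+> B). Inl -` S = J}. Inr -` S = L}. c S)"
  proof (rule Q.moebius_collect[OF B])
    show "finite {S \<in> Pow (A <+> B). Inl -` S = J}" using A B by simp
    show "(\<lambda>S. Inr -` S) \<in> {S \<in> Pow (A <+> B). Inl -` S = J} \<rightarrow> Pow B" by auto
    show "c \<in> {S \<in> Pow (A <+> B). Inl -` S = J} \<rightarrow> carrier Q" by (intro Pi_I cc) auto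
    fix K assume K: "K \<subseteq> B"
    have "{S \<in> Pow (A <+> K). Inl -` S = J} = {S \<in> {S \<in> Pow (A <+> B). Inl -` S = J}. Inr -` S \<subseteq> K}"
      using K by auto
    then show "b (x \<oplus>\<^bsub>P\<^esub> (\<Oplus>\<^bsub>P\<^esub>i\<in>K. u i)) J
        = (\<Oplus>\<^bsub>Q\<^esub>S\<in>{S \<in> {S \<in> Pow (A <+> B). Inl -` S = J}. Inr -` S \<subseteq> K}. c S)"
      using coeff[OF K] by simp
  qed
  then show "\<exists>d. expansion P Q (\<lambda>x. b x J) B x u d" by (auto simp: expansion_def)
qed

text \<open>The coefficients solve a triangular system: the section of \<open>f\<close> at the
  partial sum over \<open>J\<close> is \<open>b x J\<close> plus the coefficients at proper subsets,
  which are measurable and stable by induction. With pre-stability known from the joint expansion,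
  \<open>measurable_stable_diff\<close> applies.\<close>

lemma coeff_measurable_stable:
  assumes "J \<subseteq> A"
  shows "measurable_stable P Q (\<lambda>x. b x J)"
proof -
  have "finite J" using assms R.increments_finite[OF inc] by (rule finite_subset)
  then show ?thesis using assms
  proof (induction J rule: finite_psubset_induct)
    case (psubset J)
    have "measurable_stable P Q (\<lambda>x. \<Oplus>\<^bsub>Q\<^esub>K\<in>Pow J - {J}. b x K)"
      using psubset by (intro measurable_stable_finsum) auto
    moreover have "measurable_stable P Q (\<lambda>x. f (z \<oplus>\<^bsub>R\<^esub> (\<Oplus>\<^bsub>R\<^esub>i\<in>J. w i), x))"
      by (rule section_measurable_stable[OF R.increments_uball[OF inc psubset.prems]])
    ultimately show ?case
    proof (rule measurable_stable_diff[OF _ _ coeff_pre_stable[OF psubset.prems]])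
      fix x assume x: "x \<in> uball P"
      note bJ = Q.moebius_Pi[OF b[OF x] psubset.prems]
      have "(\<Oplus>\<^bsub>Q\<^esub>K\<in>Pow J - {J}. b x K) \<in> carrier Q"
        using bJ by (intro Q.finsum_closed) auto
      moreover have "b x J \<in> carrier Q" using bJ by auto
      ultimately show "f (z \<oplus>\<^bsub>R\<^esub> (\<Oplus>\<^bsub>R\<^esub>i\<in>J. w i), x) = (\<Oplus>\<^bsub>Q\<^esub>K\<in>Pow J - {J}. b x K) \<oplus>\<^bsub>Q\<^esub> b x J"
        using Q.moebius_sum[OF b[OF x] psubset.prems] Q.moebius_split[OF psubset.hyps bJ]
        by (simp add: Q.a_comm)
    qed
  qed
qed

end

lemma curry_apply: "z \<in> uball R \<Longrightarrow> x \<in> uball P \<Longrightarrow> cone_curry R P f z x = f (z, x)"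
  by (simp add: cone_curry_def)

lemma curry_section:
  assumes "z \<in> uball R"
  shows "cone_curry R P f z \<in> Cstab P Q"
  using Cstab_restrict[OF P.measurable_cone_axioms Q.measurable_cone_axioms
      section_measurable_stable[OF assms] f_uball[OF assms]] assms
  by (simp add: cone_curry_def)

sublocale F: measurable_cone "fun_cone P Q"
  by (rule fun_cone_measurable)

sublocale G: two_mcones R "fun_cone P Q"
  by unfold_locales

lemma curry_carrier: "z \<in> uball R \<Longrightarrow> cone_curry R P f z \<in> carrier (fun_cone P Q)"
  using curry_section F.uball_carrier by (simp add: uball_fun_cone)

text \<open>Coefficients chosen separately for each \<open>x\<close> assemble into functions of
  \<open>x\<close>, and \<open>coeff_measurable_stable\<close> places these in the function space.
  Sums there are pointwise, so they expand the curried function.\<close>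

lemma curry_pre_stable: "pre_stable R (fun_cone P Q) (cone_curry R P f)"
proof (rule G.pre_stableI)
  show "cone_curry R P f z \<in> carrier (fun_cone P Q)" if "z \<in> uball R" for z
    using curry_carrier[OF that] .
  fix A :: "nat set" and z w assume inc: "increments R A z w"
  let ?z = "\<lambda>I. z \<oplus>\<^bsub>R\<^esub> (\<Oplus>\<^bsub>R\<^esub>i\<in>I. w i)"
  have A: "finite A" by (rule R.increments_finite[OF inc])
  have wc: "w a \<in> carrier R" if "a \<in> A" for a using R.increments_Pi[OF inc subset_refl] that by auto
  have "\<forall>x\<in>uball P. \<exists>b. moebius Q A (\<lambda>I. f (?z I, x)) b"
  proof
    fix x assume x: "x \<in> uball P"
    \<comment> \<open>Zero increments in the second argument hold \<open>x\<close> fixed, so an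
      expansion of \<open>f\<close> on the product is one of \<open>f (_, x)\<close>.\<close>
    have "increments P A x (\<lambda>_. \<zero>\<^bsub>P\<^esub>)"
      using x A by (simp add: increments_def P.uball_carrier)
    with inc have inc': "increments (prod_cone R P) A (z, x) (\<lambda>i. (w i, \<zero>\<^bsub>P\<^esub>))"
      by (simp add: RP.increments_prod_cone)
    from H.pre_stable_expansion[OF f_pre_stable this] obtain b where
      b: "moebius Q A (\<lambda>I. f ((z, x) \<oplus>\<^bsub>prod_cone R P\<^esub> (\<Oplus>\<^bsub>prod_cone R P\<^esub>i\<in>I. (w i, \<zero>\<^bsub>P\<^esub>)))) b"
      by (auto simp: expansion_def)
    have "moebius Q A (\<lambda>I. f (?z I, x)) b"
    proof (rule Q.moebius_cong[OF b])
      fix I assume I: "I \<subseteq> A"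
      have "(\<Oplus>\<^bsub>prod_cone R P\<^esub>i\<in>I. (w i, \<zero>\<^bsub>P\<^esub>)) = (\<Oplus>\<^bsub>R\<^esub>i\<in>I. w i, \<zero>\<^bsub>P\<^esub>)"
        using RP.finsum_prod_cone[of I "\<lambda>i. (w i, \<zero>\<^bsub>P\<^esub>)"] I wc finite_subset[OF I A] by auto
      then show "f ((z, x) \<oplus>\<^bsub>prod_cone R P\<^esub> (\<Oplus>\<^bsub>prod_cone R P\<^esub>i\<in>I. (w i, \<zero>\<^bsub>P\<^esub>))) = f (?z I, x)"
        using P.uball_carrier[OF x] by (simp add: add_prod_cone)
    qed
    then show "\<exists>b. moebius Q A (\<lambda>I. f (?z I, x)) b" by blast
  qed
  from bchoice[OF this] obtain b where b: "\<And>x. x \<in> uball P \<Longrightarrow> moebius Q A (\<lambda>I. f (?z I, x)) (b x)"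
    by blast
  let ?b = "\<lambda>J. \<lambda>x\<in>uball P. b x J"
  have bc: "?b J \<in> carrier (fun_cone P Q)" if "J \<subseteq> A" for J
    by (rule fun_carrier_restrict[OF coeff_measurable_stable[OF inc b that]])
  have "moebius (fun_cone P Q) A (\<lambda>I. cone_curry R P f (?z I)) ?b"
    unfolding moebius_def
  proof (intro conjI ballI)
    show "?b \<in> Pow A \<rightarrow> carrier (fun_cone P Q)" using bc by blast
    fix I assume "I \<in> Pow A"
    then have I: "I \<subseteq> A" "finite (Pow I)" "?b \<in> Pow I \<rightarrow> carrier (fun_cone P Q)"
      using A bc by (auto intro: finite_subset simp del: restrict_apply)
    have zI: "?z I \<in> uball R" by (rule R.increments_uball[OF inc I(1)])
    show "cone_curry R P f (?z I) = (\<Oplus>\<^bsub>fun_cone P Q\<^esub>J\<in>Pow I. ?b J)"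
    proof (rule fun_ext[OF curry_carrier[OF zI] F.finsum_closed[OF I(3)]])
      fix x assume x: "x \<in> uball P"
      then show "cone_curry R P f (?z I) x = (\<Oplus>\<^bsub>fun_cone P Q\<^esub>J\<in>Pow I. ?b J) x"
        using finsum_fun_cone[OF I(2,3) x] Q.moebius_sum[OF b[OF x] I(1)] curry_apply[OF zI x] by simp
    qed
  qed
  then show "\<exists>b. expansion R (fun_cone P Q) (cone_curry R P f) A z w b"
    by (auto simp: expansion_def simp del: restrict_apply)
qed

text \<open>Least upper bounds in the function space are pointwise, so continuity reduces to that of
  \<open>f\<close> along chains whose second component is constant. The tests of the function space
  consist of paths in \<open>P\<close>, so measurability reduces to that of \<open>f\<close> along
  paths in the product.\<close>

lemma curry_measurable_stable: "measurable_stable R (fun_cone P Q) (cone_curry R P f)"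
proof (rule G.measurable_stableI)
  show "stable R (fun_cone P Q) (cone_curry R P f)"
  proof (rule G.stableI[where \<alpha> = 1, OF curry_pre_stable])
    show "cnorm (fun_cone P Q) (cone_curry R P f z) \<le> 1" if "z \<in> uball R" for z
      using curry_section[OF that] by (simp add: uball_def flip: uball_fun_cone)
    fix s z assume s: "uball_chain R s" "z \<in> uball R" "is_lub_seq R s z"
    have su: "s n \<in> uball R" for n using s(1) by (simp add: uball_chain_def)
    have chain: "uball_chain (fun_cone P Q) (\<lambda>n. cone_curry R P f (s n))"
      using G.pre_stable_mono[OF curry_pre_stable _ su] s(1) curry_section[OF su]
      by (simp add: uball_chain_def uball_fun_cone)
    show "is_lub_seq (fun_cone P Q) (\<lambda>n. cone_curry R P f (s n)) (cone_curry R P f z)"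
      unfolding fun_cone_lub_iff[OF chain curry_carrier[OF s(2)]]
    proof
      fix x assume x: "x \<in> uball P"
      have "uball_chain (prod_cone R P) (\<lambda>n. (s n, x))"
        using s(1) x by (simp add: uball_chain_def uball_prod_cone le_prod_cone P.le_refl P.uball_carrier)
      moreover have "(z, x) \<in> uball (prod_cone R P)"
        using s(2) x by (simp add: uball_prod_cone)
      moreover have "is_lub_seq (prod_cone R P) (\<lambda>n. (s n, x)) (z, x)"
        using s(3) x by (simp add: lub_prod_cone P.lub_const P.uball_carrier)
      ultimately have "is_lub_seq Q (\<lambda>n. f (s n, x)) (f (z, x))"
        by (rule H.stable_lub[OF f_stable])
      then show "is_lub_seq Q (\<lambda>n. cone_curry R P f (s n) x) (cone_curry R P f z x)"
        by (simp add: curry_apply su s(2) x)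
    qed
  qed
  fix n \<gamma> k l assume \<gamma>: "\<gamma> \<in> uball_paths R n" and "l \<in> tests (fun_cone P Q) k"
  then obtain \<delta> m where \<delta>: "\<delta> \<in> uball_paths P k" and m: "m \<in> tests Q k" and l: "l = path_test P Q k \<delta> m"
    by (auto simp: tests_fun_cone)
  \<comment> \<open>The parameter of the test drives both \<open>\<delta>\<close> and
    \<open>m\<close>, so \<open>\<delta>\<close> is read on the first coordinates and
    \<open>\<gamma>\<close> on the remaining ones; together they form a single path in the
    product.\<close>
  have "(\<lambda>w. (\<gamma> (last_coords k n w), \<delta> (first_coords k w))) \<in> uball_paths (prod_cone R P) (k + n)"
    using uball_paths_compose[OF \<gamma> last_coords_measurable] uball_paths_compose[OF \<delta> first_coords_measurable]
    by (simp add: RP.uball_paths_prod_cone)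
  from H.measurable_stable_path[OF f_measurable_stable this]
  have "(\<lambda>w. m (first_coords k w) (f (\<gamma> (last_coords k n w), \<delta> (first_coords k w)))) \<in> borel_measurable (Rn (k + n))"
    by (rule path_measurable[OF _ m first_coords_measurable measurable_ident_sets[OF refl]])
  then show "(\<lambda>w. l (first_coords k w) (cone_curry R P f (\<gamma> (last_coords k n w)))) \<in> borel_measurable (Rn (k + n))"
    by (simp add: l path_test_apply[OF coords_space curry_carrier[OF uball_paths_uball[OF \<gamma> coords_space]]]
        curry_apply uball_paths_uball[OF \<gamma> coords_space] uball_paths_uball[OF \<delta> coords_space])
qed

lemma Cstab_curry: "cone_curry R P f \<in> Cstab R (fun_cone P Q)"
proof -
  have "(\<lambda>z\<in>uball R. cone_curry R P f z) \<in> Cstab R (fun_cone P Q)"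
    using Cstab_restrict[OF R.measurable_cone_axioms F.measurable_cone_axioms curry_measurable_stable]
      curry_section by (simp add: uball_fun_cone)
  moreover have "(\<lambda>z\<in>uball R. cone_curry R P f z) = cone_curry R P f"
    by (auto simp: cone_curry_def restrict_def)
  ultimately show ?thesis by simp
qed

lemma Ev_curry: "z \<in> uball R \<Longrightarrow> x \<in> uball P \<Longrightarrow> Ev P Q (cone_curry R P f z, x) = f (z, x)"
  by (simp add: Ev_apply curry_section curry_apply)

lemma curry_unique:
  assumes g: "g \<in> Cstab R (fun_cone P Q)" and eq: "\<And>z x. z \<in> uball R \<Longrightarrow> x \<in> uball P \<Longrightarrow> Ev P Q (g z, x) = f (z, x)"
  shows "g = cone_curry R P f"
proof (rule extensionalityI[OF Cstab_extensional[OF g] Cstab_extensional[OF Cstab_curry]])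
  fix z assume z: "z \<in> uball R"
  have gz: "g z \<in> Cstab P Q" using Cstab_apply[OF g z] by (simp add: uball_fun_cone)
  show "g z = cone_curry R P f z"
  proof (rule extensionalityI[OF Cstab_extensional[OF gz] Cstab_extensional[OF curry_section[OF z]]])
    show "g z x = cone_curry R P f z x" if "x \<in> uball P" for x
      using eq[OF z that] that z by (simp add: Ev_apply[OF gz] curry_apply)
  qed
qed

end

section \<open>Assembly of the cartesian closed structure\<close>

theorem theorem6p8:
  fixes P :: "'p mcone" and Q :: "'q mcone" and R :: "'r mcone" and S :: "'s mcone"
  assumes P: "measurable_complete_cone P" and Q: "measurable_complete_cone Q"
    and R: "measurable_complete_cone R" and S: "measurable_complete_cone S"
  shows
     "\<comment> \<open>category\<close>
      (cone_id P \<in> Cstab P P) \<and>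
      (\<forall>f\<in>Cstab P Q. \<forall>g\<in>Cstab Q R. cone_comp P g f \<in> Cstab P R) \<and>
      (\<forall>f\<in>Cstab P Q. cone_comp P f (cone_id P) = f \<and> cone_comp P (cone_id Q) f = f) \<and>
      (\<forall>f\<in>Cstab P Q. \<forall>g\<in>Cstab Q R. \<forall>h\<in>Cstab R S.
       cone_comp P h (cone_comp P g f) = cone_comp P (cone_comp Q h g) f) \<and>
      \<comment> \<open>terminal object\<close>
      (measurable_complete_cone one_cone) \<and>
      (\<exists>!f. f \<in> Cstab R one_cone) \<and>
      \<comment> \<open>binary products\<close>
      (measurable_complete_cone (prod_cone P Q)) \<and>
      (cone_fst P Q \<in> Cstab (prod_cone P Q) P) \<and>
      (cone_snd P Q \<in> Cstab (prod_cone P Q) Q) \<and>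
      (\<forall>f\<in>Cstab R P. \<forall>g\<in>Cstab R Q. \<exists>!h. h \<in> Cstab R (prod_cone P Q) \<and>
       cone_comp R (cone_fst P Q) h = f \<and> cone_comp R (cone_snd P Q) h = g) \<and>
      \<comment> \<open>exponentials\<close>
      (measurable_complete_cone (fun_cone P Q)) \<and>
      (uball (prod_cone (fun_cone P Q) P) = uball (fun_cone P Q) \<times> uball P) \<and>
      (Ev P Q \<in> Cstab (prod_cone (fun_cone P Q) P) Q) \<and>
      (\<forall>f\<in>Cstab (prod_cone R P) Q.
       (\<exists>!g. g \<in> Cstab R (fun_cone P Q) \<and>
          (\<forall>z\<in>uball R. \<forall>x\<in>uball P. Ev P Q (g z, x) = f (z, x))) \<and>
       cone_curry R P f \<in> Cstab R (fun_cone P Q) \<and>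
       (\<forall>z\<in>uball R. \<forall>x\<in>uball P. Ev P Q (cone_curry R P f z, x) = f (z, x)))"
proof -
  interpret P: measurable_complete_cone P by (rule P)
  interpret Q: measurable_complete_cone Q by (rule Q)
  interpret R: measurable_complete_cone R by (rule R)
  interpret PQ: complete_mcone_pair P Q by unfold_locales
  have comp_id: "cone_comp P f (cone_id P) = f \<and> cone_comp P (cone_id Q) f = f" if f: "f \<in> Cstab P Q" for f
    using Cstab_extensional[OF f] Cstab_apply[OF f]
    by (auto simp: cone_comp_def cone_id_def compose_def restrict_def extensional_def fun_eq_iff)
  \<comment> \<open>The restriction built into \<open>cone_comp Q h g\<close> is invisible here
    because \<open>f\<close> maps into \<open>uball Q\<close>.\<close>
  have comp_assoc: "cone_comp P h (cone_comp P g f) = cone_comp P (cone_comp Q h g) f"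
    if f: "f \<in> Cstab P Q" for f and g :: "'q \<Rightarrow> 'r" and h :: "'r \<Rightarrow> 's"
    using Cstab_apply[OF f] by (auto simp: cone_comp_def compose_def restrict_def fun_eq_iff)
  have prod: "measurable_complete_cone (prod_cone P Q)"
    using PQ.prod_cone_measurable prod_cone_complete[OF P.complete_pcone_axioms Q.complete_pcone_axioms]
    by (rule measurable_complete_cone.intro)
  have fun_cone: "measurable_complete_cone (fun_cone P Q)"
    using PQ.fun_cone_measurable PQ.fun_cone_complete by (rule measurable_complete_cone.intro)
  have exponential: "(\<exists>!g. g \<in> Cstab R (fun_cone P Q) \<and>
          (\<forall>z\<in>uball R. \<forall>x\<in>uball P. Ev P Q (g z, x) = f (z, x))) \<and>
       cone_curry R P f \<in> Cstab R (fun_cone P Q) \<and>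
       (\<forall>z\<in>uball R. \<forall>x\<in>uball P. Ev P Q (cone_curry R P f z, x) = f (z, x))"
    if f: "f \<in> Cstab (prod_cone R P) Q" for f
  proof -
    interpret C: currying P Q R f by unfold_locales (rule f)
    show ?thesis
      by (intro conjI ex1I[of _ "cone_curry R P f"] ballI C.Cstab_curry C.Ev_curry C.curry_unique) auto
  qed
  show ?thesis
    by (intro conjI ballI uball_prod_cone exponential fun_cone prod comp_assoc
        Cstab_id[OF P.measurable_cone_axioms] PQ.Cstab_Ev PQ.Cstab_fst PQ.Cstab_snd
        Cstab_comp[OF P.measurable_cone_axioms Q.measurable_cone_axioms R.measurable_cone_axioms]
        one_cone_measurable_complete terminal_unique[OF R.measurable_cone_axioms]
        PQ.product_universal[OF R.measurable_cone_axioms]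
        conjunct1[OF comp_id] conjunct2[OF comp_id])
      (use exponential in blast)+
qed

end
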